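(* Let $B$ be a separable graded $C^*$-algebra with grading automorphism $\beta$. Endow the crossed product $B\rtimes_\beta\mathbb{Z}_2$ with the grading $\hat\beta$ given by the dual action, i.e. the automorphism that fixes $B$ pointwise and sends the canonical self-adjoint unitary implementing $\beta$ to its negative. Then for $i=0,1$ $$K^{\mathrm{gr}}_i(B\rtimes_\beta\mathbb{Z}_2)\cong K^{\mathrm{gr}}_i(B\widehat\otimes\mathbb{C}\mathrm{liff}_1)= K^{\mathrm{gr}}_{i+1}(B).$$
   Context: A grading of a $C^*$-algebra $A$ is an automorphism $\alpha$ with $\alpha^2=1$; elements with $\alpha(a)=a$ are even (degree $0$), those with $\alpha(a)=-a$ odd (degree $1$); $\partial a$ is the degree. The graded tensor product $A\widehat\otimes B$ of $(A,\alpha)$ and $(B,\beta)$ is the completion in the minimal norm of the algebraic tensor product with, for homogeneous elements, $(a\widehat\otimes b)(a'\widehat\otimes b')=(-1)^{\partial b\cdot\partial a'}aa'\widehat\otimes bb'$ and $(a\widehat\otimes b)^*=(-1)^{\partial a\cdot\partial b}a^*\widehat\otimes b^*$, with grading $\alpha\widehat\otimes\beta$. $\mathbb{C}\mathrm{liff}_1$ is $\mathbb{C}\oplus\mathbb{C}$ with grading $(z,w)\mapsto(w,z)$, and $\mathbb{C}\mathrm{liff}_{n+1}=\mathbb{C}\mathrm{liff}_n\widehat\otimes\mathbb{C}\mathrm{liff}_1$. For a separable graded $C^*$-algebra $A$, $K^{\mathrm{gr}}_0(A):=KK(\mathbb{C},A)$ and $K^{\mathrm{gr}}_j(A):=KK(\mathbb{C},A\widehat\otimes\mathbb{C}\mathrm{liff}_j)$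 for $j\ge1$, where $KK$ is Kasparov's $KK$-theory of graded $C^*$-algebras and $\mathbb{C}$ is trivially graded. By Bott periodicity $K^{\mathrm{gr}}_{j+2}(A)\cong K^{\mathrm{gr}}_j(A)$, so indices may be read modulo $2$. *)

theory Defs
  imports Complex_Main "HOL-Library.Countable_Set" "HOL-Algebra.FiniteProduct"
begin

section \<open>Complex vector spaces on a carrier\<close>

record 'v cspace = "'v partial_object" +
  vadd :: "'v \<Rightarrow> 'v \<Rightarrow> 'v" (infixl "\<boxplus>\<index>" 65)
  vzero :: "'v"
  vscale :: "complex \<Rightarrow> 'v \<Rightarrow> 'v" (infixr "\<odot>\<index>" 75)

definition add_grp :: "('v, 'm) cspace_scheme \<Rightarrow> 'v monoid" where
  "add_grp V = \<lparr>carrier = carrier V, monoid.mult = vadd V, one = vzero V\<rparr>"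

abbreviation vsum :: "('v, 'm) cspace_scheme \<Rightarrow> ('k \<Rightarrow> 'v) \<Rightarrow> 'k set \<Rightarrow> 'v" where
  "vsum V f I \<equiv> finprod (add_grp V) f I"

definition vdiff :: "('v, 'm) cspace_scheme \<Rightarrow> 'v \<Rightarrow> 'v \<Rightarrow> 'v" where
  "vdiff V x y = x \<boxplus>\<^bsub>V\<^esub> ((- 1) \<odot>\<^bsub>V\<^esub> y)"

locale complex_space =
  fixes V :: "('v, 'm) cspace_scheme" (structure)
  assumes add_comm_group: "comm_group (add_grp V)"
    and scale_closed: "x \<in> carrier V \<Longrightarrow> c \<odot> x \<in> carrier V"
    and scale_add: "x \<in> carrier V \<Longrightarrow> y \<in> carrier V \<Longrightarrow> c \<odot> (x \<boxplus> y) = (c \<odot> x) \<boxplus> (c \<odot> y)"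
    and add_scale: "x \<in> carrier V \<Longrightarrow> (c + d) \<odot> x = (c \<odot> x) \<boxplus> (d \<odot> x)"
    and scale_scale: "x \<in> carrier V \<Longrightarrow> c \<odot> d \<odot> x = (c * d) \<odot> x"
    and scale_one: "x \<in> carrier V \<Longrightarrow> 1 \<odot> x = x"

definition clinear_map ::
  "('v, 'm) cspace_scheme \<Rightarrow> ('w, 'n) cspace_scheme \<Rightarrow> ('v \<Rightarrow> 'w) \<Rightarrow> bool" where
  "clinear_map V W f \<longleftrightarrow>
     (\<forall>x\<in>carrier V. f x \<in> carrier W) \<and>
     (\<forall>x\<in>carrier V. \<forall>y\<in>carrier V. f (x \<boxplus>\<^bsub>V\<^esub> y) = f x \<boxplus>\<^bsub>W\<^esub> f y) \<and>
     (\<forall>c. \<forall>x\<in>carrier V. f (c \<odot>\<^bsub>V\<^esub> x) = c \<odot>\<^bsub>W\<^esub> f x)"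

definition cspan :: "('v, 'm) cspace_scheme \<Rightarrow> 'v set \<Rightarrow> 'v set" where
  "cspan V S = {vsum V (\<lambda>k. c k \<odot>\<^bsub>V\<^esub> s k) {..<n} | n c s. \<forall>k<n::nat. s k \<in> S}"

definition cdense :: "('v, 'm) cspace_scheme \<Rightarrow> ('v \<Rightarrow> real) \<Rightarrow> 'v set \<Rightarrow> bool" where
  "cdense V nrm S \<longleftrightarrow>
     S \<subseteq> carrier V \<and> (\<forall>x\<in>carrier V. \<forall>\<epsilon>>0. \<exists>s\<in>S. nrm (vdiff V x s) < \<epsilon>)"

definition ccomplete :: "('v, 'm) cspace_scheme \<Rightarrow> ('v \<Rightarrow> real) \<Rightarrow> bool" where
  "ccomplete V nrm \<longleftrightarrow>
     (\<forall>X. (\<forall>n::nat. X n \<in> carrier V) \<and>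
          (\<forall>\<epsilon>>0. \<exists>N. \<forall>m\<ge>N. \<forall>n\<ge>N. nrm (vdiff V (X m) (X n)) < \<epsilon>)
        \<longrightarrow> (\<exists>l\<in>carrier V. (\<lambda>n. nrm (vdiff V (X n) l)) \<longlonglongrightarrow> 0))"

section \<open>Graded C*-algebras\<close>

record 'a graded_star = "'a cspace" +
  amult :: "'a \<Rightarrow> 'a \<Rightarrow> 'a" (infixl "\<star>\<index>" 70)
  adj :: "'a \<Rightarrow> 'a"
  grading :: "'a \<Rightarrow> 'a"

record 'a graded_cstar = "'a graded_star" +
  anorm :: "'a \<Rightarrow> real"

locale graded_star_algebra = complex_space A
  for A :: "('a, 'm) graded_star_scheme" (structure) +
  assumes mult_closed: "a \<in> carrier A \<Longrightarrow> b \<in> carrier A \<Longrightarrow> a \<star> b \<in> carrier A"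
    and mult_assoc: "a \<in> carrier A \<Longrightarrow> b \<in> carrier A \<Longrightarrow> c \<in> carrier A
          \<Longrightarrow> a \<star> b \<star> c = a \<star> (b \<star> c)"
    and mult_add_left: "a \<in> carrier A \<Longrightarrow> b \<in> carrier A \<Longrightarrow> c \<in> carrier A
          \<Longrightarrow> (a \<boxplus> b) \<star> c = (a \<star> c) \<boxplus> (b \<star> c)"
    and mult_add_right: "a \<in> carrier A \<Longrightarrow> b \<in> carrier A \<Longrightarrow> c \<in> carrier A
          \<Longrightarrow> a \<star> (b \<boxplus> c) = (a \<star> b) \<boxplus> (a \<star> c)"
    and mult_scale_left: "a \<in> carrier A \<Longrightarrow> b \<in> carrier A \<Longrightarrow> (z \<odot> a) \<star> b = z \<odot> (a \<star> b)"
    and mult_scale_right: "a \<in> carrier A \<Longrightarrow> b \<in> carrier A \<Longrightarrow> a \<star> (z \<odot> b) = z \<odot> (a \<star> b)"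
    and adj_closed: "a \<in> carrier A \<Longrightarrow> adj A a \<in> carrier A"
    and adj_adj: "a \<in> carrier A \<Longrightarrow> adj A (adj A a) = a"
    and adj_add: "a \<in> carrier A \<Longrightarrow> b \<in> carrier A \<Longrightarrow> adj A (a \<boxplus> b) = adj A a \<boxplus> adj A b"
    and adj_scale: "a \<in> carrier A \<Longrightarrow> adj A (z \<odot> a) = cnj z \<odot> adj A a"
    and adj_mult: "a \<in> carrier A \<Longrightarrow> b \<in> carrier A \<Longrightarrow> adj A (a \<star> b) = adj A b \<star> adj A a"
    and grading_linear: "clinear_map A A (grading A)"
    and grading_mult: "a \<in> carrier A \<Longrightarrow> b \<in> carrier A
          \<Longrightarrow> grading A (a \<star> b) = grading A a \<star> grading A b"
    and grading_adj: "a \<in> carrier A \<Longrightarrow> grading A (adj A a) = adj A (grading A a)"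
    and grading_grading: "a \<in> carrier A \<Longrightarrow> grading A (grading A a) = a"

definition cstar_norm :: "('a, 'm) graded_star_scheme \<Rightarrow> ('a \<Rightarrow> real) \<Rightarrow> bool" where
  "cstar_norm A nrm \<longleftrightarrow>
     (\<forall>a\<in>carrier A. 0 \<le> nrm a \<and> (nrm a = 0 \<longleftrightarrow> a = vzero A)) \<and>
     (\<forall>a\<in>carrier A. \<forall>b\<in>carrier A. nrm (a \<boxplus>\<^bsub>A\<^esub> b) \<le> nrm a + nrm b) \<and>
     (\<forall>z. \<forall>a\<in>carrier A. nrm (z \<odot>\<^bsub>A\<^esub> a) = cmod z * nrm a) \<and>
     (\<forall>a\<in>carrier A. \<forall>b\<in>carrier A. nrm (a \<star>\<^bsub>A\<^esub> b) \<le> nrm a * nrm b) \<and>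
     (\<forall>a\<in>carrier A. nrm (adj A a \<star>\<^bsub>A\<^esub> a) = (nrm a)\<^sup>2)"

locale graded_cstar_algebra = graded_star_algebra A
  for A :: "('a, 'm) graded_cstar_scheme" (structure) +
  assumes norm_cstar: "cstar_norm A (anorm A)"
    and norm_complete: "ccomplete A (anorm A)"

definition separable_cstar :: "('a, 'm) graded_cstar_scheme \<Rightarrow> bool" where
  "separable_cstar A \<longleftrightarrow> (\<exists>S. countable S \<and> cdense A (anorm A) S)"

text \<open>The least C*-norm.  It is used only for algebras of finite rank over a given C*-algebra
  (graded tensor products with a Clifford algebra and crossed products by a group of order two).
  Such a *-algebra is already complete in a C*-norm, and therefore has exactly one C*-norm, so that
  no completion is needed, and the minimal (reduced) and maximal (full) norms coincide with it.\<close>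

definition least_cstar_norm :: "('a, 'm) graded_star_scheme \<Rightarrow> 'a \<Rightarrow> real" where
  "least_cstar_norm A a = (INF nrm\<in>{nrm. cstar_norm A nrm}. nrm a)"

definition with_least_norm :: "'a graded_star \<Rightarrow> 'a graded_cstar" where
  "with_least_norm A = graded_star.extend A (graded_cstar.fields (least_cstar_norm A))"

definition complex_alg :: "complex graded_cstar" where
  "complex_alg = \<lparr>carrier = UNIV, vadd = (+), vzero = 0, vscale = (*), amult = (*), adj = cnj,
     grading = (\<lambda>z. z), anorm = cmod\<rparr>"

definition cylinder :: "'a graded_cstar \<Rightarrow> (real \<Rightarrow> 'a) graded_cstar" where  \<comment> \<open>\<open>C([0,1], A)\<close>\<close>
  "cylinder A =
     \<lparr>carrier = {f \<in> {0..1} \<rightarrow>\<^sub>E carrier A.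
        \<forall>t\<in>{0..1}. ((\<lambda>s. anorm A (vdiff A (f s) (f t))) \<longlongrightarrow> 0) (at t within {0..1})},
      vadd = (\<lambda>f g. \<lambda>t\<in>{0..1}. f t \<boxplus>\<^bsub>A\<^esub> g t),
      vzero = (\<lambda>t\<in>{0..1}. vzero A),
      vscale = (\<lambda>z f. \<lambda>t\<in>{0..1}. z \<odot>\<^bsub>A\<^esub> f t),
      amult = (\<lambda>f g. \<lambda>t\<in>{0..1}. f t \<star>\<^bsub>A\<^esub> g t),
      adj = (\<lambda>f. \<lambda>t\<in>{0..1}. adj A (f t)),
      grading = (\<lambda>f. \<lambda>t\<in>{0..1}. grading A (f t)),
      anorm = (\<lambda>f. SUP t\<in>{0..1}. anorm A (f t))\<rparr>"

section \<open>Graded tensor products with Clifford algebras\<close>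

text \<open>The component of degree \<open>s mod 2\<close> of an element.\<close>

definition hom_part :: "('a, 'm) graded_star_scheme \<Rightarrow> nat \<Rightarrow> 'a \<Rightarrow> 'a" where
  "hom_part A s a = (1 / 2) \<odot>\<^bsub>A\<^esub> (a \<boxplus>\<^bsub>A\<^esub> ((- 1) ^ s \<odot>\<^bsub>A\<^esub> grading A a))"

text \<open>The second factor \<open>D\<close> of a graded tensor product is a finite-dimensional algebra with
  underlying vector space \<open>\<complex>\<^sup>m\<close>, realised as the functions on \<open>{..<m}\<close>; its standard basis \<open>e\<^sub>k\<close>
  need not be homogeneous.  The algebraic tensor product of \<open>A\<close> and \<open>D\<close> then consists of the families
  \<open>x\<close> of \<open>m\<close> elements of \<open>A\<close>, standing for the sum of the \<open>x\<^sub>k \<otimes> e\<^sub>k\<close>.  Product and adjoint are the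
  (sesqui)linear extensions of the formulas
  \<open>(a \<otimes> b)(a' \<otimes> b') = (-1)\<^bsup>\<partial>b\<cdot>\<partial>a'\<^esup> aa' \<otimes> bb'\<close> and \<open>(a \<otimes> b)\<^sup>* = (-1)\<^bsup>\<partial>a\<cdot>\<partial>b\<^esup> a\<^sup>* \<otimes> b\<^sup>*\<close> for
  homogeneous elements: below, \<open>s\<close> and \<open>t\<close> run over the degrees of the components of the second
  and the first tensor factor that enter the sign.\<close>

definition std_basis :: "nat \<Rightarrow> nat \<Rightarrow> nat \<Rightarrow> complex" where
  "std_basis m k = (\<lambda>i\<in>{..<m}. if i = k then 1 else 0)"

definition gtensor_alg ::
  "('a, 'n) graded_star_scheme \<Rightarrow> nat \<Rightarrow> (nat \<Rightarrow> complex, 'o) graded_star_scheme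
     \<Rightarrow> (nat \<Rightarrow> 'a) graded_star" where
  "gtensor_alg A m D =
     \<lparr>carrier = {..<m} \<rightarrow>\<^sub>E carrier A,
      vadd = (\<lambda>x y. \<lambda>p\<in>{..<m}. x p \<boxplus>\<^bsub>A\<^esub> y p),
      vzero = (\<lambda>p\<in>{..<m}. vzero A),
      vscale = (\<lambda>z x. \<lambda>p\<in>{..<m}. z \<odot>\<^bsub>A\<^esub> x p),
      amult = (\<lambda>x y. \<lambda>p\<in>{..<m}. vsum A
        (\<lambda>(k, l, s, t). ((- 1) ^ (s * t) * (hom_part D s (std_basis m k) \<star>\<^bsub>D\<^esub> std_basis m l) p)
            \<odot>\<^bsub>A\<^esub> (x k \<star>\<^bsub>A\<^esub> hom_part A t (y l)))
        ({..<m} \<times> {..<m} \<times> {..<2} \<times> {..<2})),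
      adj = (\<lambda>x. \<lambda>p\<in>{..<m}. vsum A
        (\<lambda>(k, s, t). ((- 1) ^ (s * t) * adj D (hom_part D s (std_basis m k)) p)
            \<odot>\<^bsub>A\<^esub> adj A (hom_part A t (x k)))
        ({..<m} \<times> {..<2} \<times> {..<2})),
      grading = (\<lambda>x. \<lambda>p\<in>{..<m}. vsum A
        (\<lambda>k. grading D (std_basis m k) p \<odot>\<^bsub>A\<^esub> grading A (x k)) {..<m})\<rparr>"

definition gtensor ::
  "('a, 'n) graded_star_scheme \<Rightarrow> nat \<Rightarrow> (nat \<Rightarrow> complex, 'o) graded_star_scheme
     \<Rightarrow> (nat \<Rightarrow> 'a) graded_cstar" where
  "gtensor A m D = with_least_norm (gtensor_alg A m D)"

definition transport_alg :: "('a \<Rightarrow> 'b) \<Rightarrow> ('b \<Rightarrow> 'a) \<Rightarrow> 'a graded_cstar \<Rightarrow> 'b graded_cstar" where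
  "transport_alg h g A =
     \<lparr>carrier = h ` carrier A,
      vadd = (\<lambda>x y. h (g x \<boxplus>\<^bsub>A\<^esub> g y)),
      vzero = h (vzero A),
      vscale = (\<lambda>z x. h (z \<odot>\<^bsub>A\<^esub> g x)),
      amult = (\<lambda>x y. h (g x \<star>\<^bsub>A\<^esub> g y)),
      adj = (\<lambda>x. h (adj A (g x))),
      grading = (\<lambda>x. h (grading A (g x))),
      anorm = (\<lambda>x. anorm A (g x))\<rparr>"

definition cliff_one :: "(nat \<Rightarrow> complex) graded_cstar" where  \<comment> \<open>\<open>\<complex> \<oplus> \<complex>\<close> with the flip\<close>
  "cliff_one =
     \<lparr>carrier = {..<2} \<rightarrow>\<^sub>E UNIV,
      vadd = (\<lambda>x y. \<lambda>k\<in>{..<2}. x k + y k),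
      vzero = (\<lambda>k\<in>{..<2}. 0),
      vscale = (\<lambda>z x. \<lambda>k\<in>{..<2}. z * x k),
      amult = (\<lambda>x y. \<lambda>k\<in>{..<2}. x k * y k),
      adj = (\<lambda>x. \<lambda>k\<in>{..<2}. cnj (x k)),
      grading = (\<lambda>x. \<lambda>k\<in>{..<2}. x (1 - k)),
      anorm = (\<lambda>x. max (cmod (x 0)) (cmod (x 1)))\<rparr>"

text \<open>To keep one type for all \<open>n\<close>, the underlying vector space \<open>(\<complex>\<^bsup>M\<^esup>)\<^sup>2\<close> of the tensor product
  of \<open>Cliff\<^sub>n\<close> (with \<open>M = 2\<^sup>n\<close>) and \<open>Cliff\<^sub>1\<close> is identified with \<open>\<complex>\<^bsup>2M\<^esup>\<close> by the
  re-indexing \<open>(j, i) \<mapsto> 2i + j\<close>.  The value at \<open>0\<close> is the usual convention \<open>Cliff\<^sub>0 = \<complex>\<close>.\<close>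

definition pack :: "nat \<Rightarrow> (nat \<Rightarrow> nat \<Rightarrow> complex) \<Rightarrow> nat \<Rightarrow> complex" where
  "pack M x = (\<lambda>k\<in>{..<2 * M}. x (k mod 2) (k div 2))"

definition unpack :: "nat \<Rightarrow> (nat \<Rightarrow> complex) \<Rightarrow> nat \<Rightarrow> nat \<Rightarrow> complex" where
  "unpack M y = (\<lambda>j\<in>{..<2}. \<lambda>i\<in>{..<M}. y (2 * i + j))"

fun cliff :: "nat \<Rightarrow> (nat \<Rightarrow> complex) graded_cstar" where
  "cliff 0 = transport_alg (\<lambda>z. \<lambda>k\<in>{..<1}. z) (\<lambda>x. x 0) complex_alg"
| "cliff (Suc 0) = cliff_one"
| "cliff (Suc (Suc n)) =
     transport_alg (pack (2 ^ Suc n)) (unpack (2 ^ Suc n)) (gtensor (cliff (Suc n)) 2 cliff_one)"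

abbreviation tensor_cliff ::
  "('a, 'n) graded_star_scheme \<Rightarrow> nat \<Rightarrow> (nat \<Rightarrow> 'a) graded_cstar" (infixl "\<otimes>Cliff" 70) where
  "A \<otimes>Cliff n \<equiv> gtensor A (2 ^ n) (cliff n)"

section \<open>The crossed product by the grading automorphism\<close>

text \<open>The pair \<open>(a, b)\<close> stands for \<open>a + bu\<close>, where \<open>u\<close> is the canonical self-adjoint unitary, with
  \<open>u b u\<^sup>* = \<beta>(b)\<close>.  The grading is the dual action: it fixes \<open>B\<close> and maps \<open>u\<close> to \<open>-u\<close>;
  the given grading \<open>\<beta>\<close> of \<open>B\<close> enters only through the product and the adjoint.\<close>

definition crossed_alg :: "('b, 'm) graded_star_scheme \<Rightarrow> ('b \<times> 'b) graded_star" where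
  "crossed_alg B = (let \<beta> = grading B in
     \<lparr>carrier = carrier B \<times> carrier B,
      vadd = (\<lambda>(a, b) (c, d). (a \<boxplus>\<^bsub>B\<^esub> c, b \<boxplus>\<^bsub>B\<^esub> d)),
      vzero = (vzero B, vzero B),
      vscale = (\<lambda>z (a, b). (z \<odot>\<^bsub>B\<^esub> a, z \<odot>\<^bsub>B\<^esub> b)),
      amult = (\<lambda>(a, b) (c, d).
        ((a \<star>\<^bsub>B\<^esub> c) \<boxplus>\<^bsub>B\<^esub> (b \<star>\<^bsub>B\<^esub> \<beta> d), (a \<star>\<^bsub>B\<^esub> d) \<boxplus>\<^bsub>B\<^esub> (b \<star>\<^bsub>B\<^esub> \<beta> c))),
      adj = (\<lambda>(a, b). (adj B a, \<beta> (adj B b))),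
      grading = (\<lambda>(a, b). (a, (- 1) \<odot>\<^bsub>B\<^esub> b))\<rparr>)"

definition crossed_product :: "('b, 'm) graded_star_scheme \<Rightarrow> ('b \<times> 'b) graded_cstar" where
  "crossed_product B = with_least_norm (crossed_alg B)"

section \<open>Graded Hilbert modules\<close>

record ('a, 'e) hilbert_module = "'e cspace" +
  ract :: "'e \<Rightarrow> 'a \<Rightarrow> 'e" (infixl "\<lhd>\<index>" 70)
  ip :: "'e \<Rightarrow> 'e \<Rightarrow> 'a"
  egrading :: "'e \<Rightarrow> 'e"

definition hnorm ::
  "'a graded_cstar \<Rightarrow> ('a, 'e, 'm) hilbert_module_scheme \<Rightarrow> 'e \<Rightarrow> real" where
  "hnorm A E e = sqrt (anorm A (ip E e e))"

definition positive_element :: "'a graded_cstar \<Rightarrow> 'a \<Rightarrow> bool" where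
  "positive_element A p \<longleftrightarrow> (\<exists>a\<in>carrier A. p = adj A a \<star>\<^bsub>A\<^esub> a)"

locale graded_hilbert_module = complex_space E
  for A :: "'a graded_cstar" and E :: "('a, 'e, 'm) hilbert_module_scheme" (structure) +
  assumes ract_closed: "e \<in> carrier E \<Longrightarrow> a \<in> carrier A \<Longrightarrow> e \<lhd> a \<in> carrier E"
    and ract_add_left: "e \<in> carrier E \<Longrightarrow> f \<in> carrier E \<Longrightarrow> a \<in> carrier A
          \<Longrightarrow> (e \<boxplus> f) \<lhd> a = (e \<lhd> a) \<boxplus> (f \<lhd> a)"
    and ract_add_right: "e \<in> carrier E \<Longrightarrow> a \<in> carrier A \<Longrightarrow> b \<in> carrier A
          \<Longrightarrow> e \<lhd> (a \<boxplus>\<^bsub>A\<^esub> b) = (e \<lhd> a) \<boxplus> (e \<lhd> b)"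
    and ract_scale_left: "e \<in> carrier E \<Longrightarrow> a \<in> carrier A \<Longrightarrow> (z \<odot> e) \<lhd> a = z \<odot> (e \<lhd> a)"
    and ract_scale_right: "e \<in> carrier E \<Longrightarrow> a \<in> carrier A
          \<Longrightarrow> e \<lhd> (z \<odot>\<^bsub>A\<^esub> a) = z \<odot> (e \<lhd> a)"
    and ract_mult: "e \<in> carrier E \<Longrightarrow> a \<in> carrier A \<Longrightarrow> b \<in> carrier A
          \<Longrightarrow> e \<lhd> (a \<star>\<^bsub>A\<^esub> b) = e \<lhd> a \<lhd> b"
    and ip_closed: "e \<in> carrier E \<Longrightarrow> f \<in> carrier E \<Longrightarrow> ip E e f \<in> carrier A"
    and ip_add_right: "e \<in> carrier E \<Longrightarrow> f \<in> carrier E \<Longrightarrow> g \<in> carrier E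
          \<Longrightarrow> ip E e (f \<boxplus> g) = ip E e f \<boxplus>\<^bsub>A\<^esub> ip E e g"
    and ip_scale_right: "e \<in> carrier E \<Longrightarrow> f \<in> carrier E
          \<Longrightarrow> ip E e (z \<odot> f) = z \<odot>\<^bsub>A\<^esub> ip E e f"
    and ip_ract_right: "e \<in> carrier E \<Longrightarrow> f \<in> carrier E \<Longrightarrow> a \<in> carrier A
          \<Longrightarrow> ip E e (f \<lhd> a) = ip E e f \<star>\<^bsub>A\<^esub> a"
    and ip_adj: "e \<in> carrier E \<Longrightarrow> f \<in> carrier E \<Longrightarrow> adj A (ip E e f) = ip E f e"
    and ip_positive: "e \<in> carrier E \<Longrightarrow> positive_element A (ip E e e)"
    and ip_definite: "e \<in> carrier E \<Longrightarrow> ip E e e = vzero A \<Longrightarrow> e = vzero E"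
    and hnorm_complete: "ccomplete E (hnorm A E)"
    and egrading_linear: "clinear_map E E (egrading E)"
    and egrading_egrading: "e \<in> carrier E \<Longrightarrow> egrading E (egrading E e) = e"
    and egrading_ract: "e \<in> carrier E \<Longrightarrow> a \<in> carrier A
          \<Longrightarrow> egrading E (e \<lhd> a) = egrading E e \<lhd> grading A a"
    and egrading_ip: "e \<in> carrier E \<Longrightarrow> f \<in> carrier E
          \<Longrightarrow> ip E (egrading E e) (egrading E f) = grading A (ip E e f)"

definition countably_generated ::
  "'a graded_cstar \<Rightarrow> ('a, 'e, 'm) hilbert_module_scheme \<Rightarrow> bool" where
  "countably_generated A E \<longleftrightarrow>
     (\<exists>G. countable G \<and> G \<subseteq> carrier E \<and>
          cdense E (hnorm A E) (cspan E {g \<lhd>\<^bsub>E\<^esub> a | g a. g \<in> G \<and> a \<in> carrier A}))"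

definition is_adjoint ::
  "('a, 'e, 'm) hilbert_module_scheme \<Rightarrow> ('e \<Rightarrow> 'e) \<Rightarrow> ('e \<Rightarrow> 'e) \<Rightarrow> bool" where
  "is_adjoint E T T' \<longleftrightarrow>
     (\<forall>e\<in>carrier E. T e \<in> carrier E \<and> T' e \<in> carrier E) \<and>
     (\<forall>e\<in>carrier E. \<forall>f\<in>carrier E. ip E (T e) f = ip E e (T' f))"

text \<open>Compact operators: norm limits of finite sums of the operators \<open>e \<mapsto> x\<cdot>\<langle>y, e\<rangle>\<close>.\<close>

definition compact_op ::
  "'a graded_cstar \<Rightarrow> ('a, 'e, 'm) hilbert_module_scheme \<Rightarrow> ('e \<Rightarrow> 'e) \<Rightarrow> bool" where
  "compact_op A E T \<longleftrightarrow>
     (\<exists>T'. is_adjoint E T T') \<and>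
     (\<forall>\<epsilon>>0. \<exists>(n::nat) x y. (\<forall>k<n. x k \<in> carrier E \<and> y k \<in> carrier E) \<and>
        (\<forall>e\<in>carrier E.
           hnorm A E (vdiff E (T e) (vsum E (\<lambda>k. x k \<lhd>\<^bsub>E\<^esub> ip E (y k) e) {..<n}))
             \<le> \<epsilon> * hnorm A E e))"

section \<open>Kasparov modules and KK-groups\<close>

record ('d, 'a, 'e) kasparov = "('a, 'e) hilbert_module" +
  lact :: "'d \<Rightarrow> 'e \<Rightarrow> 'e"
  fop :: "'e \<Rightarrow> 'e"

text \<open>Since \<open>F\<close> is odd, its graded commutator with \<open>\<phi>(d)\<close> is \<open>F\<phi>(d) - \<phi>(\<delta>(d))F\<close>, where \<open>\<delta>\<close> is the
  grading of \<open>D\<close>.\<close>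

definition kasparov_module ::
  "'d graded_cstar \<Rightarrow> 'a graded_cstar \<Rightarrow> ('d, 'a, 'e) kasparov \<Rightarrow> bool" where
  "kasparov_module D A X \<longleftrightarrow>
     graded_hilbert_module A X \<and> countably_generated A X \<and>
     (let \<phi> = lact X; F = fop X; E = carrier X in
      (\<forall>d\<in>carrier D. is_adjoint X (\<phi> d) (\<phi> (adj D d))) \<and>
      (\<forall>d\<in>carrier D. \<forall>d'\<in>carrier D. \<forall>e\<in>E.
         \<phi> (d \<boxplus>\<^bsub>D\<^esub> d') e = \<phi> d e \<boxplus>\<^bsub>X\<^esub> \<phi> d' e \<and> \<phi> (d \<star>\<^bsub>D\<^esub> d') e = \<phi> d (\<phi> d' e)) \<and>
      (\<forall>z. \<forall>d\<in>carrier D. \<forall>e\<in>E. \<phi> (z \<odot>\<^bsub>D\<^esub> d) e = z \<odot>\<^bsub>X\<^esub> \<phi> d e) \<and>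
      (\<forall>d\<in>carrier D. \<forall>e\<in>E. egrading X (\<phi> d e) = \<phi> (grading D d) (egrading X e)) \<and>
      (\<forall>e\<in>E. egrading X (F e) = (- 1) \<odot>\<^bsub>X\<^esub> F (egrading X e)) \<and>
      (\<exists>F'. is_adjoint X F F' \<and>
        (\<forall>d\<in>carrier D.
           compact_op A X (\<lambda>e. vdiff X (F (\<phi> d e)) (\<phi> (grading D d) (F e))) \<and>
           compact_op A X (\<lambda>e. vdiff X (F (F (\<phi> d e))) (\<phi> d e)) \<and>
           compact_op A X (\<lambda>e. vdiff X (F (\<phi> d e)) (F' (\<phi> d e))))))"

text \<open>For a *-homomorphism \<open>f\<close> into \<open>A\<close>, the predicate says that \<open>Y\<close> is unitarily equivalent to the
  internal tensor product of \<open>X\<close> and \<open>A\<close> along \<open>f\<close>, with the induced action and operator: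
  \<open>\<tau> e a\<close> is the elementary tensor, these have the defining inner products and dense span.\<close>

definition is_pushforward ::
  "'d graded_cstar \<Rightarrow> 'a graded_cstar \<Rightarrow> ('c \<Rightarrow> 'a)
     \<Rightarrow> ('d, 'c, 'e) kasparov \<Rightarrow> ('d, 'a, 'f) kasparov \<Rightarrow> bool" where
  "is_pushforward D A f X Y \<longleftrightarrow>
     (\<exists>\<tau>. (\<forall>e\<in>carrier X. \<forall>a\<in>carrier A.
              \<tau> e a \<in> carrier Y \<and>
              (\<forall>b\<in>carrier A. \<tau> e a \<lhd>\<^bsub>Y\<^esub> b = \<tau> e (a \<star>\<^bsub>A\<^esub> b)) \<and>
              egrading Y (\<tau> e a) = \<tau> (egrading X e) (grading A a) \<and>
              (\<forall>d\<in>carrier D. lact Y d (\<tau> e a) = \<tau> (lact X d e) a) \<and>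
              fop Y (\<tau> e a) = \<tau> (fop X e) a) \<and>
          (\<forall>e\<in>carrier X. \<forall>a\<in>carrier A. \<forall>e'\<in>carrier X. \<forall>a'\<in>carrier A.
              ip Y (\<tau> e a) (\<tau> e' a') = adj A a \<star>\<^bsub>A\<^esub> f (ip X e e') \<star>\<^bsub>A\<^esub> a') \<and>
          cdense Y (hnorm A Y) (cspan Y {\<tau> e a | e a. e \<in> carrier X \<and> a \<in> carrier A}))"

text \<open>For separable \<open>A\<close>, a countably generated Hilbert \<open>A\<close>-module is separable and hence has at most
  the cardinality of the continuum.  Up to unitary equivalence its carrier is therefore a set
  of real numbers (whose own algebraic structure plays no role), and such modules suffice to form
  the set of homotopy classes.  The same applies to the modules over \<open>C([0,1], A)\<close> that serve as
  homotopies, and to direct sums.\<close>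

definition kasparov_modules ::
  "'d graded_cstar \<Rightarrow> 'a graded_cstar \<Rightarrow> ('d, 'a, real) kasparov set" where
  "kasparov_modules D A = {X. kasparov_module D A X}"

definition homotopy ::
  "'d graded_cstar \<Rightarrow> 'a graded_cstar \<Rightarrow> ('d, 'a, real) kasparov rel" where
  "homotopy D A =
     {(X, Y) \<in> kasparov_modules D A \<times> kasparov_modules D A.
        \<exists>Z\<in>kasparov_modules D (cylinder A).
          is_pushforward D A (\<lambda>f. f 0) Z X \<and> is_pushforward D A (\<lambda>f. f 1) Z Y}"

definition kasparov_embedding ::
  "'d graded_cstar \<Rightarrow> 'a graded_cstar \<Rightarrow> ('d, 'a, 'e) kasparov \<Rightarrow> ('d, 'a, 'f) kasparov
     \<Rightarrow> ('e \<Rightarrow> 'f) \<Rightarrow> bool" where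
  "kasparov_embedding D A X W i \<longleftrightarrow>
     clinear_map X W i \<and>
     (\<forall>e\<in>carrier X.
        (\<forall>a\<in>carrier A. i (e \<lhd>\<^bsub>X\<^esub> a) = i e \<lhd>\<^bsub>W\<^esub> a) \<and>
        (\<forall>e'\<in>carrier X. ip W (i e) (i e') = ip X e e') \<and>
        i (egrading X e) = egrading W (i e) \<and>
        (\<forall>d\<in>carrier D. i (lact X d e) = lact W d (i e)) \<and>
        i (fop X e) = fop W (i e))"

definition is_direct_sum ::
  "'d graded_cstar \<Rightarrow> 'a graded_cstar \<Rightarrow> ('d, 'a, 'e) kasparov \<Rightarrow> ('d, 'a, 'f) kasparov
     \<Rightarrow> ('d, 'a, 'g) kasparov \<Rightarrow> bool" where
  "is_direct_sum D A X Y W \<longleftrightarrow>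
     (\<exists>i j. kasparov_embedding D A X W i \<and> kasparov_embedding D A Y W j \<and>
        (\<forall>x\<in>carrier X. \<forall>y\<in>carrier Y. ip W (i x) (j y) = vzero A) \<and>
        (\<forall>w\<in>carrier W. \<exists>x\<in>carrier X. \<exists>y\<in>carrier Y. w = i x \<boxplus>\<^bsub>W\<^esub> j y))"

text \<open>Addition is induced by the direct sum; the neutral element is the class of the zero module.
  Both unions are unions of one and the same homotopy class.\<close>

definition KK ::
  "'d graded_cstar \<Rightarrow> 'a graded_cstar \<Rightarrow> ('d, 'a, real) kasparov set monoid" where
  "KK D A =
     \<lparr>carrier = kasparov_modules D A // homotopy D A,
      monoid.mult = (\<lambda>P Q. \<Union>{homotopy D A `` {W} | W X Y.
        X \<in> P \<and> Y \<in> Q \<and> W \<in> kasparov_modules D A \<and> is_direct_sum D A X Y W}),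
      one = \<Union>{homotopy D A `` {W} | W.
        W \<in> kasparov_modules D A \<and> carrier W = {vzero W}}\<rparr>"

text \<open>The element type of \<open>A \<otimes> Cliff\<^sub>j\<close> differs from that of \<open>A\<close>, so the case \<open>j = 0\<close> is a separate
  constant.\<close>

definition Kgr_zero :: "'a graded_cstar \<Rightarrow> (complex, 'a, real) kasparov set monoid" where
  "Kgr_zero A = KK complex_alg A"

definition Kgr ::
  "nat \<Rightarrow> 'a graded_cstar \<Rightarrow> (complex, nat \<Rightarrow> 'a, real) kasparov set monoid" where  \<comment> \<open>for \<open>j \<ge> 1\<close>\<close>
  "Kgr j A = KK complex_alg (A \<otimes>Cliff j)"

end

theory Submission
  imports Defs
begin

text \<open>Let \<open>\<epsilon> = (1, -1)\<close> be the odd generator of \<open>Cliff\<^sub>1\<close>.  The obvious map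
  \<open>b \<mapsto> b \<otimes> 1\<close>, \<open>u \<mapsto> 1 \<otimes> \<epsilon>\<close> is a *-isomorphism from the crossed product onto
  \<open>B \<otimes> Cliff\<^sub>1\<close>, but it does not respect the gradings, since the dual action fixes \<open>B\<close>.  This is
  repaired by sending an odd \<open>b\<close> to the even element \<open>\<i>b \<otimes> \<epsilon>\<close> instead: the elements
  \<open>b\<^sub>0 \<otimes> 1 + \<i>b\<^sub>1 \<otimes> \<epsilon>\<close> form a copy of \<open>B\<close> of degree \<open>0\<close>, on which \<open>1 \<otimes> \<epsilon>\<close> acts by \<open>\<beta>\<close>.
  Together with the associativity of the graded tensor product, everything follows from the
  invariance of \<open>KK\<close> under graded isomorphisms of the coefficient algebra.\<close>

section \<open>Graded isomorphisms\<close>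

text \<open>The factor \<i> is forced. Moving \<epsilon> past an odd element costs a sign, so for
  odd b and c the product of b \<otimes> \<epsilon> and c \<otimes> \<epsilon> is -bc \<otimes> 1,
  and the adjoint of b \<otimes> \<epsilon> is minus the adjoint of b, tensored with \<epsilon>; the
  factor \<i> undoes both signs. As \<open>B\<close> may lack a unit, u and 1 \<otimes> \<epsilon>
  need not be elements, so the map is written on pairs standing for a + bu.

  Norms need no estimate: the least C*-norm is determined by the *-algebra, so algebraic
  isomorphisms are isometric. Likewise \<open>KK\<close> is formed from the operations of the
  coefficient record, so a bijection respecting them transports modules, homotopies and direct sums.

  Associativity enters only for two factors Cliff_1, where the map is a re-indexing and the content
  lies in comparing structure constants. The identities behind both isomorphisms are checked in one
  way: both sides are expanded over a fixed finite family of vectors and the coefficients are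
  compared.\<close>

text \<open>The operations are controlled on a set \<open>U\<close> that may be larger than the carrier: for the
  cylinder, \<open>U\<close> consists of all functions into the carrier, which avoids showing that sums and
  products of continuous functions are continuous.\<close>

locale graded_star_iso =
  fixes U :: "'a set" and A :: "('a, 'm) graded_star_scheme"
    and A' :: "('c, 'n) graded_star_scheme" and f :: "'a \<Rightarrow> 'c"
  assumes inj: "inj_on f U"
    and carrier_subset: "carrier A \<subseteq> U"
    and image_carrier: "f ` carrier A = carrier A'"
    and zero: "vzero A \<in> U" "f (vzero A) = vzero A'"
    and add: "a \<in> U \<Longrightarrow> b \<in> U \<Longrightarrow> a \<boxplus>\<^bsub>A\<^esub> b \<in> U"
      "a \<in> U \<Longrightarrow> b \<in> U \<Longrightarrow> f (a \<boxplus>\<^bsub>A\<^esub> b) = f a \<boxplus>\<^bsub>A'\<^esub> f b"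
    and scale: "a \<in> U \<Longrightarrow> z \<odot>\<^bsub>A\<^esub> a \<in> U"
      "a \<in> U \<Longrightarrow> f (z \<odot>\<^bsub>A\<^esub> a) = z \<odot>\<^bsub>A'\<^esub> f a"
    and mult: "a \<in> U \<Longrightarrow> b \<in> U \<Longrightarrow> a \<star>\<^bsub>A\<^esub> b \<in> U"
      "a \<in> U \<Longrightarrow> b \<in> U \<Longrightarrow> f (a \<star>\<^bsub>A\<^esub> b) = f a \<star>\<^bsub>A'\<^esub> f b"
    and adjoint: "a \<in> U \<Longrightarrow> adj A a \<in> U" "a \<in> U \<Longrightarrow> f (adj A a) = adj A' (f a)"
    and grade: "a \<in> U \<Longrightarrow> grading A a \<in> U"
      "a \<in> U \<Longrightarrow> f (grading A a) = grading A' (f a)"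
begin

lemma mem_U: "a \<in> carrier A \<Longrightarrow> a \<in> U"
  using carrier_subset by blast

lemma image_mem: "a \<in> carrier A \<Longrightarrow> f a \<in> carrier A'"
  using image_carrier by blast

lemma vdiff: "a \<in> U \<Longrightarrow> b \<in> U \<Longrightarrow> f (vdiff A a b) = vdiff A' (f a) (f b)"
  by (simp add: vdiff_def add scale)

lemma inv_f: "a \<in> U \<Longrightarrow> inv_into U f (f a) = a"
  using inj by (rule inv_into_f_f)

lemma inverse: "graded_star_iso (f ` U) A' A (inv_into U f)"
proof -
  have "inv_into U f ` f ` carrier A = carrier A"
    using carrier_subset inj by (rule inv_into_image_cancel[rotated])
  then show ?thesis
    unfolding graded_star_iso_def image_carrier[symmetric]
    by (auto simp: inv_f mem_U inj_on_inv_into zero(2)[symmetric] zero(1) add(2)[symmetric] add(1)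
        scale(2)[symmetric] scale(1) mult(2)[symmetric] mult(1)
        adjoint(2)[symmetric] adjoint(1) grade(2)[symmetric] grade(1))
qed

lemma cstar_norm_comp:
  assumes U: "U = carrier A" and nrm: "cstar_norm A' nrm"
  shows "cstar_norm A (\<lambda>a. nrm (f a))"
proof -
  have "f a = vzero A' \<longleftrightarrow> a = vzero A" if "a \<in> carrier A" for a
    using inj that zero U by (metis inj_on_eq_iff)
  then show ?thesis
    using nrm image_mem unfolding cstar_norm_def U[symmetric]
    by (simp add: add scale mult adjoint)
qed

end

text \<open>Pulling C*-norms back along \<open>f\<close> and along its inverse matches the C*-norms
  of the two algebras, so both infima run over the same set of real numbers.\<close>

lemma (in graded_star_iso) least_cstar_norm:
  assumes U: "U = carrier A" and a: "a \<in> carrier A"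
  shows "least_cstar_norm A' (f a) = least_cstar_norm A a"
proof -
  interpret inv: graded_star_iso "f ` U" A' A "inv_into U f"
    by (rule inverse)
  have "(\<lambda>nrm. nrm (f a)) ` {nrm. cstar_norm A' nrm} = (\<lambda>nrm. nrm a) ` {nrm. cstar_norm A nrm}"
  proof (intro subset_antisym image_subsetI)
    fix nrm assume "nrm \<in> {nrm. cstar_norm A' nrm}"
    then show "nrm (f a) \<in> (\<lambda>nrm. nrm a) ` {nrm. cstar_norm A nrm}"
      using cstar_norm_comp[OF U] by (intro image_eqI[of _ _ "\<lambda>a. nrm (f a)"]) auto
  next
    fix nrm assume "nrm \<in> {nrm. cstar_norm A nrm}"
    then show "nrm a \<in> (\<lambda>nrm. nrm (f a)) ` {nrm. cstar_norm A' nrm}"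
      using inv.cstar_norm_comp[of nrm] image_carrier[folded U] inv_f[OF mem_U[OF a]]
      by (intro image_eqI[of _ _ "\<lambda>a. nrm (inv_into U f a)"]) auto
  qed
  then show ?thesis
    unfolding least_cstar_norm_def by simp
qed

locale graded_cstar_iso = graded_star_iso U A A' f
  for U :: "'a set" and A :: "'a graded_cstar" and A' :: "'c graded_cstar" and f +
  assumes norm: "a \<in> carrier A \<Longrightarrow> anorm A' (f a) = anorm A a"

lemma (in graded_cstar_iso) inverse_cstar: "graded_cstar_iso (f ` U) A' A (inv_into U f)"
proof -
  interpret inv: graded_star_iso "f ` U" A' A "inv_into U f"
    by (rule inverse)
  show ?thesis
    by unfold_locales (auto simp: image_carrier[symmetric] inv_f mem_U norm)
qed

lemma with_least_norm_simps [simp]: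
  "carrier (with_least_norm A) = carrier A"
  "vadd (with_least_norm A) = vadd A"
  "vzero (with_least_norm A) = vzero A"
  "vscale (with_least_norm A) = vscale A"
  "amult (with_least_norm A) = amult A"
  "adj (with_least_norm A) = adj A"
  "grading (with_least_norm A) = grading A"
  "anorm (with_least_norm A) = least_cstar_norm A"
  by (simp_all add: with_least_norm_def graded_star.extend_def graded_cstar.fields_def)

text \<open>Upgrades the algebraic isomorphisms constructed later to isometric ones, the form in
  which \<open>KK\<close> can use them.\<close>

lemma graded_cstar_iso_least_norm:
  assumes "graded_star_iso (carrier A) A A' f"
  shows "graded_cstar_iso (carrier A) (with_least_norm A) (with_least_norm A') f"
proof -
  interpret graded_star_iso "carrier A" A A' f by fact
  show ?thesis
    by unfold_locales
      (auto simp: least_cstar_norm inj image_carrier zero add scale mult adjoint grade)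
qed

text \<open>Continuity of a path is convergence of norms of differences, and \<open>f\<close>
  preserves both differences and norms.\<close>

lemma (in graded_cstar_iso) cylinder_image_mem:
  assumes U: "U = carrier A" and c: "c \<in> carrier (cylinder A)"
  shows "(\<lambda>t\<in>{0..1}. f (c t)) \<in> carrier (cylinder A')"
proof -
  have c_mem: "c t \<in> carrier A" if "t \<in> {0..1}" for t
    using c that by (auto simp: cylinder_def)
  have "((\<lambda>s. anorm A' (vdiff A' ((\<lambda>t\<in>{0..1}. f (c t)) s) ((\<lambda>t\<in>{0..1}. f (c t)) t)))
      \<longlongrightarrow> 0) (at t within {0..1})" if t: "t \<in> {0..1}" for t
  proof (rule Lim_transform_eventually)
    show "((\<lambda>s. anorm A (vdiff A (c s) (c t))) \<longlongrightarrow> 0) (at t within {0..1})"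
      using c t by (simp add: cylinder_def)
    show "\<forall>\<^sub>F s in at t within {0..1}. anorm A (vdiff A (c s) (c t)) =
        anorm A' (vdiff A' ((\<lambda>t\<in>{0..1}. f (c t)) s) ((\<lambda>t\<in>{0..1}. f (c t)) t))"
    proof -
      have "anorm A (vdiff A (c s) (c t)) =
          anorm A' (vdiff A' ((\<lambda>t\<in>{0..1}. f (c t)) s) ((\<lambda>t\<in>{0..1}. f (c t)) t))"
        if "s \<in> {0..1}" for s
      proof -
        have "vdiff A (c s) (c t) \<in> carrier A"
          using c_mem[OF \<open>s \<in> _\<close>] c_mem[OF t] unfolding U[symmetric]
          by (simp add: vdiff_def add scale)
        then show ?thesis
          using c_mem[OF \<open>s \<in> _\<close>] c_mem[OF t] that t norm by (simp add: vdiff[symmetric] mem_U)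
      qed
      then show ?thesis
        by (simp add: eventually_at_filter)
    qed
  qed
  then show ?thesis
    using c_mem image_mem by (simp add: cylinder_def)
qed

text \<open>Homotopies are modules over the cylinder, so they need the isomorphism applied pointwise
  to paths. Surjectivity is \<open>cylinder_image_mem\<close> for the inverse of
  \<open>f\<close>.\<close>

lemma (in graded_cstar_iso) cylinder_iso:
  assumes U: "U = carrier A"
  shows "graded_cstar_iso ({0..1} \<rightarrow>\<^sub>E U) (cylinder A) (cylinder A') (\<lambda>c. \<lambda>t\<in>{0..1}. f (c t))"
proof -
  let ?F = "\<lambda>c. \<lambda>t\<in>{0..1::real}. f (c t)"
  have U': "f ` U = carrier A'"
    using image_carrier U by simp
  interpret inv: graded_cstar_iso "f ` U" A' A "inv_into U f"
    by (rule inverse_cstar)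
  have sub: "carrier (cylinder A) \<subseteq> {0..1} \<rightarrow>\<^sub>E U"
    unfolding U by (auto simp: cylinder_def)
  show ?thesis
  proof unfold_locales
    show "inj_on ?F ({0..1} \<rightarrow>\<^sub>E U)"
    proof (rule inj_onI)
      fix c d assume c: "c \<in> {0..1} \<rightarrow>\<^sub>E U" and d: "d \<in> {0..1} \<rightarrow>\<^sub>E U" and eq: "?F c = ?F d"
      have "c t = d t" if "t \<in> {0..1}" for t
        using fun_cong[OF eq, of t] that c d by (auto dest!: inj_onD[OF inj])
      then show "c = d"
        using c d by (rule PiE_ext[rotated 2])
    qed
    show "?F ` carrier (cylinder A) = carrier (cylinder A')"
    proof (intro subset_antisym subsetI)
      fix c assume "c \<in> carrier (cylinder A')"
      then have "(\<lambda>t\<in>{0..1}. inv_into U f (c t)) \<in> carrier (cylinder A)"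
        and "?F (\<lambda>t\<in>{0..1}. inv_into U f (c t)) = c"
        using inv.cylinder_image_mem[OF U'] by (auto simp: cylinder_def U' f_inv_into_f
            fun_eq_iff PiE_def extensional_def Pi_def)
      then show "c \<in> ?F ` carrier (cylinder A)"
        by (metis image_eqI)
    qed (use cylinder_image_mem[OF U] in auto)
    show "anorm (cylinder A') (?F c) = anorm (cylinder A) c" if "c \<in> carrier (cylinder A)" for c
      using that norm by (auto simp: cylinder_def PiE_iff intro!: SUP_cong)
    show "carrier (cylinder A) \<subseteq> {0..1} \<rightarrow>\<^sub>E U"
      by (fact sub)
  qed (auto simp: cylinder_def PiE_iff fun_eq_iff zero add scale mult adjoint grade)
qed

section \<open>Change of coefficients in Kasparov modules\<close>

text \<open>Vectors, left action and operator stay the same; only the scalars are renamed by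
  \<open>f\<close>. The right action and the inner product are compared only where they carry
  meaning.\<close>

definition coeff_rel ::
  "'a set \<Rightarrow> ('a \<Rightarrow> 'c) \<Rightarrow> ('d, 'a, 'e) kasparov \<Rightarrow> ('d, 'c, 'e) kasparov \<Rightarrow> bool" where
  "coeff_rel U f X X' \<longleftrightarrow>
     carrier X' = carrier X \<and> vadd X' = vadd X \<and> vzero X' = vzero X \<and> vscale X' = vscale X \<and>
     egrading X' = egrading X \<and> lact X' = lact X \<and> fop X' = fop X \<and>
     (\<forall>e\<in>carrier X. \<forall>a\<in>U. ract X' e (f a) = ract X e a) \<and>
     (\<forall>e\<in>carrier X. \<forall>e'\<in>carrier X. ip X' e e' = f (ip X e e'))"

lemma coeff_relD:
  assumes "coeff_rel U f X X'"
  shows "carrier X' = carrier X" "vadd X' = vadd X" "vzero X' = vzero X" "vscale X' = vscale X"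
    "egrading X' = egrading X" "lact X' = lact X" "fop X' = fop X"
    "vdiff X' = vdiff X" "add_grp X' = add_grp X"
    "e \<in> carrier X \<Longrightarrow> a \<in> U \<Longrightarrow> ract X' e (f a) = ract X e a"
    "e \<in> carrier X \<Longrightarrow> e' \<in> carrier X \<Longrightarrow> ip X' e e' = f (ip X e e')"
  using assms by (auto simp: coeff_rel_def vdiff_def add_grp_def fun_eq_iff)

definition change_coeff ::
  "'a set \<Rightarrow> ('a \<Rightarrow> 'c) \<Rightarrow> ('d, 'a, 'e) kasparov \<Rightarrow> ('d, 'c, 'e) kasparov" where
  "change_coeff U f X =
     \<lparr>carrier = carrier X, vadd = vadd X, vzero = vzero X, vscale = vscale X,
      ract = (\<lambda>e a. ract X e (inv_into U f a)), ip = (\<lambda>e e'. f (ip X e e')),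
      egrading = egrading X, lact = lact X, fop = fop X\<rparr>"

context graded_cstar_iso
begin

lemma coeff_rel_change: "coeff_rel U f X (change_coeff U f X)"
  by (simp add: coeff_rel_def change_coeff_def inv_f)

text \<open>Cancelling \<open>inv_into U f\<close> against \<open>f\<close> requires the inner
  products to lie in \<open>U\<close>, which \<open>ip_closed\<close> supplies.\<close>

lemma coeff_rel_inverse:
  assumes "graded_hilbert_module A X" and "coeff_rel U f X X'"
  shows "coeff_rel (f ` U) (inv_into U f) X' X"
  using assms(2) graded_hilbert_module.ip_closed[OF assms(1)] mem_U
  by (auto simp: coeff_rel_def inv_f)

end

locale coefficient_change = graded_cstar_iso U A A' f + X: graded_hilbert_module A X
  for U :: "'a set" and A :: "'a graded_cstar" and A' :: "'c graded_cstar" and f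
    and X :: "('d, 'a, 'e) kasparov" +
  fixes X' :: "('d, 'c, 'e) kasparov"
  assumes coeff_rel: "coeff_rel U f X X'"
begin

lemmas rel = coeff_relD[OF coeff_rel]

lemma ip_mem_U: "e \<in> carrier X \<Longrightarrow> e' \<in> carrier X \<Longrightarrow> ip X e e' \<in> U"
  by (simp add: mem_U X.ip_closed)

lemma vdiff_closed: "x \<in> carrier X \<Longrightarrow> y \<in> carrier X \<Longrightarrow> vdiff X x y \<in> carrier X"
proof -
  interpret G: comm_group "add_grp X" by (rule X.add_comm_group)
  show "x \<in> carrier X \<Longrightarrow> y \<in> carrier X \<Longrightarrow> vdiff X x y \<in> carrier X"
    using G.m_closed[of x "(-1) \<odot>\<^bsub>X\<^esub> y"] X.scale_closed
    by (simp add: vdiff_def add_grp_def)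
qed

lemma hnorm_eq: "e \<in> carrier X \<Longrightarrow> hnorm A' X' e = hnorm A X e"
  by (simp add: hnorm_def rel norm X.ip_closed)

text \<open>Every scalar of \<open>A'\<close> is written as the image of one of \<open>A\<close>,
  after which each axiom is the one for \<open>X\<close>. Completeness carries over because
  \<open>hnorm_eq\<close> leaves the norms of vectors unchanged.\<close>

lemma hilbert_module: "graded_hilbert_module A' X'"
proof (intro graded_hilbert_module.intro complex_space.intro graded_hilbert_module_axioms.intro)
  show "comm_group (add_grp X')"
    by (simp add: rel X.add_comm_group)
next
  fix e assume "e \<in> carrier X'"
  then show "positive_element A' (ip X' e e)"
    using X.ip_positive[of e] unfolding positive_element_def image_carrier[symmetric]
    by (auto simp: rel mult adjoint mem_U)
next
  fix e assume "e \<in> carrier X'" "ip X' e e = vzero A'"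
  then have "ip X e e = vzero A"
    using inj_onD[OF inj _ ip_mem_U[of e e] zero(1)] by (simp add: rel zero(2))
  then show "e = vzero X'"
    using X.ip_definite \<open>e \<in> _\<close> by (simp add: rel)
next
  show "ccomplete X' (hnorm A' X')"
    using X.hnorm_complete unfolding ccomplete_def rel by (simp add: hnorm_eq vdiff_closed cong: conj_cong)
next
  show "clinear_map X' X' (egrading X')"
    using X.egrading_linear by (simp add: clinear_map_def rel)
next
  fix e a assume "e \<in> carrier X'" "a \<in> carrier A'"
  moreover have "egrading X e \<in> carrier X" if "e \<in> carrier X" for e
    using X.egrading_linear that by (simp add: clinear_map_def)
  ultimately show "egrading X' (e \<lhd>\<^bsub>X'\<^esub> a) = egrading X' e \<lhd>\<^bsub>X'\<^esub> grading A' a"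
    by (auto simp: rel image_carrier[symmetric] mem_U X.egrading_ract grade(1) grade(2)[symmetric])
next
  fix e e' assume "e \<in> carrier X'" "e' \<in> carrier X'"
  moreover have "egrading X e \<in> carrier X" if "e \<in> carrier X" for e
    using X.egrading_linear that by (simp add: clinear_map_def)
  ultimately show "ip X' (egrading X' e) (egrading X' e') = grading A' (ip X' e e')"
    by (simp add: rel X.egrading_ip grade(2) ip_mem_U)
next
  fix e a b assume "e \<in> carrier X'" "a \<in> carrier A'" "b \<in> carrier A'"
  then obtain a0 b0 where ab: "a = f a0" "b = f b0" "a0 \<in> carrier A" "b0 \<in> carrier A" "e \<in> carrier X"
    by (auto simp: rel image_carrier[symmetric])
  then show "e \<lhd>\<^bsub>X'\<^esub> (a \<boxplus>\<^bsub>A'\<^esub> b) = (e \<lhd>\<^bsub>X'\<^esub> a) \<boxplus>\<^bsub>X'\<^esub> (e \<lhd>\<^bsub>X'\<^esub> b)"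
    by (simp add: rel mem_U X.ract_add_right add flip: add(2))
  show "e \<lhd>\<^bsub>X'\<^esub> (a \<star>\<^bsub>A'\<^esub> b) = e \<lhd>\<^bsub>X'\<^esub> a \<lhd>\<^bsub>X'\<^esub> b"
    using ab by (simp add: rel mem_U X.ract_mult X.ract_closed mult flip: mult(2))
next
  fix e a z assume "e \<in> carrier X'" "a \<in> carrier A'"
  then obtain a0 where ab: "a = f a0" "a0 \<in> carrier A" "e \<in> carrier X"
    by (auto simp: rel image_carrier[symmetric])
  then show "e \<lhd>\<^bsub>X'\<^esub> (z \<odot>\<^bsub>A'\<^esub> a) = z \<odot>\<^bsub>X'\<^esub> (e \<lhd>\<^bsub>X'\<^esub> a)"
    by (simp add: rel mem_U X.ract_scale_right scale flip: scale(2))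
next
  have add_closed: "x \<boxplus>\<^bsub>X\<^esub> y \<in> carrier X" if "x \<in> carrier X" "y \<in> carrier X" for x y
    using comm_groupE(1)[OF X.add_comm_group, of x y] that by (simp add: add_grp_def)
  fix e e' a assume "e \<in> carrier X'" "e' \<in> carrier X'" "a \<in> carrier A'"
  then obtain a0 where ab: "a = f a0" "a0 \<in> carrier A" "e \<in> carrier X" "e' \<in> carrier X"
    by (auto simp: rel image_carrier[symmetric])
  then show "(e \<boxplus>\<^bsub>X'\<^esub> e') \<lhd>\<^bsub>X'\<^esub> a = (e \<lhd>\<^bsub>X'\<^esub> a) \<boxplus>\<^bsub>X'\<^esub> (e' \<lhd>\<^bsub>X'\<^esub> a)"
    by (simp add: rel mem_U X.ract_add_left add_closed)
  show "ip X' e (e' \<lhd>\<^bsub>X'\<^esub> a) = ip X' e e' \<star>\<^bsub>A'\<^esub> a"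
    using ab by (simp add: rel mem_U X.ract_closed X.ip_ract_right ip_mem_U mult(2))
next
  have add_closed: "x \<boxplus>\<^bsub>X\<^esub> y \<in> carrier X" if "x \<in> carrier X" "y \<in> carrier X" for x y
    using comm_groupE(1)[OF X.add_comm_group, of x y] that by (simp add: add_grp_def)
  fix d e e' assume "d \<in> carrier X'" "e \<in> carrier X'" "e' \<in> carrier X'"
  then show "ip X' d (e \<boxplus>\<^bsub>X'\<^esub> e') = ip X' d e \<boxplus>\<^bsub>A'\<^esub> ip X' d e'"
    by (simp add: rel add_closed X.ip_add_right ip_mem_U add(2))
next
  fix d e and z assume "d \<in> carrier X'" "e \<in> carrier X'"
  then show "ip X' d (z \<odot>\<^bsub>X'\<^esub> e) = z \<odot>\<^bsub>A'\<^esub> ip X' d e"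
    by (simp add: rel X.scale_closed X.ip_scale_right ip_mem_U scale(2))
next
  fix d e assume de: "d \<in> carrier X'" "e \<in> carrier X'"
  then show "ip X' d e \<in> carrier A'"
    by (simp add: rel X.ip_closed image_mem)
  show "adj A' (ip X' d e) = ip X' e d"
    using de by (simp add: rel ip_mem_U X.ip_adj flip: adjoint(2))
next
  fix e a assume "e \<in> carrier X'" "a \<in> carrier A'"
  then obtain a0 where ab: "a = f a0" "a0 \<in> carrier A" "e \<in> carrier X"
    by (auto simp: rel image_carrier[symmetric])
  then show "e \<lhd>\<^bsub>X'\<^esub> a \<in> carrier X'"
    by (simp add: rel mem_U X.ract_closed)
  show "(z \<odot>\<^bsub>X'\<^esub> e) \<lhd>\<^bsub>X'\<^esub> a = z \<odot>\<^bsub>X'\<^esub> (e \<lhd>\<^bsub>X'\<^esub> a)" for z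
    using ab by (simp add: rel mem_U X.scale_closed X.ract_scale_left)
qed (simp_all add: rel X.scale_closed X.scale_add X.add_scale X.scale_scale X.scale_one
    X.egrading_egrading)

lemma cspan_eq: "cspan X' S = cspan X S"
  by (simp add: cspan_def rel)

lemma cdense_eq: "cdense X' (hnorm A' X') S \<longleftrightarrow> cdense X (hnorm A X) S"
  unfolding cdense_def rel by (auto simp: hnorm_eq vdiff_closed subset_iff)

lemma ract_image:
  assumes "G \<subseteq> carrier X"
  shows "{g \<lhd>\<^bsub>X'\<^esub> a | g a. g \<in> G \<and> a \<in> carrier A'} = {g \<lhd>\<^bsub>X\<^esub> a | g a. g \<in> G \<and> a \<in> carrier A}"
proof -
  have eq: "g \<lhd>\<^bsub>X'\<^esub> f a = g \<lhd>\<^bsub>X\<^esub> a" if "g \<in> G" "a \<in> carrier A" for g a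
    using that assms by (auto simp: rel mem_U)
  show ?thesis
    unfolding image_carrier[symmetric]
  proof (intro subset_antisym subsetI)
    fix x assume "x \<in> {g \<lhd>\<^bsub>X'\<^esub> a | g a. g \<in> G \<and> a \<in> f ` carrier A}"
    then show "x \<in> {g \<lhd>\<^bsub>X\<^esub> a | g a. g \<in> G \<and> a \<in> carrier A}"
      using eq by blast
  next
    fix x assume "x \<in> {g \<lhd>\<^bsub>X\<^esub> a | g a. g \<in> G \<and> a \<in> carrier A}"
    then obtain g a where "x = g \<lhd>\<^bsub>X'\<^esub> f a" "g \<in> G" "a \<in> carrier A"
      using eq by force
    then show "x \<in> {g \<lhd>\<^bsub>X'\<^esub> a | g a. g \<in> G \<and> a \<in> f ` carrier A}"
      by blast
  qed
qed

lemma countably_generated_eq: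
  "countably_generated A' X' \<longleftrightarrow> countably_generated A X"
  unfolding countably_generated_def by (auto simp: rel cspan_eq cdense_eq ract_image cong: conj_cong)

text \<open>Injectivity of \<open>f\<close> on \<open>U\<close> reflects equality of inner
  products.\<close>

lemma is_adjoint_iff: "is_adjoint X' T T' \<longleftrightarrow> is_adjoint X T T'"
proof -
  have "f (ip X (T e) e') = f (ip X e (T' e')) \<longleftrightarrow> ip X (T e) e' = ip X e (T' e')"
    if "e \<in> carrier X" "e' \<in> carrier X" "T e \<in> carrier X" "T' e' \<in> carrier X" for e e'
    using that by (intro inj_on_eq_iff[OF inj] ip_mem_U)
  then show ?thesis
    unfolding is_adjoint_def rel(1) by (auto simp: rel)
qed

lemma compact_op:
  assumes "compact_op A X T"
  shows "compact_op A' X' T"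
proof -
  interpret G: comm_group "add_grp X" by (rule X.add_comm_group)
  obtain T' where T': "is_adjoint X T T'"
    using assms unfolding compact_op_def by blast
  have "\<exists>(n::nat) x y. (\<forall>k<n. x k \<in> carrier X' \<and> y k \<in> carrier X') \<and>
        (\<forall>e\<in>carrier X'. hnorm A' X' (vdiff X' (T e) (vsum X' (\<lambda>k. x k \<lhd>\<^bsub>X'\<^esub> ip X' (y k) e) {..<n}))
          \<le> \<epsilon> * hnorm A' X' e)" if "\<epsilon> > 0" for \<epsilon>
  proof -
    obtain n x y where xy: "\<forall>k<n::nat. x k \<in> carrier X \<and> y k \<in> carrier X"
      and le: "\<And>e. e \<in> carrier X \<Longrightarrow>
        hnorm A X (vdiff X (T e) (vsum X (\<lambda>k. x k \<lhd>\<^bsub>X\<^esub> ip X (y k) e) {..<n})) \<le> \<epsilon> * hnorm A X e"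
      using assms \<open>\<epsilon> > 0\<close> unfolding compact_op_def by (elim conjE allE[of _ \<epsilon>] impE) blast+
    have "hnorm A' X' (vdiff X' (T e) (vsum X' (\<lambda>k. x k \<lhd>\<^bsub>X'\<^esub> ip X' (y k) e) {..<n}))
          \<le> \<epsilon> * hnorm A' X' e" if e: "e \<in> carrier X" for e
    proof -
      have closed: "(\<lambda>k. x k \<lhd>\<^bsub>X\<^esub> ip X (y k) e) \<in> {..<n} \<rightarrow> carrier (add_grp X)"
        using xy e by (auto simp: X.ract_closed X.ip_closed add_grp_def)
      \<comment> \<open>The rank-one operators do not change: the \<open>f\<close> introduced by
        \<open>ip X'\<close> is absorbed by \<open>ract X'\<close>. Hence the same approximants
        serve.\<close>
      have "vsum X' (\<lambda>k. x k \<lhd>\<^bsub>X'\<^esub> ip X' (y k) e) {..<n}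
          = vsum X (\<lambda>k. x k \<lhd>\<^bsub>X\<^esub> ip X (y k) e) {..<n}"
        unfolding rel(9) using xy e closed by (intro G.finprod_cong') (auto simp: rel ip_mem_U)
      moreover have "T e \<in> carrier X"
        using T' e by (auto simp: is_adjoint_def)
      moreover have "vsum X (\<lambda>k. x k \<lhd>\<^bsub>X\<^esub> ip X (y k) e) {..<n} \<in> carrier X"
        using G.finprod_closed[OF closed] by (simp add: add_grp_def)
      ultimately show ?thesis
        using le[OF e] e by (simp add: rel hnorm_eq vdiff_closed)
    qed
    then show ?thesis
      using xy by (auto simp: rel)
  qed
  then show ?thesis
    using T' unfolding compact_op_def is_adjoint_iff by blast
qed

end

context graded_cstar_iso
begin

lemma coefficient_change:
  assumes "kasparov_module D A X" "coeff_rel U f X X'"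
  shows "coefficient_change U A A' f X X'"
  using assms graded_cstar_iso_axioms
  by (simp add: coefficient_change_def coefficient_change_axioms_def kasparov_module_def)

lemma kasparov_module:
  assumes X: "kasparov_module D A X" and rel: "coeff_rel U f X X'"
  shows "kasparov_module D A' X'"
proof -
  interpret coefficient_change U A A' f X X'
    using assms by (rule coefficient_change)
  show ?thesis
    using X hilbert_module compact_op unfolding kasparov_module_def Let_def
    by (auto simp: countably_generated_eq is_adjoint_iff rel)
qed

lemma coeff_rel_sym:
  assumes "kasparov_module D A X" "coeff_rel U f X X'"
  shows "coeff_rel (f ` U) (inv_into U f) X' X"
  using assms coeff_rel_inverse by (auto simp: kasparov_module_def)

text \<open>The vectors are unchanged, so the embeddings \<open>i\<close> and \<open>j\<close> of
  the given sum serve again.\<close>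

lemma is_direct_sum:
  assumes X: "kasparov_module D A X" "coeff_rel U f X X'"
    and Y: "kasparov_module D A Y" "coeff_rel U f Y Y'"
    and W: "kasparov_module D A W" "coeff_rel U f W W'"
    and sum: "is_direct_sum D A X Y W"
  shows "is_direct_sum D A' X' Y' W'"
proof -
  interpret X: coefficient_change U A A' f X X' using X by (rule coefficient_change)
  interpret Y: coefficient_change U A A' f Y Y' using Y by (rule coefficient_change)
  interpret W: coefficient_change U A A' f W W' using W by (rule coefficient_change)
  obtain i j where i: "kasparov_embedding D A X W i" and j: "kasparov_embedding D A Y W j"
    and orth: "\<forall>x\<in>carrier X. \<forall>y\<in>carrier Y. ip W (i x) (j y) = vzero A"
    and total: "\<forall>w\<in>carrier W. \<exists>x\<in>carrier X. \<exists>y\<in>carrier Y. w = i x \<boxplus>\<^bsub>W\<^esub> j y"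
    using sum unfolding is_direct_sum_def by blast
  have ij: "x \<in> carrier X \<Longrightarrow> i x \<in> carrier W" "y \<in> carrier Y \<Longrightarrow> j y \<in> carrier W" for x y
    using i j by (auto simp: kasparov_embedding_def clinear_map_def)
  have "kasparov_embedding D A' X' W' i"
    using i unfolding kasparov_embedding_def clinear_map_def image_carrier[symmetric]
    by (auto simp: X.rel W.rel mem_U)
  moreover have "kasparov_embedding D A' Y' W' j"
    using j unfolding kasparov_embedding_def clinear_map_def image_carrier[symmetric]
    by (auto simp: Y.rel W.rel mem_U)
  ultimately show ?thesis
    using orth total ij unfolding is_direct_sum_def
    by (intro exI[of _ i] exI[of _ j]) (simp add: X.rel Y.rel W.rel zero)
qed

end

section \<open>Pushforwards and homotopies under a change of coefficients\<close>

context graded_cstar_iso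
begin

text \<open>Two algebras change at once: \<open>F\<close> renames the scalars of \<open>Z\<close>
  and \<open>f\<close> those of \<open>Y\<close>. The second part of \<open>ev\<close> makes
  \<open>\<phi>\<close> and \<open>\<phi>'\<close> correspond; they will be the evaluations at the
  ends of a homotopy.\<close>

lemma is_pushforward:
  assumes "graded_cstar_iso V C C' F"
    and ev: "\<And>c. c \<in> carrier C \<Longrightarrow> \<phi> c \<in> carrier A"
      "\<And>c. c \<in> carrier C \<Longrightarrow> \<phi>' (F c) = f (\<phi> c)"
    and Z: "kasparov_module D C Z" "coeff_rel V F Z Z'"
    and Y: "kasparov_module D A Y" "coeff_rel U f Y Y'"
    and push: "is_pushforward D A \<phi> Z Y"
  shows "is_pushforward D A' \<phi>' Z' Y'"
proof -
  interpret Z: coefficient_change V C C' F Z Z'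
    by (rule graded_cstar_iso.coefficient_change[OF assms(1) Z])
  interpret Y: coefficient_change U A A' f Y Y'
    using Y by (rule coefficient_change)
  obtain \<tau> where \<tau>: "\<forall>e\<in>carrier Z. \<forall>a\<in>carrier A.
        \<tau> e a \<in> carrier Y \<and>
        (\<forall>b\<in>carrier A. \<tau> e a \<lhd>\<^bsub>Y\<^esub> b = \<tau> e (a \<star>\<^bsub>A\<^esub> b)) \<and>
        egrading Y (\<tau> e a) = \<tau> (egrading Z e) (grading A a) \<and>
        (\<forall>d\<in>carrier D. lact Y d (\<tau> e a) = \<tau> (lact Z d e) a) \<and>
        fop Y (\<tau> e a) = \<tau> (fop Z e) a"
    and ip: "\<forall>e\<in>carrier Z. \<forall>a\<in>carrier A. \<forall>e'\<in>carrier Z. \<forall>a'\<in>carrier A.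
        ip Y (\<tau> e a) (\<tau> e' a') = adj A a \<star>\<^bsub>A\<^esub> \<phi> (ip Z e e') \<star>\<^bsub>A\<^esub> a'"
    and dense: "cdense Y (hnorm A Y) (cspan Y {\<tau> e a | e a. e \<in> carrier Z \<and> a \<in> carrier A})"
    using push unfolding is_pushforward_def by blast
  \<comment> \<open>Elementary tensors with the scalar pulled back to \<open>A\<close>. They form
    the same set of vectors as before, so density is inherited.\<close>
  define \<tau>' where "\<tau>' e a = \<tau> e (inv_into U f a)" for e a
  have \<tau>': "\<tau>' e (f a) = \<tau> e a" if "a \<in> U" for e a
    using that by (simp add: \<tau>'_def inv_f)
  have "{\<tau>' e a | e a. e \<in> carrier Z' \<and> a \<in> carrier A'} = {\<tau> e a | e a. e \<in> carrier Z \<and> a \<in> carrier A}"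
  proof (intro subset_antisym subsetI)
    fix x assume "x \<in> {\<tau>' e a | e a. e \<in> carrier Z' \<and> a \<in> carrier A'}"
    then show "x \<in> {\<tau> e a | e a. e \<in> carrier Z \<and> a \<in> carrier A}"
      using \<tau>' mem_U unfolding Z.rel(1) image_carrier[symmetric] by blast
  next
    fix x assume "x \<in> {\<tau> e a | e a. e \<in> carrier Z \<and> a \<in> carrier A}"
    then obtain e a where "x = \<tau>' e (f a)" "e \<in> carrier Z" "a \<in> carrier A"
      by (auto simp: \<tau>' mem_U)
    then show "x \<in> {\<tau>' e a | e a. e \<in> carrier Z' \<and> a \<in> carrier A'}"
      using image_mem by (auto simp: Z.rel)
  qed
  then have "cdense Y' (hnorm A' Y') (cspan Y' {\<tau>' e a | e a. e \<in> carrier Z' \<and> a \<in> carrier A'})"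
    using dense by (simp add: Y.cdense_eq Y.cspan_eq)
  moreover have "\<tau>' e a \<in> carrier Y' \<and>
        (\<forall>b\<in>carrier A'. \<tau>' e a \<lhd>\<^bsub>Y'\<^esub> b = \<tau>' e (a \<star>\<^bsub>A'\<^esub> b)) \<and>
        egrading Y' (\<tau>' e a) = \<tau>' (egrading Z' e) (grading A' a) \<and>
        (\<forall>d\<in>carrier D. lact Y' d (\<tau>' e a) = \<tau>' (lact Z' d e) a) \<and>
        fop Y' (\<tau>' e a) = \<tau>' (fop Z' e) a"
    if e: "e \<in> carrier Z'" and a: "a \<in> carrier A'" for e a
  proof -
    obtain a0 where a0: "a = f a0" "a0 \<in> carrier A"
      using a by (auto simp flip: image_carrier)
    have *: "\<tau> e a0 \<lhd>\<^bsub>Y'\<^esub> f b = \<tau>' e (f a0 \<star>\<^bsub>A'\<^esub> f b)" if "b \<in> carrier A" for b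
      using \<tau> a0 that \<open>e \<in> _\<close> by (simp add: Y.rel Z.rel mem_U \<tau>' mult flip: mult(2))
    have "egrading Y (\<tau> e a0) = \<tau>' (egrading Z e) (grading A' (f a0))"
      using \<tau> a0 e by (simp add: Z.rel mem_U \<tau>' grade flip: grade(2))
    then show ?thesis
      using * \<tau> a0 e by (auto simp: Y.rel Z.rel mem_U \<tau>' simp flip: image_carrier)
  qed
  moreover have "ip Y' (\<tau>' e a) (\<tau>' e' a') = adj A' a \<star>\<^bsub>A'\<^esub> \<phi>' (ip Z' e e') \<star>\<^bsub>A'\<^esub> a'"
    if ee': "e \<in> carrier Z'" "e' \<in> carrier Z'" and aa': "a \<in> carrier A'" "a' \<in> carrier A'"
    for e a e' a'
  proof -
    obtain a0 a0' where a0: "a = f a0" "a0 \<in> carrier A" "a' = f a0'" "a0' \<in> carrier A"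
      using aa' by (auto simp flip: image_carrier)
    \<comment> \<open>Keeps the middle factor inside \<open>U\<close>, where \<open>f\<close> is
      known to be multiplicative.\<close>
    have "\<phi> (ip Z e e') \<in> U"
      using ee' by (simp add: Z.rel Z.X.ip_closed ev mem_U)
    then show ?thesis
      using ee' a0 \<tau> ip
      by (simp add: Y.rel Z.rel mem_U \<tau>' mult adjoint ev Z.X.ip_closed)
  qed
  ultimately show ?thesis
    unfolding is_pushforward_def by blast
qed

text \<open>The connecting module is transported along the cylinder isomorphism, and evaluation at
  an endpoint commutes with applying \<open>f\<close> pointwise.\<close>

lemma homotopy:
  assumes U: "U = carrier A" and XY: "(X, Y) \<in> homotopy D A"
    and rel: "coeff_rel U f X X'" "coeff_rel U f Y Y'"
  shows "(X', Y') \<in> homotopy D A'"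
proof -
  obtain Z :: "(_, _, real) kasparov"
    where X: "kasparov_module D A X" and Y: "kasparov_module D A Y"
    and Z: "kasparov_module D (cylinder A) Z"
    and push: "is_pushforward D A (\<lambda>f. f 0) Z X" "is_pushforward D A (\<lambda>f. f 1) Z Y"
    using XY by (auto simp: homotopy_def kasparov_modules_def)
  let ?V = "{0..1::real} \<rightarrow>\<^sub>E U" and ?F = "\<lambda>c. \<lambda>t\<in>{0..1::real}. f (c t)"
  define Z' where "Z' = change_coeff ?V ?F Z"
  interpret C: graded_cstar_iso ?V "cylinder A" "cylinder A'" ?F
    using U by (rule cylinder_iso)
  have Z': "coeff_rel ?V ?F Z Z'"
    unfolding Z'_def by (rule C.coeff_rel_change)
  have "is_pushforward D A' (\<lambda>f. f 0) Z' X'"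
    by (rule is_pushforward[OF C.graded_cstar_iso_axioms _ _ Z Z' X rel(1) push(1)])
      (auto simp: cylinder_def)
  moreover have "is_pushforward D A' (\<lambda>f. f 1) Z' Y'"
    by (rule is_pushforward[OF C.graded_cstar_iso_axioms _ _ Z Z' Y rel(2) push(2)])
      (auto simp: cylinder_def)
  ultimately show ?thesis
    using kasparov_module[OF X rel(1)] kasparov_module[OF Y rel(2)] C.kasparov_module[OF Z Z']
    by (auto simp: homotopy_def kasparov_modules_def)
qed

text \<open>Working with the relation instead of a map absorbs the values of the module operations
  outside the carriers, on which equality of records also depends.\<close>

definition change_class ::
  "'d graded_cstar \<Rightarrow> ('d, 'a, real) kasparov set \<Rightarrow> ('d, 'c, real) kasparov set" where
  "change_class D P = {X' \<in> kasparov_modules D A'. \<exists>X\<in>P. coeff_rel U f X X'}"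

end

section \<open>Isomorphism invariance of the KK-groups\<close>

lemma homotopy_kasparov:
  assumes "(X, Y) \<in> homotopy D A"
  shows "kasparov_module D A X" "kasparov_module D A Y"
  using assms by (auto simp: homotopy_def kasparov_modules_def)

text \<open>With \<open>U\<close> equal to the carrier, the inverse is an isomorphism of the same
  kind, so each one-directional transport result can also be read backwards.\<close>

locale graded_cstar_iso_carrier = graded_cstar_iso "carrier A" A A' f for A A' f
begin

lemma inverse_carrier: "graded_cstar_iso_carrier A' A (inv_into (carrier A) f)"
  using inverse_cstar by (simp add: image_carrier graded_cstar_iso_carrier_def)

sublocale inv: graded_cstar_iso "carrier A'" A' A "inv_into (carrier A) f"
  using inverse_carrier by (simp add: graded_cstar_iso_carrier_def)

lemma rel_sym:
  assumes "kasparov_module D A X" "coeff_rel (carrier A) f X X'"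
  shows "coeff_rel (carrier A') (inv_into (carrier A) f) X' X"
  using coeff_rel_sym[OF assms] by (simp add: image_carrier)

text \<open>Inverting twice gives back \<open>f\<close> only on the carrier, which is where the
  inner products of a Hilbert module lie.\<close>

lemma rel_sym':
  assumes "kasparov_module D A' X'" "coeff_rel (carrier A') (inv_into (carrier A) f) X' X"
  shows "coeff_rel (carrier A) f X X'"
proof -
  have "inv_into (carrier A') (inv_into (carrier A) f) a = f a" if "a \<in> carrier A" for a
    using that by (metis image_mem inv.inv_f inv_f)
  then show ?thesis
    using inv.coeff_rel_sym[OF assms] inv.kasparov_module[OF assms]
    by (auto simp: coeff_rel_def inv.image_carrier kasparov_module_def graded_hilbert_module.ip_closed)
qed

lemma lift_module:
  assumes "kasparov_module D A' X'"
  obtains X where "kasparov_module D A X" "coeff_rel (carrier A) f X X'"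
  using assms inv.coeff_rel_change inv.kasparov_module rel_sym' by meson

lemma homotopy_iff:
  assumes "kasparov_module D A X" "kasparov_module D A Y"
    and "coeff_rel (carrier A) f X X'" "coeff_rel (carrier A) f Y Y'"
  shows "(X', Y') \<in> homotopy D A' \<longleftrightarrow> (X, Y) \<in> homotopy D A"
  using homotopy[OF refl _ assms(3,4)] inv.homotopy[OF refl] rel_sym assms by meson

text \<open>One inclusion is \<open>homotopy\<close>. For the other, any \<open>Y'\<close> homotopic
  to \<open>X'\<close> is lifted to a module over \<open>A\<close>, and \<open>homotopy_iff\<close>
  places the lift in the class of \<open>X\<close>.\<close>

lemma change_class_homotopy:
  assumes X: "kasparov_module D A X" and rel: "coeff_rel (carrier A) f X X'"
  shows "change_class D (homotopy D A `` {X}) = homotopy D A' `` {X'}"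
proof (intro subset_antisym subsetI)
  fix Y' assume "Y' \<in> change_class D (homotopy D A `` {X})"
  then show "Y' \<in> homotopy D A' `` {X'}"
    using homotopy rel by (auto simp: change_class_def)
next
  fix Y' assume "Y' \<in> homotopy D A' `` {X'}"
  then have XY': "(X', Y') \<in> homotopy D A'" by simp
  then obtain Y where Y: "kasparov_module D A Y" "coeff_rel (carrier A) f Y Y'"
    using homotopy_kasparov lift_module by meson
  then show "Y' \<in> change_class D (homotopy D A `` {X})"
    using XY' homotopy_iff[OF X Y(1) rel Y(2)] homotopy_kasparov(2)[OF XY']
    by (auto simp: change_class_def kasparov_modules_def)
qed

text \<open>An element of the carrier is the homotopy image of a single module \<open>Z\<close>, so
  membership reduces to \<open>homotopy_iff\<close> for \<open>Z\<close> and
  \<open>X\<close>.\<close>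

lemma change_class_mem_iff:
  assumes P: "P \<in> carrier (KK D A)" and X: "kasparov_module D A X"
    and rel: "coeff_rel (carrier A) f X X'"
  shows "X' \<in> change_class D P \<longleftrightarrow> X \<in> P"
proof -
  obtain Z where Z: "kasparov_module D A Z" and P: "P = homotopy D A `` {Z}"
    using P by (auto simp: KK_def quotient_def kasparov_modules_def)
  have "change_class D P = homotopy D A' `` {change_coeff (carrier A) f Z}"
    unfolding P using Z coeff_rel_change by (rule change_class_homotopy)
  then show ?thesis
    using homotopy_iff[OF Z X coeff_rel_change rel] by (simp add: P)
qed

lemma change_class_Union: "change_class D (\<Union>M) = \<Union>(change_class D ` M)"
  by (auto simp: change_class_def)

theorem KK_iso:
  fixes D :: "'d graded_cstar"
  shows "KK D A \<cong> KK D A'"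
proof -
  have class_mem: "X' \<in> kasparov_modules D A'" if "X' \<in> change_class D P" for P X'
    using that by (simp add: change_class_def)
  have closed: "change_class D P \<in> carrier (KK D A')" if P: "P \<in> carrier (KK D A)" for P
  proof -
    obtain X where X: "kasparov_module D A X" and P_eq: "P = homotopy D A `` {X}"
      using P by (auto simp: KK_def quotient_def kasparov_modules_def)
    have "change_class D P = homotopy D A' `` {change_coeff (carrier A) f X}"
      unfolding P_eq using X coeff_rel_change by (rule change_class_homotopy)
    moreover have "change_coeff (carrier A) f X \<in> kasparov_modules D A'"
      using kasparov_module[OF X coeff_rel_change] by (simp add: kasparov_modules_def)
    ultimately show ?thesis
      by (simp add: KK_def quotientI)
  qed
  have mult: "change_class D (P \<otimes>\<^bsub>KK D A\<^esub> Q) = change_class D P \<otimes>\<^bsub>KK D A'\<^esub> change_class D Q"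
    if P: "P \<in> carrier (KK D A)" and Q: "Q \<in> carrier (KK D A)" for P Q
  proof -
    have PQ: "kasparov_module D A X" if "X \<in> P \<or> X \<in> Q" for X
      using that P Q homotopy_kasparov by (auto simp: KK_def quotient_def)
    \<comment> \<open>A product is the union of the classes of all direct sums, and
      \<open>change_class\<close> commutes with unions; it remains to match the two families of
      classes.\<close>
    have "change_class D ` {homotopy D A `` {W} | W X Y. X \<in> P \<and> Y \<in> Q \<and>
          W \<in> kasparov_modules D A \<and> is_direct_sum D A X Y W} =
        {homotopy D A' `` {W} | W X Y. X \<in> change_class D P \<and> Y \<in> change_class D Q \<and>
          W \<in> kasparov_modules D A' \<and> is_direct_sum D A' X Y W}" (is "change_class D ` ?L = ?R")
    proof (intro subset_antisym subsetI)
      fix S assume "S \<in> change_class D ` ?L"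
      then obtain W X Y where S: "S = change_class D (homotopy D A `` {W})"
        and XY: "X \<in> P" "Y \<in> Q" and W: "kasparov_module D A W" and sum: "is_direct_sum D A X Y W"
        by (auto simp: kasparov_modules_def)
      let ?c = "\<lambda>X :: ('d, 'a, real) kasparov. change_coeff (carrier A) f X"
      have "S = homotopy D A' `` {?c W}"
        unfolding S using W coeff_rel_change by (rule change_class_homotopy)
      moreover have "?c X \<in> change_class D P" "?c Y \<in> change_class D Q"
        using XY change_class_mem_iff[OF P _ coeff_rel_change]
          change_class_mem_iff[OF Q _ coeff_rel_change] PQ by auto
      moreover have "?c W \<in> kasparov_modules D A'"
        using kasparov_module[OF W coeff_rel_change] by (simp add: kasparov_modules_def)
      moreover have "is_direct_sum D A' (?c X) (?c Y) (?c W)"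
        using XY PQ W sum by (intro is_direct_sum[of _ X _ Y _ W] coeff_rel_change) auto
      ultimately show "S \<in> ?R"
        by blast
    next
      fix S assume "S \<in> ?R"
      then obtain W' X' Y' where S: "S = homotopy D A' `` {W'}"
        and XY': "X' \<in> change_class D P" "Y' \<in> change_class D Q"
        and W': "kasparov_module D A' W'" and sum: "is_direct_sum D A' X' Y' W'"
        by (auto simp: kasparov_modules_def)
      obtain W where W: "kasparov_module D A W" "coeff_rel (carrier A) f W W'"
        using W' by (rule lift_module)
      obtain X Y where XY: "X \<in> P" "Y \<in> Q" "coeff_rel (carrier A) f X X'" "coeff_rel (carrier A) f Y Y'"
        using XY' by (auto simp: change_class_def)
      \<comment> \<open>Transport of direct sums along the inverse isomorphism brings the sum back
        to \<open>A\<close>.\<close>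
      have "is_direct_sum D A X Y W"
      proof (rule inv.is_direct_sum[OF _ _ _ _ W' _ sum])
        show "kasparov_module D A' X'" "kasparov_module D A' Y'"
          using XY' by (auto simp: change_class_def kasparov_modules_def)
      qed (use XY PQ W rel_sym in auto)
      then have "homotopy D A `` {W} \<in> ?L"
        using XY W by (auto simp: kasparov_modules_def)
      moreover have "S = change_class D (homotopy D A `` {W})"
        using W S by (simp add: change_class_homotopy)
      ultimately show "S \<in> change_class D ` ?L"
        by (rule rev_image_eqI)
    qed
    then show ?thesis
      by (simp add: KK_def change_class_Union)
  qed
  have "inj_on (change_class D) (carrier (KK D A))"
  proof (rule inj_onI)
    fix P Q assume P: "P \<in> carrier (KK D A)" and Q: "Q \<in> carrier (KK D A)"
      and eq: "change_class D P = change_class D Q"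
    have PQ: "kasparov_module D A X" if "X \<in> P \<or> X \<in> Q" for X
      using that P Q homotopy_kasparov by (auto simp: KK_def quotient_def)
    \<comment> \<open>Membership of \<open>X\<close> is read off from its partner
      \<open>change_coeff (carrier A) f X\<close>.\<close>
    have "X \<in> P \<longleftrightarrow> X \<in> Q" if "kasparov_module D A X" for X
      using change_class_mem_iff[OF P that coeff_rel_change]
        change_class_mem_iff[OF Q that coeff_rel_change] eq by simp
    then show "P = Q"
      using PQ by blast
  qed
  moreover have "carrier (KK D A') \<subseteq> change_class D ` carrier (KK D A)"
  proof
    fix P' assume "P' \<in> carrier (KK D A')"
    then obtain X' where X': "kasparov_module D A' X'" and P': "P' = homotopy D A' `` {X'}"
      by (auto simp: KK_def quotient_def kasparov_modules_def)
    obtain X where X: "kasparov_module D A X" "coeff_rel (carrier A) f X X'"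
      using X' by (rule lift_module)
    then have "P' = change_class D (homotopy D A `` {X})"
      using P' by (simp add: change_class_homotopy)
    moreover have "homotopy D A `` {X} \<in> carrier (KK D A)"
      using X by (simp add: KK_def kasparov_modules_def quotientI)
    ultimately show "P' \<in> change_class D ` carrier (KK D A)"
      by (rule image_eqI)
  qed
  ultimately have "change_class D \<in> iso (KK D A) (KK D A')"
    using closed mult by (auto simp: iso_def hom_def bij_betw_def)
  then show ?thesis
    unfolding is_iso_def by blast
qed

end

section \<open>Linear combinations\<close>

lemma add_grp_simps [simp]:
  "carrier (add_grp V) = carrier V" "monoid.mult (add_grp V) = vadd V" "one (add_grp V) = vzero V"
  by (simp_all add: add_grp_def)

text \<open>Vectors and coefficients are separate arguments, so an identity between combinations of
  the same vectors reduces to one between coefficient functions. The vectors may be dependent, as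
  only equal coefficients are ever turned into equal combinations.\<close>

definition lincomb :: "('v, 'm) cspace_scheme \<Rightarrow> 'k set \<Rightarrow> ('k \<Rightarrow> complex) \<Rightarrow> ('k \<Rightarrow> 'v) \<Rightarrow> 'v" where
  "lincomb V I c x = vsum V (\<lambda>i. c i \<odot>\<^bsub>V\<^esub> x i) I"

context complex_space
begin

sublocale G: comm_group "add_grp V"
  by (rule add_comm_group)

lemma add_closed [simp]: "x \<in> carrier V \<Longrightarrow> y \<in> carrier V \<Longrightarrow> x \<boxplus> y \<in> carrier V"
  using G.m_closed by simp

lemma zero_closed [simp]: "vzero V \<in> carrier V"
  using G.one_closed by simp

lemma vsum_closed: "(\<And>i. i \<in> I \<Longrightarrow> x i \<in> carrier V) \<Longrightarrow> vsum V x I \<in> carrier V"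
  using G.finprod_closed[of x I] by auto

lemma idem_zero:
  assumes "w \<in> carrier V" "w \<boxplus> w = w"
  shows "w = vzero V"
  using assms G.l_cancel_one[of w w] by simp

lemma scale_zero_right: "z \<odot> vzero V = vzero V"
  using scale_add[of "vzero V" "vzero V" z] G.r_one[of "vzero V"]
  by (intro idem_zero) (simp_all add: scale_closed)

lemma scale_zero_left: "x \<in> carrier V \<Longrightarrow> 0 \<odot> x = vzero V"
  using add_scale[of x 0 0] by (intro idem_zero) (simp_all add: scale_closed)

lemma neg_right: "x \<in> carrier V \<Longrightarrow> x \<boxplus> (- 1) \<odot> x = vzero V"
  using add_scale[of x 1 "- 1"] by (simp add: scale_one scale_zero_left)

lemma lincomb_closed:
  assumes "\<And>i. i \<in> I \<Longrightarrow> x i \<in> carrier V"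
  shows "lincomb V I c x \<in> carrier V"
  unfolding lincomb_def using assms by (intro vsum_closed scale_closed)

lemma lincomb_cong:
  assumes "\<And>i. i \<in> I \<Longrightarrow> x i \<in> carrier V" "\<And>i. i \<in> I \<Longrightarrow> c i = d i"
    "\<And>i. i \<in> I \<Longrightarrow> x i = y i"
  shows "lincomb V I c x = lincomb V I d y"
  unfolding lincomb_def using assms by (intro G.finprod_cong') (auto simp: scale_closed)

lemma lincomb_empty: "lincomb V {} c x = vzero V"
  using G.finprod_empty by (simp add: lincomb_def)

lemma lincomb_insert:
  assumes "finite I" "j \<notin> I" "x j \<in> carrier V" "\<And>i. i \<in> I \<Longrightarrow> x i \<in> carrier V"
  shows "lincomb V (insert j I) c x = (c j \<odot> x j) \<boxplus> lincomb V I c x"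
  unfolding lincomb_def using G.finprod_insert[OF assms(1,2)] assms(3,4)
  by (simp add: scale_closed Pi_def)

lemma lincomb_add:
  assumes "\<And>i. i \<in> I \<Longrightarrow> x i \<in> carrier V" "finite I"
  shows "lincomb V I c x \<boxplus> lincomb V I d x = lincomb V I (\<lambda>i. c i + d i) x"
proof -
  have "lincomb V I (\<lambda>i. c i + d i) x = vsum V (\<lambda>i. (c i \<odot> x i) \<boxplus> (d i \<odot> x i)) I"
    unfolding lincomb_def using assms
    by (intro G.finprod_cong') (auto simp: scale_closed add_scale)
  also have "\<dots> = lincomb V I c x \<boxplus> lincomb V I d x"
    unfolding lincomb_def using assms G.finprod_multf[of "\<lambda>i. c i \<odot> x i" I "\<lambda>i. d i \<odot> x i"]
    by (simp add: scale_closed Pi_def)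
  finally show ?thesis by simp
qed

lemma lincomb_scale:
  assumes "\<And>i. i \<in> I \<Longrightarrow> x i \<in> carrier V" "finite I"
  shows "z \<odot> lincomb V I c x = lincomb V I (\<lambda>i. z * c i) x"
  using assms(2,1)
proof (induction I rule: finite_induct)
  case (insert j I)
  then show ?case
    by (simp add: lincomb_insert scale_add scale_closed lincomb_closed scale_scale)
qed (simp add: lincomb_empty scale_zero_right)

lemma lincomb_zero:
  assumes "\<And>i. i \<in> I \<Longrightarrow> x i \<in> carrier V" "\<And>i. i \<in> I \<Longrightarrow> c i = 0"
  shows "lincomb V I c x = vzero V"
  unfolding lincomb_def using assms G.finprod_one_eqI[of I "\<lambda>i. c i \<odot> x i"]
  by (simp add: scale_zero_left)

lemma lincomb_delta:
  assumes "\<And>i. i \<in> I \<Longrightarrow> x i \<in> carrier V" "finite I" "j \<in> I"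
  shows "lincomb V I (\<lambda>i. if i = j then 1 else 0) x = x j"
proof -
  have "lincomb V (I - {j}) (\<lambda>i. if i = j then 1 else 0) x = vzero V"
    using assms by (intro lincomb_zero) auto
  moreover have "lincomb V (insert j (I - {j})) (\<lambda>i. if i = j then 1 else 0) x =
      (1 \<odot> x j) \<boxplus> lincomb V (I - {j}) (\<lambda>i. if i = j then 1 else 0) x"
    using assms by (subst lincomb_insert) auto
  ultimately have "lincomb V (insert j (I - {j})) (\<lambda>i. if i = j then 1 else 0) x = x j"
    using assms G.r_one[of "x j"] by (simp only: scale_one add_grp_simps)
  then show ?thesis
    using assms(3) by (simp add: insert_absorb)
qed

lemma lincomb_sum:
  assumes "\<And>i. i \<in> I \<Longrightarrow> x i \<in> carrier V" "finite I" "finite K"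
  shows "vsum V (\<lambda>k. lincomb V I (c k) x) K = lincomb V I (\<lambda>i. \<Sum>k\<in>K. c k i) x"
  using assms(3)
proof (induction K rule: finite_induct)
  case empty
  then show ?case
    using assms G.finprod_empty by (simp add: lincomb_zero)
next
  case (insert k K)
  then show ?case
    using assms G.finprod_insert[OF insert(1,2), of "\<lambda>k. lincomb V I (c k) x"]
    by (simp add: lincomb_closed lincomb_add)
qed

text \<open>Substitution multiplies the coefficient matrices; this collapses nested expansions onto
  one family of vectors.\<close>

lemma lincomb_lincomb:
  assumes "\<And>i. i \<in> I \<Longrightarrow> x i \<in> carrier V" "finite I" "finite K"
  shows "lincomb V K d (\<lambda>k. lincomb V I (c k) x) = lincomb V I (\<lambda>i. \<Sum>k\<in>K. d k * c k i) x"
  unfolding lincomb_def[of V K] using assms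
  by (simp add: lincomb_scale lincomb_sum[OF assms])

lemma lincomb_add_vectors:
  assumes "\<And>i. i \<in> I \<Longrightarrow> x i \<in> carrier V" "\<And>i. i \<in> I \<Longrightarrow> y i \<in> carrier V"
  shows "lincomb V I c (\<lambda>i. x i \<boxplus> y i) = lincomb V I c x \<boxplus> lincomb V I c y"
proof -
  have "lincomb V I c (\<lambda>i. x i \<boxplus> y i) = vsum V (\<lambda>i. (c i \<odot> x i) \<boxplus> (c i \<odot> y i)) I"
    unfolding lincomb_def using assms
    by (intro G.finprod_cong') (auto simp: scale_closed scale_add)
  then show ?thesis
    unfolding lincomb_def using assms G.finprod_multf[of "\<lambda>i. c i \<odot> x i" I "\<lambda>i. c i \<odot> y i"]
    by (simp add: scale_closed Pi_def)
qed

lemma lincomb_scale_vectors: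
  assumes "\<And>i. i \<in> I \<Longrightarrow> x i \<in> carrier V" "finite I"
  shows "lincomb V I c (\<lambda>i. z \<odot> x i) = z \<odot> lincomb V I c x"
proof -
  have "lincomb V I c (\<lambda>i. z \<odot> x i) = lincomb V I (\<lambda>i. z * c i) x"
    unfolding lincomb_def using assms
    by (intro G.finprod_cong') (auto simp: scale_closed scale_scale mult.commute)
  then show ?thesis
    using assms by (simp add: lincomb_scale)
qed

lemma lincomb_two:
  assumes "x 0 \<in> carrier V" "x 1 \<in> carrier V"
  shows "lincomb V {..<2::nat} c x = (c 0 \<odot> x 0) \<boxplus> (c 1 \<odot> x 1)"
proof -
  have "lincomb V {1::nat} c x = c 1 \<odot> x 1"
    using assms lincomb_insert[of "{}" 1 x c] G.r_one[of "c 1 \<odot> x 1"]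
    by (simp add: lincomb_empty scale_closed)
  moreover have "{..<2} = {0, 1 :: nat}"
    by auto
  ultimately show ?thesis
    using assms lincomb_insert[of "{1::nat}" 0 x c] by simp
qed

lemma vsum_cong:
  assumes "\<And>i. i \<in> I \<Longrightarrow> x i \<in> carrier V" "\<And>i. i \<in> I \<Longrightarrow> x i = y i"
  shows "vsum V x I = vsum V y I"
  using assms by (intro G.finprod_cong') auto

end

section \<open>Graded tensor products\<close>

text \<open>The part of the axioms of a graded *-algebra that is inherited by the tensor products
  with an arbitrary finite-dimensional second factor, regardless of whether the latter is an
  algebra.\<close>

locale graded_prealgebra = complex_space A
  for A :: "('a, 'm) graded_star_scheme" (structure) +
  assumes pre_mult_closed: "a \<in> carrier A \<Longrightarrow> b \<in> carrier A \<Longrightarrow> a \<star> b \<in> carrier A"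
    and pre_mult_add_right: "a \<in> carrier A \<Longrightarrow> b \<in> carrier A \<Longrightarrow> c \<in> carrier A
          \<Longrightarrow> a \<star> (b \<boxplus> c) = (a \<star> b) \<boxplus> (a \<star> c)"
    and pre_mult_scale_right: "a \<in> carrier A \<Longrightarrow> b \<in> carrier A \<Longrightarrow> a \<star> (z \<odot> b) = z \<odot> (a \<star> b)"
    and pre_adj_closed: "a \<in> carrier A \<Longrightarrow> adj A a \<in> carrier A"
    and pre_adj_add: "a \<in> carrier A \<Longrightarrow> b \<in> carrier A \<Longrightarrow> adj A (a \<boxplus> b) = adj A a \<boxplus> adj A b"
    and pre_adj_scale: "a \<in> carrier A \<Longrightarrow> adj A (z \<odot> a) = cnj z \<odot> adj A a"
    and pre_grading_linear: "clinear_map A A (grading A)"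
begin

lemma grading_closed: "a \<in> carrier A \<Longrightarrow> grading A a \<in> carrier A"
  using pre_grading_linear by (simp add: clinear_map_def)

lemma grading_add: "a \<in> carrier A \<Longrightarrow> b \<in> carrier A \<Longrightarrow> grading A (a \<boxplus> b) = grading A a \<boxplus> grading A b"
  using pre_grading_linear by (simp add: clinear_map_def)

lemma grading_scale: "a \<in> carrier A \<Longrightarrow> grading A (z \<odot> a) = z \<odot> grading A a"
  using pre_grading_linear by (simp add: clinear_map_def)

lemma grading_pow_closed: "a \<in> carrier A \<Longrightarrow> (grading A ^^ n) a \<in> carrier A"
  by (induction n) (auto simp: grading_closed)

lemma hom_part_closed: "a \<in> carrier A \<Longrightarrow> hom_part A t a \<in> carrier A"
  by (simp add: hom_part_def scale_closed grading_closed)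

end

sublocale graded_star_algebra \<subseteq> graded_prealgebra
  by unfold_locales
    (simp_all add: mult_closed mult_add_right mult_scale_right adj_closed adj_add adj_scale grading_linear)

lemma gtensor_alg_simps [simp]:
  "carrier (gtensor_alg A m D) = {..<m} \<rightarrow>\<^sub>E carrier A"
  "vadd (gtensor_alg A m D) x y = (\<lambda>p\<in>{..<m}. x p \<boxplus>\<^bsub>A\<^esub> y p)"
  "vzero (gtensor_alg A m D) = (\<lambda>p\<in>{..<m}. vzero A)"
  "vscale (gtensor_alg A m D) z x = (\<lambda>p\<in>{..<m}. z \<odot>\<^bsub>A\<^esub> x p)"
  "grading (gtensor_alg A m D) x =
     (\<lambda>p\<in>{..<m}. lincomb A {..<m} (\<lambda>k. grading D (std_basis m k) p) (\<lambda>k. grading A (x k)))"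
  by (simp_all add: gtensor_alg_def lincomb_def)

text \<open>Structure constants of \<open>D\<close>, with the left factor cut down to degree
  \<open>s\<close>. The sign is left out because \<open>gtensor_mult\<close> turns it into a power
  of the grading of \<open>A\<close>.\<close>

definition mult_coeff :: "nat \<Rightarrow> (nat \<Rightarrow> complex, 'o) graded_star_scheme \<Rightarrow> nat \<Rightarrow> nat \<times> nat \<times> nat \<Rightarrow> complex" where
  "mult_coeff m D p = (\<lambda>(k, l, s). (hom_part D s (std_basis m k) \<star>\<^bsub>D\<^esub> std_basis m l) p)"

definition adj_coeff :: "nat \<Rightarrow> (nat \<Rightarrow> complex, 'o) graded_star_scheme \<Rightarrow> nat \<Rightarrow> nat \<times> nat \<Rightarrow> complex" where
  "adj_coeff m D p = (\<lambda>(k, s). adj D (hom_part D s (std_basis m k)) p)"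

section \<open>Product and adjoint in coordinates\<close>

context graded_prealgebra
begin

text \<open>The projection to degree \<open>t\<close> averages the powers of the grading against the
  character \<open>(- 1) ^ (s * t)\<close> of the group of order two.\<close>

lemma mult_hom_part:
  assumes "a \<in> carrier A" "b \<in> carrier A"
  shows "a \<star> hom_part A t b = lincomb A {..<2} (\<lambda>s. (- 1) ^ (s * t) / 2) (\<lambda>s. a \<star> (grading A ^^ s) b)"
  using assms
  by (simp add: hom_part_def lincomb_two pre_mult_closed grading_closed pre_mult_add_right
      pre_mult_scale_right scale_closed scale_add scale_scale)

lemma adj_hom_part:
  assumes "a \<in> carrier A"
  shows "adj A (hom_part A t a) = lincomb A {..<2} (\<lambda>s. (- 1) ^ (s * t) / 2) (\<lambda>s. adj A ((grading A ^^ s) a))"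
  using assms
  by (simp add: hom_part_def lincomb_two pre_adj_closed grading_closed pre_adj_add pre_adj_scale
      scale_closed scale_add scale_scale)

text \<open>Moving a basis part of degree \<open>s\<close> past \<open>y l\<close> applies
  \<open>grading A ^^ s\<close>: this is what the signed sum over the degrees \<open>t\<close>
  amounts to. The sum over four indices shrinks to one over three.\<close>

lemma gtensor_mult:
  assumes x: "x \<in> {..<m} \<rightarrow>\<^sub>E carrier A" and y: "y \<in> {..<m} \<rightarrow>\<^sub>E carrier A" and p: "p < m"
  shows "amult (gtensor_alg A m D) x y p =
    lincomb A ({..<m} \<times> {..<m} \<times> {..<2}) (mult_coeff m D p) (\<lambda>(k, l, s). x k \<star> (grading A ^^ s) (y l))"
proof -
  let ?I = "{..<m} \<times> {..<m} \<times> {..<2::nat}"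
  let ?K = "{..<m} \<times> {..<m} \<times> {..<2::nat} \<times> {..<2::nat}"
  define X where "X = (\<lambda>(k, l, s). x k \<star> (grading A ^^ s) (y l))"
  define M where "M s k l = mult_coeff m D p (k, l, s)" for s k l
  \<comment> \<open>Coefficients of \<open>x k \<star> hom_part A t (y l)\<close> in the family
    \<open>X\<close>.\<close>
  define e :: "nat \<times> nat \<times> nat \<times> nat \<Rightarrow> nat \<times> nat \<times> nat \<Rightarrow> complex"
    where "e = (\<lambda>(k, l, s, t) i. \<Sum>r<2. (- 1) ^ (r * t) / 2 * (if i = (k, l, r) then 1 else 0))"
  have X: "X i \<in> carrier A" if "i \<in> ?I" for i
    using that x y by (auto simp: X_def intro!: pre_mult_closed grading_pow_closed)
  have "x k \<star> hom_part A t (y l) = lincomb A ?I (e (k, l, s, t)) X"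
    if "k < m" "l < m" for k l s t
  proof -
    have "x k \<star> hom_part A t (y l) = lincomb A {..<2} (\<lambda>s. (- 1) ^ (s * t) / 2) (\<lambda>s. X (k, l, s))"
      unfolding X_def prod.case using that x y by (intro mult_hom_part) auto
    also have "\<dots> = lincomb A {..<2} (\<lambda>s. (- 1) ^ (s * t) / 2)
        (\<lambda>s. lincomb A ?I (\<lambda>i. if i = (k, l, s) then 1 else 0) X)"
      using that by (intro lincomb_cong X) (auto simp: lincomb_delta[OF X])
    also have "\<dots> = lincomb A ?I (e (k, l, s, t)) X"
      by (simp add: lincomb_lincomb[OF X] e_def)
    finally show ?thesis .
  qed
  then have "amult (gtensor_alg A m D) x y p =
      lincomb A ?K (\<lambda>(k, l, s, t). (- 1) ^ (s * t) * M s k l) (\<lambda>k. lincomb A ?I (e k) X)"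
    using p unfolding lincomb_def[of A ?K] gtensor_alg_def
    by (simp, intro vsum_cong)
      (auto simp: M_def mult_coeff_def lincomb_closed X intro!: scale_closed pre_mult_closed hom_part_closed
         PiE_mem[OF x] PiE_mem[OF y])
  also have "\<dots> = lincomb A ?I (\<lambda>i. \<Sum>(k, l, s, t)\<in>?K. (- 1) ^ (s * t) * M s k l * e (k, l, s, t) i) X"
    by (subst lincomb_lincomb[OF X]) (auto simp: case_prod_unfold)
  also have "\<dots> = lincomb A ?I (mult_coeff m D p) X"
  proof (rule lincomb_cong[OF X])
    fix i assume "i \<in> ?I"
    then obtain k' l' r' where i: "i = (k', l', r')" "k' < m" "l' < m" "r' < 2"
      by auto
    \<comment> \<open>Orthogonality of characters: summing
      \<open>(- 1) ^ (s * t) * (- 1) ^ (r * t) / 2\<close> over \<open>t\<close> leaves only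
      \<open>s = r\<close>.\<close>
    have "(\<Sum>s<2. \<Sum>t<2. (- 1) ^ (s * t) * M s k l * e (k, l, s, t) i) =
        (if k = k' then if l = l' then M r' k l else 0 else 0)" for k l
      using \<open>r' < 2\<close> by (auto simp: i(1) e_def numeral_2_eq_2 less_Suc_eq)
    then have "(\<Sum>(k, l, s, t)\<in>?K. (- 1) ^ (s * t) * M s k l * e (k, l, s, t) i) =
        (\<Sum>k<m. \<Sum>l<m. if k = k' then if l = l' then M r' k l else 0 else 0)"
      by (simp add: sum.cartesian_product[symmetric])
    also have "\<dots> = (\<Sum>k<m. if k = k' then \<Sum>l<m. if l = l' then M r' k l else 0 else 0)"
      by (intro sum.cong) auto
    also have "\<dots> = M r' k' l'"
      using i by simp
    finally show "(\<Sum>(k, l, s, t)\<in>?K. (- 1) ^ (s * t) * M s k l * e (k, l, s, t) i) = mult_coeff m D p i"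
      by (simp add: i M_def)
  qed auto
  finally show ?thesis
    by (simp add: X_def)
qed

text \<open>The signs collapse as for the product; the coefficients of the degree projections are
  real, so the adjoint does not alter them.\<close>

lemma gtensor_adj:
  assumes x: "x \<in> {..<m} \<rightarrow>\<^sub>E carrier A" and p: "p < m"
  shows "adj (gtensor_alg A m D) x p =
    lincomb A ({..<m} \<times> {..<2}) (adj_coeff m D p) (\<lambda>(k, s). adj A ((grading A ^^ s) (x k)))"
proof -
  let ?I = "{..<m} \<times> {..<2::nat}"
  let ?K = "{..<m} \<times> {..<2::nat} \<times> {..<2::nat}"
  define X where "X = (\<lambda>(k, s). adj A ((grading A ^^ s) (x k)))"
  define M where "M s k = adj_coeff m D p (k, s)" for s k
  define e :: "nat \<times> nat \<times> nat \<Rightarrow> nat \<times> nat \<Rightarrow> complex"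
    where "e = (\<lambda>(k, s, t) i. \<Sum>r<2. (- 1) ^ (r * t) / 2 * (if i = (k, r) then 1 else 0))"
  have X: "X i \<in> carrier A" if "i \<in> ?I" for i
    using that x by (auto simp: X_def intro!: pre_adj_closed grading_pow_closed)
  have "adj A (hom_part A t (x k)) = lincomb A ?I (e (k, s, t)) X"
    if "k < m" for k s t
  proof -
    have "adj A (hom_part A t (x k)) = lincomb A {..<2} (\<lambda>s. (- 1) ^ (s * t) / 2) (\<lambda>s. X (k, s))"
      unfolding X_def prod.case using that x by (intro adj_hom_part) auto
    also have "\<dots> = lincomb A {..<2} (\<lambda>s. (- 1) ^ (s * t) / 2)
        (\<lambda>s. lincomb A ?I (\<lambda>i. if i = (k, s) then 1 else 0) X)"
      using that by (intro lincomb_cong X) (auto simp: lincomb_delta[OF X])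
    also have "\<dots> = lincomb A ?I (e (k, s, t)) X"
      by (simp add: lincomb_lincomb[OF X] e_def)
    finally show ?thesis .
  qed
  then have "adj (gtensor_alg A m D) x p =
      lincomb A ?K (\<lambda>(k, s, t). (- 1) ^ (s * t) * M s k) (\<lambda>k. lincomb A ?I (e k) X)"
    using p unfolding lincomb_def[of A ?K] gtensor_alg_def
    by (simp, intro vsum_cong)
      (auto simp: M_def adj_coeff_def lincomb_closed X intro!: scale_closed pre_adj_closed hom_part_closed
         PiE_mem[OF x])
  also have "\<dots> = lincomb A ?I (\<lambda>i. \<Sum>(k, s, t)\<in>?K. (- 1) ^ (s * t) * M s k * e (k, s, t) i) X"
    by (subst lincomb_lincomb[OF X]) (auto simp: case_prod_unfold)
  also have "\<dots> = lincomb A ?I (adj_coeff m D p) X"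
  proof (rule lincomb_cong[OF X])
    fix i assume "i \<in> ?I"
    then obtain k' r' where i: "i = (k', r')" "k' < m" "r' < 2"
      by auto
    have "(\<Sum>s<2. \<Sum>t<2. (- 1) ^ (s * t) * M s k * e (k, s, t) i) =
        (if k = k' then M r' k else 0)" for k
      using \<open>r' < 2\<close> by (auto simp: i(1) e_def numeral_2_eq_2 less_Suc_eq)
    then have "(\<Sum>(k, s, t)\<in>?K. (- 1) ^ (s * t) * M s k * e (k, s, t) i) =
        (\<Sum>k<m. if k = k' then M r' k else 0)"
      by (simp add: sum.cartesian_product[symmetric])
    also have "\<dots> = M r' k'"
      using i by simp
    finally show "(\<Sum>(k, s, t)\<in>?K. (- 1) ^ (s * t) * M s k * e (k, s, t) i) = adj_coeff m D p i"
      by (simp add: i M_def)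
  qed auto
  finally show ?thesis
    by (simp add: X_def)
qed

lemma mult_extensional: "amult (gtensor_alg A m D) x y \<in> extensional {..<m}"
  by (simp add: gtensor_alg_def)

lemma adj_extensional: "adj (gtensor_alg A m D) x \<in> extensional {..<m}"
  by (simp add: gtensor_alg_def)

lemma gtensor_complex_space: "complex_space (gtensor_alg A m D)"
proof -
  have comm: "comm_group (add_grp (gtensor_alg A m D))"
  proof (rule comm_groupI; simp only: add_grp_simps gtensor_alg_simps)
    fix x y assume x: "x \<in> {..<m} \<rightarrow>\<^sub>E carrier A" and y: "y \<in> {..<m} \<rightarrow>\<^sub>E carrier A"
    show "(\<lambda>p\<in>{..<m}. x p \<boxplus> y p) \<in> {..<m} \<rightarrow>\<^sub>E carrier A"
      using PiE_mem[OF x] PiE_mem[OF y] by (simp add: restrict_PiE_iff)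
    show "(\<lambda>p\<in>{..<m}. x p \<boxplus> y p) = (\<lambda>p\<in>{..<m}. y p \<boxplus> x p)"
      using G.m_comm PiE_mem[OF x] PiE_mem[OF y] by (intro restrict_ext) simp
    fix z assume z: "z \<in> {..<m} \<rightarrow>\<^sub>E carrier A"
    show "(\<lambda>p\<in>{..<m}. (\<lambda>p\<in>{..<m}. x p \<boxplus> y p) p \<boxplus> z p) =
        (\<lambda>p\<in>{..<m}. x p \<boxplus> (\<lambda>p\<in>{..<m}. y p \<boxplus> z p) p)"
      using G.m_assoc PiE_mem[OF x] PiE_mem[OF y] PiE_mem[OF z] by (intro restrict_ext) simp
  next
    show "(\<lambda>p\<in>{..<m}. vzero A) \<in> {..<m} \<rightarrow>\<^sub>E carrier A"
      by auto
  next
    fix x assume x: "x \<in> {..<m} \<rightarrow>\<^sub>E carrier A"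
    have "(\<lambda>p\<in>{..<m}. x p) = x"
      using x by (simp add: PiE_restrict)
    moreover have "(\<lambda>p\<in>{..<m}. (\<lambda>p\<in>{..<m}. vzero A) p \<boxplus> x p) = (\<lambda>p\<in>{..<m}. x p)"
      using G.l_one PiE_mem[OF x] by (intro restrict_ext) simp
    ultimately show "(\<lambda>p\<in>{..<m}. (\<lambda>p\<in>{..<m}. vzero A) p \<boxplus> x p) = x"
      by simp
    show "\<exists>y\<in>{..<m} \<rightarrow>\<^sub>E carrier A. (\<lambda>p\<in>{..<m}. y p \<boxplus> x p) = (\<lambda>p\<in>{..<m}. vzero A)"
    proof (rule bexI)
      have "(- 1) \<odot> a \<boxplus> a = vzero A" if "a \<in> carrier A" for a
        using neg_right[OF that] G.m_comm[of a "(- 1) \<odot> a"] that by (simp add: scale_closed)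
      then show "(\<lambda>p\<in>{..<m}. (\<lambda>p\<in>{..<m}. (- 1) \<odot> x p) p \<boxplus> x p) = (\<lambda>p\<in>{..<m}. vzero A)"
        using PiE_mem[OF x] by (intro restrict_ext) simp
      show "(\<lambda>p\<in>{..<m}. (- 1) \<odot> x p) \<in> {..<m} \<rightarrow>\<^sub>E carrier A"
        using PiE_mem[OF x] by (simp add: restrict_PiE_iff scale_closed)
    qed
  qed
  show ?thesis
  proof (rule complex_space.intro[OF comm]; simp only: gtensor_alg_simps)
    fix x c d assume x: "x \<in> {..<m} \<rightarrow>\<^sub>E carrier A"
    show "(\<lambda>p\<in>{..<m}. c \<odot> x p) \<in> {..<m} \<rightarrow>\<^sub>E carrier A"
      using PiE_mem[OF x] by (simp add: restrict_PiE_iff scale_closed)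
    show "(\<lambda>p\<in>{..<m}. (c + d) \<odot> x p) = (\<lambda>p\<in>{..<m}. (\<lambda>p\<in>{..<m}. c \<odot> x p) p \<boxplus> (\<lambda>p\<in>{..<m}. d \<odot> x p) p)"
      using PiE_mem[OF x] by (intro restrict_ext) (simp add: add_scale)
    show "(\<lambda>p\<in>{..<m}. c \<odot> (\<lambda>p\<in>{..<m}. d \<odot> x p) p) = (\<lambda>p\<in>{..<m}. (c * d) \<odot> x p)"
      using PiE_mem[OF x] by (intro restrict_ext) (simp add: scale_scale)
    have "(\<lambda>p\<in>{..<m}. x p) = x"
      using x by (simp add: PiE_restrict)
    moreover have "(\<lambda>p\<in>{..<m}. 1 \<odot> x p) = (\<lambda>p\<in>{..<m}. x p)"
      using PiE_mem[OF x] by (intro restrict_ext) (simp add: scale_one)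
    ultimately show "(\<lambda>p\<in>{..<m}. 1 \<odot> x p) = x"
      by simp
    fix y assume y: "y \<in> {..<m} \<rightarrow>\<^sub>E carrier A"
    show "(\<lambda>p\<in>{..<m}. c \<odot> (\<lambda>p\<in>{..<m}. x p \<boxplus> y p) p) =
        (\<lambda>p\<in>{..<m}. (\<lambda>p\<in>{..<m}. c \<odot> x p) p \<boxplus> (\<lambda>p\<in>{..<m}. c \<odot> y p) p)"
      using PiE_mem[OF x] PiE_mem[OF y] by (intro restrict_ext) (simp add: scale_add)
  qed
qed

text \<open>Serves iteration: the coordinate formulas become applicable with a tensor product as
  first factor. They inherit linearity in the second argument and conjugate linearity of the adjoint
  from \<open>A\<close>.\<close>

lemma gtensor_prealgebra: "graded_prealgebra (gtensor_alg A m D)"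
proof -
  interpret T: complex_space "gtensor_alg A m D"
    by (rule gtensor_complex_space)
  have pow_add: "(grading A ^^ s) (a \<boxplus> b) = (grading A ^^ s) a \<boxplus> (grading A ^^ s) b"
    if "a \<in> carrier A" "b \<in> carrier A" for a b s
    using that by (induction s) (auto simp: grading_add grading_pow_closed)
  have pow_scale: "(grading A ^^ s) (z \<odot> a) = z \<odot> (grading A ^^ s) a"
    if "a \<in> carrier A" for a s z
    using that by (induction s) (auto simp: grading_scale grading_pow_closed)
  have closed: "x k \<star> (grading A ^^ s) (y l) \<in> carrier A" "adj A ((grading A ^^ s) (x k)) \<in> carrier A"
    if "x \<in> {..<m} \<rightarrow>\<^sub>E carrier A" "y \<in> {..<m} \<rightarrow>\<^sub>E carrier A" "k < m" "l < m" for x y k l s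
    using that by (auto intro!: pre_mult_closed grading_pow_closed pre_adj_closed)
  have scale_mem: "(\<lambda>p\<in>{..<m}. z \<odot> x p) \<in> {..<m} \<rightarrow>\<^sub>E carrier A"
    if x: "x \<in> {..<m} \<rightarrow>\<^sub>E carrier A" for x z
    using PiE_mem[OF x] by (simp add: restrict_PiE_iff scale_closed)
  have add_mem: "(\<lambda>p\<in>{..<m}. x p \<boxplus> y p) \<in> {..<m} \<rightarrow>\<^sub>E carrier A"
    if x: "x \<in> {..<m} \<rightarrow>\<^sub>E carrier A" and y: "y \<in> {..<m} \<rightarrow>\<^sub>E carrier A" for x y
    using PiE_mem[OF x] PiE_mem[OF y] by (simp add: restrict_PiE_iff)
  have mult_mem: "amult (gtensor_alg A m D) x y \<in> {..<m} \<rightarrow>\<^sub>E carrier A"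
    if "x \<in> {..<m} \<rightarrow>\<^sub>E carrier A" "y \<in> {..<m} \<rightarrow>\<^sub>E carrier A" for x y
    using that closed mult_extensional
    by (auto simp: PiE_iff gtensor_mult intro!: lincomb_closed)
  have adj_mem: "adj (gtensor_alg A m D) x \<in> {..<m} \<rightarrow>\<^sub>E carrier A"
    if "x \<in> {..<m} \<rightarrow>\<^sub>E carrier A" for x
    using that closed adj_extensional
    by (auto simp: PiE_iff gtensor_adj intro!: lincomb_closed)
  show ?thesis
  proof (rule graded_prealgebra.intro[OF gtensor_complex_space graded_prealgebra_axioms.intro];
      (simp only: gtensor_alg_simps)?)
    fix x y z assume x: "x \<in> {..<m} \<rightarrow>\<^sub>E carrier A" and y: "y \<in> {..<m} \<rightarrow>\<^sub>E carrier A"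
    show "amult (gtensor_alg A m D) x y \<in> {..<m} \<rightarrow>\<^sub>E carrier A"
      using x y by (rule mult_mem)
    show "amult (gtensor_alg A m D) x (\<lambda>p\<in>{..<m}. z \<odot> y p) =
        (\<lambda>p\<in>{..<m}. z \<odot> amult (gtensor_alg A m D) x y p)" for z
    proof (rule extensionalityI[OF mult_extensional restrict_extensional])
      fix p assume "p \<in> {..<m}"
      then have "amult (gtensor_alg A m D) x (\<lambda>p\<in>{..<m}. z \<odot> y p) p =
        lincomb A ({..<m} \<times> {..<m} \<times> {..<2}) (mult_coeff m D p)
          (\<lambda>(k, l, s). x k \<star> (grading A ^^ s) ((\<lambda>p\<in>{..<m}. z \<odot> y p) l))"
        using x scale_mem[OF y] by (intro gtensor_mult) simp_all
      also have "\<dots> = lincomb A ({..<m} \<times> {..<m} \<times> {..<2}) (mult_coeff m D p)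
          (\<lambda>i. z \<odot> (case i of (k, l, s) \<Rightarrow> x k \<star> (grading A ^^ s) (y l)))"
        using closed x y
        by (intro lincomb_cong)
          (auto simp: pow_scale pre_mult_scale_right grading_pow_closed PiE_mem[OF x] PiE_mem[OF y] scale_closed)
      also have "\<dots> = (\<lambda>p\<in>{..<m}. z \<odot> amult (gtensor_alg A m D) x y p) p"
        using \<open>p \<in> _\<close> closed x y by (subst lincomb_scale_vectors) (auto simp: gtensor_mult)
      finally show "amult (gtensor_alg A m D) x (\<lambda>p\<in>{..<m}. z \<odot> y p) p =
        (\<lambda>p\<in>{..<m}. z \<odot> amult (gtensor_alg A m D) x y p) p" .
    qed
    assume z: "z \<in> {..<m} \<rightarrow>\<^sub>E carrier A"
    show "amult (gtensor_alg A m D) x (\<lambda>p\<in>{..<m}. y p \<boxplus> z p) =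
        (\<lambda>p\<in>{..<m}. amult (gtensor_alg A m D) x y p \<boxplus> amult (gtensor_alg A m D) x z p)"
    proof (rule extensionalityI[OF mult_extensional restrict_extensional])
      fix p assume "p \<in> {..<m}"
      then have "amult (gtensor_alg A m D) x (\<lambda>p\<in>{..<m}. y p \<boxplus> z p) p =
        lincomb A ({..<m} \<times> {..<m} \<times> {..<2}) (mult_coeff m D p)
          (\<lambda>(k, l, s). x k \<star> (grading A ^^ s) ((\<lambda>p\<in>{..<m}. y p \<boxplus> z p) l))"
        using x add_mem[OF y z] by (intro gtensor_mult) simp_all
      also have "\<dots> = lincomb A ({..<m} \<times> {..<m} \<times> {..<2}) (mult_coeff m D p)
          (\<lambda>i. (case i of (k, l, s) \<Rightarrow> x k \<star> (grading A ^^ s) (y l))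
             \<boxplus> (case i of (k, l, s) \<Rightarrow> x k \<star> (grading A ^^ s) (z l)))"
        using closed x y z
        by (intro lincomb_cong)
          (auto simp: pow_add pre_mult_add_right grading_pow_closed PiE_mem[OF x] PiE_mem[OF y] PiE_mem[OF z])
      also have "\<dots> = (\<lambda>p\<in>{..<m}. amult (gtensor_alg A m D) x y p \<boxplus> amult (gtensor_alg A m D) x z p) p"
        using \<open>p \<in> _\<close> closed x y z by (subst lincomb_add_vectors) (auto simp: gtensor_mult)
      finally show "amult (gtensor_alg A m D) x (\<lambda>p\<in>{..<m}. y p \<boxplus> z p) p =
        (\<lambda>p\<in>{..<m}. amult (gtensor_alg A m D) x y p \<boxplus> amult (gtensor_alg A m D) x z p) p" .
    qed
  next
    fix x assume x: "x \<in> {..<m} \<rightarrow>\<^sub>E carrier A"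
    show "adj (gtensor_alg A m D) x \<in> {..<m} \<rightarrow>\<^sub>E carrier A"
      using x by (rule adj_mem)
    show "adj (gtensor_alg A m D) (\<lambda>p\<in>{..<m}. z \<odot> x p) =
        (\<lambda>p\<in>{..<m}. cnj z \<odot> adj (gtensor_alg A m D) x p)" for z
    proof (rule extensionalityI[OF adj_extensional restrict_extensional])
      fix p assume "p \<in> {..<m}"
      then have "adj (gtensor_alg A m D) (\<lambda>p\<in>{..<m}. z \<odot> x p) p =
        lincomb A ({..<m} \<times> {..<2}) (adj_coeff m D p)
          (\<lambda>(k, s). adj A ((grading A ^^ s) ((\<lambda>p\<in>{..<m}. z \<odot> x p) k)))"
        using scale_mem[OF x] by (intro gtensor_adj) simp_all
      also have "\<dots> = lincomb A ({..<m} \<times> {..<2}) (adj_coeff m D p)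
          (\<lambda>i. cnj z \<odot> (case i of (k, s) \<Rightarrow> adj A ((grading A ^^ s) (x k))))"
        using closed x
        by (intro lincomb_cong)
          (auto simp: pow_scale pre_adj_scale grading_pow_closed PiE_mem[OF x] scale_closed pre_adj_closed)
      also have "\<dots> = (\<lambda>p\<in>{..<m}. cnj z \<odot> adj (gtensor_alg A m D) x p) p"
        using \<open>p \<in> _\<close> closed x by (subst lincomb_scale_vectors) (auto simp: gtensor_adj)
      finally show "adj (gtensor_alg A m D) (\<lambda>p\<in>{..<m}. z \<odot> x p) p =
        (\<lambda>p\<in>{..<m}. cnj z \<odot> adj (gtensor_alg A m D) x p) p" .
    qed
    fix y assume y: "y \<in> {..<m} \<rightarrow>\<^sub>E carrier A"
    show "adj (gtensor_alg A m D) (\<lambda>p\<in>{..<m}. x p \<boxplus> y p) =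
        (\<lambda>p\<in>{..<m}. adj (gtensor_alg A m D) x p \<boxplus> adj (gtensor_alg A m D) y p)"
    proof (rule extensionalityI[OF adj_extensional restrict_extensional])
      fix p assume "p \<in> {..<m}"
      then have "adj (gtensor_alg A m D) (\<lambda>p\<in>{..<m}. x p \<boxplus> y p) p =
        lincomb A ({..<m} \<times> {..<2}) (adj_coeff m D p)
          (\<lambda>(k, s). adj A ((grading A ^^ s) ((\<lambda>p\<in>{..<m}. x p \<boxplus> y p) k)))"
        using add_mem[OF x y] by (intro gtensor_adj) simp_all
      also have "\<dots> = lincomb A ({..<m} \<times> {..<2}) (adj_coeff m D p)
          (\<lambda>i. (case i of (k, s) \<Rightarrow> adj A ((grading A ^^ s) (x k)))
             \<boxplus> (case i of (k, s) \<Rightarrow> adj A ((grading A ^^ s) (y k))))"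
        using closed x y
        by (intro lincomb_cong)
          (auto simp: pow_add pre_adj_add grading_pow_closed PiE_mem[OF x] PiE_mem[OF y] pre_adj_closed)
      also have "\<dots> = (\<lambda>p\<in>{..<m}. adj (gtensor_alg A m D) x p \<boxplus> adj (gtensor_alg A m D) y p) p"
        using \<open>p \<in> _\<close> closed x y by (subst lincomb_add_vectors) (auto simp: gtensor_adj)
      finally show "adj (gtensor_alg A m D) (\<lambda>p\<in>{..<m}. x p \<boxplus> y p) p =
        (\<lambda>p\<in>{..<m}. adj (gtensor_alg A m D) x p \<boxplus> adj (gtensor_alg A m D) y p) p" .
    qed
  next
    show "clinear_map (gtensor_alg A m D) (gtensor_alg A m D) (grading (gtensor_alg A m D))"
      unfolding clinear_map_def gtensor_alg_simps
    proof (intro conjI ballI allI)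
      fix x assume x: "x \<in> {..<m} \<rightarrow>\<^sub>E carrier A"
      let ?G = "\<lambda>x. \<lambda>p\<in>{..<m}. lincomb A {..<m} (\<lambda>k. grading D (std_basis m k) p) (\<lambda>k. grading A (x k))"
      show "?G x \<in> {..<m} \<rightarrow>\<^sub>E carrier A"
        unfolding restrict_PiE_iff using PiE_mem[OF x] by (auto intro!: lincomb_closed grading_closed)
      show "?G (\<lambda>p\<in>{..<m}. c \<odot> x p) = (\<lambda>p\<in>{..<m}. c \<odot> ?G x p)" for c
      proof (rule restrict_ext)
        fix p assume p: "p \<in> {..<m}"
        have "lincomb A {..<m} (\<lambda>k. grading D (std_basis m k) p) (\<lambda>k. grading A ((\<lambda>p\<in>{..<m}. c \<odot> x p) k)) =
          lincomb A {..<m} (\<lambda>k. grading D (std_basis m k) p) (\<lambda>k. c \<odot> grading A (x k))"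
          using PiE_mem[OF x] by (intro lincomb_cong) (auto simp: grading_scale grading_closed scale_closed)
        also have "\<dots> = c \<odot> ?G x p"
          using p PiE_mem[OF x] by (simp, intro lincomb_scale_vectors) (auto simp: grading_closed)
        finally show "lincomb A {..<m} (\<lambda>k. grading D (std_basis m k) p) (\<lambda>k. grading A ((\<lambda>p\<in>{..<m}. c \<odot> x p) k)) =
            c \<odot> ?G x p" .
      qed
      fix y assume y: "y \<in> {..<m} \<rightarrow>\<^sub>E carrier A"
      show "?G (\<lambda>p\<in>{..<m}. x p \<boxplus> y p) = (\<lambda>p\<in>{..<m}. ?G x p \<boxplus> ?G y p)"
      proof (rule restrict_ext)
        fix p assume p: "p \<in> {..<m}"
        have "lincomb A {..<m} (\<lambda>k. grading D (std_basis m k) p) (\<lambda>k. grading A ((\<lambda>p\<in>{..<m}. x p \<boxplus> y p) k)) =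
          lincomb A {..<m} (\<lambda>k. grading D (std_basis m k) p) (\<lambda>k. grading A (x k) \<boxplus> grading A (y k))"
          using PiE_mem[OF x] PiE_mem[OF y] by (intro lincomb_cong) (auto simp: grading_add grading_closed)
        also have "\<dots> = ?G x p \<boxplus> ?G y p"
          using p PiE_mem[OF x] PiE_mem[OF y] by (simp, intro lincomb_add_vectors) (auto simp: grading_closed)
        finally show "lincomb A {..<m} (\<lambda>k. grading D (std_basis m k) p) (\<lambda>k. grading A ((\<lambda>p\<in>{..<m}. x p \<boxplus> y p) k)) =
            ?G x p \<boxplus> ?G y p" .
      qed
    qed
  qed
qed

end

text \<open>Coefficients are pushed forward along \<open>g\<close>, adding up over its
  fibres.\<close>

lemma (in complex_space) lincomb_reindex:
  assumes "\<And>i. i \<in> I \<Longrightarrow> x i \<in> carrier V" "finite I" "finite K" "\<And>k. k \<in> K \<Longrightarrow> g k \<in> I"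
  shows "lincomb V K d (\<lambda>k. x (g k)) = lincomb V I (\<lambda>i. \<Sum>k\<in>K. d k * (if i = g k then 1 else 0)) x"
proof -
  have "lincomb V K d (\<lambda>k. x (g k)) = lincomb V K d (\<lambda>k. lincomb V I (\<lambda>i. if i = g k then 1 else 0) x)"
    using assms(1,4) by (intro lincomb_cong) (auto simp: lincomb_delta[OF assms(1,2)])
  then show ?thesis
    by (simp add: lincomb_lincomb[OF assms(1-3)])
qed

section \<open>Functoriality of the tensor product in its first factor\<close>

context graded_star_iso
begin

lemma hom_part: "a \<in> U \<Longrightarrow> hom_part A s a \<in> U" "a \<in> U \<Longrightarrow> f (hom_part A s a) = hom_part A' s (f a)"
  by (simp_all add: hom_part_def add scale grade)

lemma vsum:
  assumes "complex_space A" "complex_space A'" "U = carrier A" "finite I" "\<And>i. i \<in> I \<Longrightarrow> x i \<in> U"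
  shows "f (vsum A x I) = vsum A' (\<lambda>i. f (x i)) I"
proof -
  interpret A: complex_space A by fact
  interpret A': complex_space A' by fact
  show ?thesis
    using assms(4,5)
  proof (induction I rule: finite_induct)
    case empty
    then show ?case
      using A.G.finprod_empty A'.G.finprod_empty by (simp add: zero)
  next
    case (insert i I)
    have x: "x j \<in> U" "f (x j) \<in> carrier A'" if "j \<in> insert i I" for j
      using insert.prems that image_mem assms(3) by auto
    have "vsum A x I \<in> U"
      using x assms(3) by (auto intro: A.vsum_closed)
    then show ?case
      using x assms(3) insert A.G.finprod_insert[OF insert(1,2), of x]
        A'.G.finprod_insert[OF insert(1,2), of "\<lambda>i. f (x i)"]
      by (simp add: Pi_def add)
  qed
qed

text \<open>The structure constants come from \<open>D\<close> alone, so \<open>f\<close> applied to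
  each component only has to commute with sums, scalars and the operations of
  \<open>A\<close>.\<close>

lemma gtensor_iso:
  assumes A: "complex_space A" and A': "complex_space A'" and U: "U = carrier A"
  shows "graded_star_iso ({..<m} \<rightarrow>\<^sub>E U) (gtensor_alg A m D) (gtensor_alg A' m D) (\<lambda>x. \<lambda>p\<in>{..<m}. f (x p))"
proof -
  let ?F = "\<lambda>x. \<lambda>p\<in>{..<m}. f (x p)"
  interpret A: complex_space A by fact
  have vsum_U: "vsum A x I \<in> U" if "\<And>i. i \<in> I \<Longrightarrow> x i \<in> U" for x and I :: "'k set"
    using that unfolding U by (rule A.vsum_closed)
  note f_vsum = vsum[OF A A' U]
  interpret inv: graded_star_iso "f ` U" A' A "inv_into U f"
    by (rule inverse)
  have image: "f ` U = carrier A'"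
    using image_carrier U by simp
  show ?thesis
  proof (rule graded_star_iso.intro)
    show "inj_on ?F ({..<m} \<rightarrow>\<^sub>E U)"
    proof (rule inj_onI)
      fix c d assume c: "c \<in> {..<m} \<rightarrow>\<^sub>E U" and d: "d \<in> {..<m} \<rightarrow>\<^sub>E U" and eq: "?F c = ?F d"
      have "c t = d t" if "t \<in> {..<m}" for t
        using fun_cong[OF eq, of t] that c d by (auto dest!: inj_onD[OF inj])
      then show "c = d"
        using c d by (rule PiE_ext[rotated 2])
    qed
    show "?F ` carrier (gtensor_alg A m D) = carrier (gtensor_alg A' m D)"
      unfolding gtensor_alg_simps
    proof (intro subset_antisym subsetI)
      fix y assume "y \<in> ?F ` ({..<m} \<rightarrow>\<^sub>E carrier A)"
      then obtain x where "y = ?F x" and x: "x \<in> {..<m} \<rightarrow>\<^sub>E carrier A"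
        by blast
      then show "y \<in> {..<m} \<rightarrow>\<^sub>E carrier A'"
        using PiE_mem[OF x] image_mem by (simp only: restrict_PiE_iff) blast
    next
      fix y assume y: "y \<in> {..<m} \<rightarrow>\<^sub>E carrier A'"
      have "(\<lambda>p\<in>{..<m}. inv_into U f (y p)) \<in> {..<m} \<rightarrow>\<^sub>E carrier A"
        using PiE_mem[OF y] inv_into_into[of _ f U] by (simp add: restrict_PiE_iff image[symmetric] U)
      moreover have "?F (\<lambda>p\<in>{..<m}. inv_into U f (y p)) = (\<lambda>p\<in>{..<m}. y p)"
        using PiE_mem[OF y] by (intro restrict_ext) (simp add: image[symmetric] f_inv_into_f)
      moreover have "(\<lambda>p\<in>{..<m}. y p) = y"
        using y by (simp add: PiE_restrict)
      ultimately show "y \<in> ?F ` ({..<m} \<rightarrow>\<^sub>E carrier A)"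
        by (metis image_eqI)
    qed
  next
    fix x assume x: "x \<in> {..<m} \<rightarrow>\<^sub>E U"
    note x_mem = PiE_mem[OF x]
    show "vscale (gtensor_alg A m D) z x \<in> {..<m} \<rightarrow>\<^sub>E U" for z
      unfolding gtensor_alg_simps restrict_PiE_iff using x_mem by (simp add: scale)
    show "?F (vscale (gtensor_alg A m D) z x) = vscale (gtensor_alg A' m D) z (?F x)" for z
      unfolding gtensor_alg_simps using x_mem by (intro restrict_ext) (simp add: scale)
    show "grading (gtensor_alg A m D) x \<in> {..<m} \<rightarrow>\<^sub>E U"
      unfolding gtensor_alg_simps restrict_PiE_iff lincomb_def
      using x_mem by (auto intro!: vsum_U scale grade)
    show "?F (grading (gtensor_alg A m D) x) = grading (gtensor_alg A' m D) (?F x)"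
      unfolding gtensor_alg_simps lincomb_def
    proof (rule restrict_ext)
      fix p assume "p \<in> {..<m}"
      interpret A': complex_space A' by fact
      have "f (vsum A (\<lambda>k. grading D (std_basis m k) p \<odot>\<^bsub>A\<^esub> grading A (x k)) {..<m})
          = vsum A' (\<lambda>k. f (grading D (std_basis m k) p \<odot>\<^bsub>A\<^esub> grading A (x k))) {..<m}"
        using x_mem by (intro f_vsum) (auto intro!: scale grade)
      also have "\<dots> = vsum A' (\<lambda>k. grading D (std_basis m k) p \<odot>\<^bsub>A'\<^esub> grading A' (?F x k)) {..<m}"
        using x_mem by (intro A'.vsum_cong)
            (auto simp: scale grade image[symmetric] intro!: inv.scale(1) inv.grade(1))
      finally show "f ((\<lambda>p\<in>{..<m}. vsum A (\<lambda>k. grading D (std_basis m k) p \<odot>\<^bsub>A\<^esub> grading A (x k)) {..<m}) p) =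
        vsum A' (\<lambda>k. grading D (std_basis m k) p \<odot>\<^bsub>A'\<^esub> grading A' (?F x k)) {..<m}"
        using \<open>p \<in> _\<close> by simp
    qed
    show "adj (gtensor_alg A m D) x \<in> {..<m} \<rightarrow>\<^sub>E U"
      unfolding gtensor_alg_def using x_mem
      by (auto simp: restrict_PiE_iff intro!: vsum_U scale adjoint hom_part)
    show "?F (adj (gtensor_alg A m D) x) = adj (gtensor_alg A' m D) (?F x)"
    proof -
      interpret A': complex_space A' by fact
      let ?c = "\<lambda>p k s t. (- 1) ^ (s * t) * adj D (hom_part D s (std_basis m k)) p"
      have "f (vsum A (\<lambda>(k, s, t). ?c p k s t \<odot>\<^bsub>A\<^esub> adj A (hom_part A t (x k))) ({..<m} \<times> {..<2} \<times> {..<2}))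
          = vsum A' (\<lambda>(k, s, t). ?c p k s t \<odot>\<^bsub>A'\<^esub> adj A' (hom_part A' t (?F x k))) ({..<m} \<times> {..<2} \<times> {..<2})" for p
      proof (subst f_vsum)
        show "vsum A' (\<lambda>i. f (case i of (k, s, t) \<Rightarrow> ?c p k s t \<odot>\<^bsub>A\<^esub> adj A (hom_part A t (x k)))) ({..<m} \<times> {..<2} \<times> {..<2})
          = vsum A' (\<lambda>(k, s, t). ?c p k s t \<odot>\<^bsub>A'\<^esub> adj A' (hom_part A' t (?F x k))) ({..<m} \<times> {..<2} \<times> {..<2})"
          using x_mem by (intro A'.vsum_cong) (auto simp: scale adjoint hom_part image[symmetric]
              intro!: inv.scale(1) inv.adjoint(1) inv.hom_part(1))
      qed (use x_mem in \<open>auto intro!: scale adjoint hom_part\<close>)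
      then show ?thesis
        unfolding gtensor_alg_def by (auto intro!: restrict_ext)
    qed
    fix y assume y: "y \<in> {..<m} \<rightarrow>\<^sub>E U"
    note y_mem = PiE_mem[OF y]
    show "vadd (gtensor_alg A m D) x y \<in> {..<m} \<rightarrow>\<^sub>E U"
      unfolding gtensor_alg_simps restrict_PiE_iff using x_mem y_mem by (simp add: add)
    show "?F (vadd (gtensor_alg A m D) x y) = vadd (gtensor_alg A' m D) (?F x) (?F y)"
      unfolding gtensor_alg_simps using x_mem y_mem by (intro restrict_ext) (simp add: add)
    show "amult (gtensor_alg A m D) x y \<in> {..<m} \<rightarrow>\<^sub>E U"
      unfolding gtensor_alg_def using x_mem y_mem
      by (auto simp: restrict_PiE_iff intro!: vsum_U scale mult hom_part)
    show "?F (amult (gtensor_alg A m D) x y) = amult (gtensor_alg A' m D) (?F x) (?F y)"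
    proof -
      interpret A': complex_space A' by fact
      let ?c = "\<lambda>p k l s t. (- 1) ^ (s * t) * (hom_part D s (std_basis m k) \<star>\<^bsub>D\<^esub> std_basis m l) p"
      let ?K = "{..<m} \<times> {..<m} \<times> {..<2} \<times> {..<2}"
      have "f (vsum A (\<lambda>(k, l, s, t). ?c p k l s t \<odot>\<^bsub>A\<^esub> (x k \<star>\<^bsub>A\<^esub> hom_part A t (y l))) ?K)
          = vsum A' (\<lambda>(k, l, s, t). ?c p k l s t \<odot>\<^bsub>A'\<^esub> (?F x k \<star>\<^bsub>A'\<^esub> hom_part A' t (?F y l))) ?K" for p
      proof (subst f_vsum)
        show "vsum A' (\<lambda>i. f (case i of (k, l, s, t) \<Rightarrow> ?c p k l s t \<odot>\<^bsub>A\<^esub> (x k \<star>\<^bsub>A\<^esub> hom_part A t (y l)))) ?K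
          = vsum A' (\<lambda>(k, l, s, t). ?c p k l s t \<odot>\<^bsub>A'\<^esub> (?F x k \<star>\<^bsub>A'\<^esub> hom_part A' t (?F y l))) ?K"
          using x_mem y_mem by (intro A'.vsum_cong) (auto simp: scale mult hom_part image[symmetric]
              intro!: inv.scale(1) inv.mult(1) inv.hom_part(1))
      qed (use x_mem y_mem in \<open>auto intro!: scale mult hom_part\<close>)
      then show ?thesis
        unfolding gtensor_alg_def by (auto intro!: restrict_ext)
    qed
  qed (use carrier_subset zero in \<open>auto simp: U\<close>)
qed

end

section \<open>The first Clifford algebra\<close>

lemma less_two_cases: "p < (2::nat) \<Longrightarrow> p = 0 \<or> p = 1"
  by auto

lemma sum_less_two: "(\<Sum>s<2::nat. f s) = f 0 + (f 1 :: complex)"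
  by (simp add: numeral_2_eq_2)

text \<open>The basis consists of two orthogonal projections exchanged by the grading. Hence only
  \<open>l = p\<close> survives, and the degree \<open>s\<close> part of a projection has the entry
  1/2 at its own index and \<open>(- 1) ^ s / 2\<close> at the other.\<close>

lemma mult_coeff_cliff_one:
  assumes "k < 2" "l < 2" "s < 2" "p < 2"
  shows "mult_coeff 2 cliff_one p (k, l, s) = (if l = p then (- 1) ^ (s * (k + p)) / 2 else 0)"
  using assms[THEN less_two_cases]
  by (auto simp: mult_coeff_def hom_part_def cliff_one_def std_basis_def)

lemma adj_coeff_cliff_one:
  assumes "k < 2" "s < 2" "p < 2"
  shows "adj_coeff 2 cliff_one p (k, s) = (- 1) ^ (s * (k + p)) / 2"
  using assms[THEN less_two_cases]
  by (auto simp: adj_coeff_def hom_part_def cliff_one_def std_basis_def)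

lemma grading_cliff_one_basis:
  assumes "k < 2" "p < 2"
  shows "grading cliff_one (std_basis 2 k) p = (if k = 1 - p then 1 else 0)"
  using assms[THEN less_two_cases]
  by (auto simp: cliff_one_def std_basis_def)

context graded_prealgebra
begin

text \<open>Only the basis vectors \<open>e\<^sub>k \<otimes> e\<^sub>p\<close> contribute to the component at \<open>p\<close>, and moving \<open>e\<^sub>k\<close>
  past \<open>y\<^sub>p\<close> projects to the part of degree \<open>k + p\<close>.\<close>

lemma gtensor_cliff_one_mult:
  assumes x: "x \<in> {..<2} \<rightarrow>\<^sub>E carrier A" and y: "y \<in> {..<2} \<rightarrow>\<^sub>E carrier A" and p: "p < 2"
  shows "amult (gtensor_alg A 2 cliff_one) x y p =
    (x 0 \<star> hom_part A p (y p)) \<boxplus> (x 1 \<star> hom_part A (1 + p) (y p))"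
proof -
  let ?I = "{..<2::nat} \<times> {..<2::nat} \<times> {..<2::nat}"
  define X where "X = (\<lambda>(k, l, s). x k \<star> (grading A ^^ s) (y l))"
  have X: "X i \<in> carrier A" if "i \<in> ?I" for i
    using that x y by (auto simp: X_def intro!: pre_mult_closed grading_pow_closed)
  have add: "lincomb A ?I c X \<boxplus> lincomb A ?I d X = lincomb A ?I (\<lambda>i. c i + d i) X" for c d
    by (rule lincomb_add) (auto intro: X)
  have *: "x k \<star> hom_part A t (y p) =
      lincomb A ?I (\<lambda>i. \<Sum>s<2. (- 1) ^ (s * t) / 2 * (if i = (k, p, s) then 1 else 0)) X" if "k < 2" for k t
  proof -
    have "x k \<star> hom_part A t (y p) = lincomb A {..<2} (\<lambda>s. (- 1) ^ (s * t) / 2) (\<lambda>s. X (k, p, s))"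
      unfolding X_def prod.case using that x y p by (intro mult_hom_part) auto
    also have "\<dots> = lincomb A ?I (\<lambda>i. \<Sum>s<2. (- 1) ^ (s * t) / 2 * (if i = (k, p, s) then 1 else 0)) X"
      using that p by (intro lincomb_reindex X) auto
    finally show ?thesis .
  qed
  have "amult (gtensor_alg A 2 cliff_one) x y p = lincomb A ?I (mult_coeff 2 cliff_one p) X"
    unfolding X_def using x y p by (rule gtensor_mult)
  also have "\<dots> = lincomb A ?I (\<lambda>i. \<Sum>s<2. (- 1) ^ (s * p) / 2 * (if i = (0, p, s) then 1 else 0)) X \<boxplus>
      lincomb A ?I (\<lambda>i. \<Sum>s<2. (- 1) ^ (s * (1 + p)) / 2 * (if i = (1, p, s) then 1 else 0)) X"
    unfolding add
    using p by (intro lincomb_cong X)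
      (auto simp: mult_coeff_cliff_one sum_less_two dest!: less_two_cases)
  finally show ?thesis
    by (simp add: *)
qed

text \<open>The coefficients \<open>(- 1) ^ (s * (k + p)) / 2\<close> on the powers of the grading
  form the projection to degree \<open>k + p\<close>.\<close>

lemma gtensor_cliff_one_adj:
  assumes x: "x \<in> {..<2} \<rightarrow>\<^sub>E carrier A" and p: "p < 2"
  shows "adj (gtensor_alg A 2 cliff_one) x p =
    adj A (hom_part A p (x 0)) \<boxplus> adj A (hom_part A (1 + p) (x 1))"
proof -
  let ?I = "{..<2::nat} \<times> {..<2::nat}"
  define X where "X = (\<lambda>(k, s). adj A ((grading A ^^ s) (x k)))"
  have X: "X i \<in> carrier A" if "i \<in> ?I" for i
    using that x by (auto simp: X_def intro!: pre_adj_closed grading_pow_closed)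
  have add: "lincomb A ?I c X \<boxplus> lincomb A ?I d X = lincomb A ?I (\<lambda>i. c i + d i) X" for c d
    by (rule lincomb_add) (auto intro: X)
  have *: "adj A (hom_part A t (x k)) =
      lincomb A ?I (\<lambda>i. \<Sum>s<2. (- 1) ^ (s * t) / 2 * (if i = (k, s) then 1 else 0)) X" if "k < 2" for k t
  proof -
    have "adj A (hom_part A t (x k)) = lincomb A {..<2} (\<lambda>s. (- 1) ^ (s * t) / 2) (\<lambda>s. X (k, s))"
      unfolding X_def prod.case using that x by (intro adj_hom_part) auto
    also have "\<dots> = lincomb A ?I (\<lambda>i. \<Sum>s<2. (- 1) ^ (s * t) / 2 * (if i = (k, s) then 1 else 0)) X"
      using that by (intro lincomb_reindex X) auto
    finally show ?thesis .
  qed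
  have "adj (gtensor_alg A 2 cliff_one) x p = lincomb A ?I (adj_coeff 2 cliff_one p) X"
    unfolding X_def using x p by (rule gtensor_adj)
  also have "\<dots> = lincomb A ?I (\<lambda>i. \<Sum>s<2. (- 1) ^ (s * p) / 2 * (if i = (0, s) then 1 else 0)) X \<boxplus>
      lincomb A ?I (\<lambda>i. \<Sum>s<2. (- 1) ^ (s * (1 + p)) / 2 * (if i = (1, s) then 1 else 0)) X"
    unfolding add
    using p by (intro lincomb_cong X)
      (auto simp: adj_coeff_cliff_one sum_less_two dest!: less_two_cases)
  finally show ?thesis
    by (simp add: *)
qed

lemma gtensor_cliff_one_grading:
  assumes x: "x \<in> {..<2} \<rightarrow>\<^sub>E carrier A" and p: "p < 2"
  shows "grading (gtensor_alg A 2 cliff_one) x p = grading A (x (1 - p))"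
proof -
  have X: "grading A (x k) \<in> carrier A" if "k \<in> {..<2}" for k
    using PiE_mem[OF x that] by (rule grading_closed)
  have "grading (gtensor_alg A 2 cliff_one) x p =
      lincomb A {..<2} (\<lambda>k. if k = 1 - p then 1 else 0) (\<lambda>k. grading A (x k))"
    using p X by (simp, intro lincomb_cong) (auto simp: grading_cliff_one_basis)
  also have "\<dots> = grading A (x (1 - p))"
    using X p by (intro lincomb_delta) auto
  finally show ?thesis .
qed

end

text \<open>Linear identities between given vectors are proved by passing to coefficients.\<close>

lemma (in complex_space) coefficients:
  assumes "set xs \<subseteq> carrier V" and n: "length xs = n"
  shows "\<exists>L. (\<forall>j<n. xs ! j = L (\<lambda>i. if i = j then 1 else 0)) \<and>
    (\<forall>c d. L c \<boxplus> L d = L (\<lambda>i. c i + d i)) \<and> (\<forall>z c. z \<odot> L c = L (\<lambda>i. z * c i)) \<and>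
    (\<forall>c d. (\<forall>i<n. c i = d i) \<longrightarrow> L c = L d)"
proof (intro exI conjI allI impI)
  let ?L = "\<lambda>c. lincomb V {..<n} c (\<lambda>i. xs ! i)"
  have x: "i \<in> {..<n} \<Longrightarrow> xs ! i \<in> carrier V" for i
    using assms nth_mem by auto
  show "xs ! j = ?L (\<lambda>i. if i = j then 1 else 0)" if "j < n" for j
    using lincomb_delta[where x = "\<lambda>i. xs ! i", OF x, of "{..<n}" j] that by simp
  show "?L c \<boxplus> ?L d = ?L (\<lambda>i. c i + d i)" for c d
    using x by (rule lincomb_add) auto
  show "z \<odot> ?L c = ?L (\<lambda>i. z * c i)" for z c
    using x by (rule lincomb_scale) auto
  show "?L c = ?L d" if "\<forall>i<n. c i = d i" for c d
    using x that by (intro lincomb_cong) auto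
qed

lemma less_4: "i < (4::nat) \<Longrightarrow> i = 0 \<or> i = 1 \<or> i = 2 \<or> i = 3"
  by presburger

lemma less_16: "i < (16::nat) \<Longrightarrow> i = 0 \<or> i = 1 \<or> i = 2 \<or> i = 3 \<or> i = 4 \<or> i = 5 \<or> i = 6 \<or> i = 7 \<or>
    i = 8 \<or> i = 9 \<or> i = 10 \<or> i = 11 \<or> i = 12 \<or> i = 13 \<or> i = 14 \<or> i = 15"
  by presburger

section \<open>The crossed product\<close>

lemma crossed_alg_simps [simp]:
  "carrier (crossed_alg B) = carrier B \<times> carrier B"
  "vadd (crossed_alg B) (a, b) (c, d) = (a \<boxplus>\<^bsub>B\<^esub> c, b \<boxplus>\<^bsub>B\<^esub> d)"
  "vzero (crossed_alg B) = (vzero B, vzero B)"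
  "vscale (crossed_alg B) z (a, b) = (z \<odot>\<^bsub>B\<^esub> a, z \<odot>\<^bsub>B\<^esub> b)"
  "amult (crossed_alg B) (a, b) (c, d) =
     ((a \<star>\<^bsub>B\<^esub> c) \<boxplus>\<^bsub>B\<^esub> (b \<star>\<^bsub>B\<^esub> grading B d), (a \<star>\<^bsub>B\<^esub> d) \<boxplus>\<^bsub>B\<^esub> (b \<star>\<^bsub>B\<^esub> grading B c))"
  "adj (crossed_alg B) (a, b) = (adj B a, grading B (adj B b))"
  "grading (crossed_alg B) (a, b) = (a, (- 1) \<odot>\<^bsub>B\<^esub> b)"
  by (simp_all add: crossed_alg_def Let_def)

lemma crossed_complex_space:
  assumes "complex_space B"
  shows "complex_space (crossed_alg B)"
proof -
  interpret B: complex_space B by fact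
  have group: "x \<boxplus>\<^bsub>B\<^esub> y \<boxplus>\<^bsub>B\<^esub> z = x \<boxplus>\<^bsub>B\<^esub> (y \<boxplus>\<^bsub>B\<^esub> z)" "x \<boxplus>\<^bsub>B\<^esub> y = y \<boxplus>\<^bsub>B\<^esub> x"
    "vzero B \<boxplus>\<^bsub>B\<^esub> x = x" "x \<boxplus>\<^bsub>B\<^esub> (- 1) \<odot>\<^bsub>B\<^esub> x = vzero B"
    if "x \<in> carrier B" "y \<in> carrier B" "z \<in> carrier B" for x y z
    using that B.G.m_assoc B.G.m_comm B.G.l_one B.neg_right by simp_all
  have comm: "comm_group (add_grp (crossed_alg B))"
  proof (rule comm_groupI; simp only: add_grp_simps crossed_alg_simps(1,3))
    fix x assume "x \<in> carrier B \<times> carrier B"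
    then obtain a b where x: "x = (a, b)" "a \<in> carrier B" "b \<in> carrier B"
      by blast
    show "vadd (crossed_alg B) (vzero B, vzero B) x = x"
      using x group(3) by simp
    show "\<exists>y\<in>carrier B \<times> carrier B. vadd (crossed_alg B) y x = (vzero B, vzero B)"
      using x group(2)[of "(- 1) \<odot>\<^bsub>B\<^esub> _"] group(4)
      by (intro bexI[of _ "((- 1) \<odot>\<^bsub>B\<^esub> a, (- 1) \<odot>\<^bsub>B\<^esub> b)"]) (auto simp: B.scale_closed)
  qed (auto simp: group(1), auto intro: group(2))
  show ?thesis
    by (rule complex_space.intro[OF comm])
      (auto simp: B.scale_closed B.scale_add B.add_scale B.scale_scale B.scale_one)
qed

context graded_star_algebra
begin

text \<open>In terms of the even and odd parts of \<open>a\<close>, \<open>twist p a\<close> is \<open>a\<^sub>0 + (-1)\<^sup>p\<i>a\<^sub>1\<close>, the component at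
  \<open>p\<close> of \<open>a\<^sub>0 \<otimes> 1 + \<i>a\<^sub>1 \<otimes> \<epsilon>\<close>.\<close>

definition twist :: "nat \<Rightarrow> 'a \<Rightarrow> 'a" where
  "twist p a = (((1 + (- 1) ^ p * \<i>) / 2) \<odot> a) \<boxplus> (((1 - (- 1) ^ p * \<i>) / 2) \<odot> grading A a)"

text \<open>Multiplying by 1 \<otimes> \<epsilon> on the right brings no sign and scales the
  component at \<open>p\<close> by \<open>(- 1) ^ p\<close>; this gives the image of bu.\<close>

definition crossed_to_tensor :: "'a \<times> 'a \<Rightarrow> nat \<Rightarrow> 'a" where
  "crossed_to_tensor = (\<lambda>(a, b). \<lambda>p\<in>{..<2}. twist p a \<boxplus> ((- 1) ^ p \<odot> twist p b))"

text \<open>\<open>twist 0\<close> and \<open>twist 1\<close> invert each other, as they multiply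
  the odd part by \<i> and by -\<i>. On the image of \<open>(a, b)\<close> the two twisted
  components are therefore a + b and a - b.\<close>

definition tensor_to_crossed :: "(nat \<Rightarrow> 'a) \<Rightarrow> 'a \<times> 'a" where
  "tensor_to_crossed x = ((1 / 2) \<odot> (twist 1 (x 0) \<boxplus> twist 0 (x 1)),
     (1 / 2) \<odot> (twist 1 (x 0) \<boxplus> ((- 1) \<odot> twist 0 (x 1))))"

lemmas closed = scale_closed mult_closed adj_closed grading_closed

lemma twist_closed: "a \<in> carrier A \<Longrightarrow> twist p a \<in> carrier A"
  by (simp add: twist_def closed)

lemmas expand = scale_add scale_scale mult_add_left mult_add_right mult_scale_left mult_scale_right
  adj_add adj_scale adj_mult grading_add grading_scale grading_mult grading_adj grading_grading

lemma tensor_to_crossed_inverse: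
  assumes ab: "a \<in> carrier A" "b \<in> carrier A"
  shows "tensor_to_crossed (crossed_to_tensor (a, b)) = (a, b)"
proof -
  \<comment> \<open>After expansion both sides are combinations of these four vectors.\<close>
  define xs where "xs = [a, b, grading A a, grading A b]"
  have "set xs \<subseteq> carrier A" "length xs = 4"
    using ab by (simp_all add: closed xs_def)
  then obtain L where L: "\<forall>j<4. xs ! j = L (\<lambda>i. if i = j then 1 else 0)"
    "\<forall>c d. L c \<boxplus> L d = L (\<lambda>i. c i + d i)" "\<forall>z c. z \<odot> L c = L (\<lambda>i. z * c i)"
    and cong: "\<forall>c d. (\<forall>i<4. c i = d i) \<longrightarrow> L c = L d"
    using coefficients by blast
  note atoms = L(1)[rule_format, of 0, unfolded xs_def, simplified]
    L(1)[rule_format, of 1, unfolded xs_def, simplified]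
    L(1)[rule_format, of 2, unfolded xs_def, simplified]
    L(1)[rule_format, of 3, unfolded xs_def, simplified]
  show ?thesis
    unfolding tensor_to_crossed_def crossed_to_tensor_def twist_def
    apply (simp add: expand closed ab)
    \<comment> \<open>Graded terms are replaced first: they contain \<open>a\<close> and
      \<open>b\<close>, which would otherwise be rewritten inside them.\<close>
    apply (simp only: atoms(3,4))
    apply (simp only: atoms(1,2))
    apply (simp only: L(2,3))
    apply (intro conjI cong[rule_format]; drule less_4; elim disjE; simp add: field_simps)
    done
qed

lemma crossed_to_tensor_inverse:
  assumes x: "x \<in> {..<2} \<rightarrow>\<^sub>E carrier A"
  shows "crossed_to_tensor (tensor_to_crossed x) = x"
proof -
  define a b where "a = x 0" and "b = x 1"
  have ab: "a \<in> carrier A" "b \<in> carrier A"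
    using PiE_mem[OF x] by (simp_all add: a_def b_def)
  define xs where "xs = [a, b, grading A a, grading A b]"
  have "set xs \<subseteq> carrier A" "length xs = 4"
    using ab by (simp_all add: closed xs_def)
  then obtain L where L: "\<forall>j<4. xs ! j = L (\<lambda>i. if i = j then 1 else 0)"
    "\<forall>c d. L c \<boxplus> L d = L (\<lambda>i. c i + d i)" "\<forall>z c. z \<odot> L c = L (\<lambda>i. z * c i)"
    and cong: "\<forall>c d. (\<forall>i<4. c i = d i) \<longrightarrow> L c = L d"
    using coefficients by blast
  note atoms = L(1)[rule_format, of 0, unfolded xs_def, simplified]
    L(1)[rule_format, of 1, unfolded xs_def, simplified]
    L(1)[rule_format, of 2, unfolded xs_def, simplified]
    L(1)[rule_format, of 3, unfolded xs_def, simplified]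
  have "crossed_to_tensor (tensor_to_crossed x) 0 = a \<and> crossed_to_tensor (tensor_to_crossed x) 1 = b"
    unfolding tensor_to_crossed_def crossed_to_tensor_def twist_def a_def[symmetric] b_def[symmetric]
    apply (simp add: expand closed ab)
    apply (simp only: atoms(3,4))
    apply (simp only: atoms(1,2))
    apply (simp only: L(2,3))
    apply (intro conjI cong[rule_format]; drule less_4; elim disjE; simp add: field_simps)
    done
  then have "crossed_to_tensor (tensor_to_crossed x) p = x p" if "p \<in> {..<2}" for p
    using that less_two_cases[of p] by (auto simp: a_def b_def)
  moreover have "crossed_to_tensor (tensor_to_crossed x) \<in> extensional {..<2}"
    by (simp add: crossed_to_tensor_def tensor_to_crossed_def)
  ultimately show ?thesis
    using x by (intro extensionalityI[of _ "{..<2}"]) (simp_all only: PiE_iff)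
qed

lemma crossed_to_tensor_mem:
  assumes ab: "a \<in> carrier A" "b \<in> carrier A"
  shows "crossed_to_tensor (a, b) \<in> {..<2} \<rightarrow>\<^sub>E carrier A"
  using ab by (simp add: crossed_to_tensor_def restrict_PiE_iff twist_closed scale_closed)

text \<open>The sign from moving \<epsilon> past an odd element meets the square of \<i>, and the
  two cancel. The same sign makes 1 \<otimes> \<epsilon> implement the grading, as u does in the
  crossed product.\<close>

lemma crossed_to_tensor_mult:
  assumes abcd: "a \<in> carrier A" "b \<in> carrier A" "c \<in> carrier A" "d \<in> carrier A" and p: "p < 2"
  shows "crossed_to_tensor (amult (crossed_alg A) (a, b) (c, d)) p =
    amult (gtensor_alg A 2 cliff_one) (crossed_to_tensor (a, b)) (crossed_to_tensor (c, d)) p"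
proof -
  \<comment> \<open>The expansion contains only products of \<open>a\<close> or \<open>b\<close>
    with \<open>c\<close> or \<open>d\<close>, each factor possibly graded: four pairs with four
    variants each.\<close>
  define xs where "xs = concat (map (\<lambda>(x, y). [x \<star> y, x \<star> grading A y, grading A x \<star> y, grading A x \<star> grading A y])
    [(a, c), (a, d), (b, c), (b, d)])"
  note xs_def = xs_def[simplified]
  have "set xs \<subseteq> carrier A" "length xs = 16"
    using abcd by (simp_all add: closed xs_def)
  then obtain L where L: "\<forall>j<16. xs ! j = L (\<lambda>i. if i = j then 1 else 0)"
    "\<forall>c d. L c \<boxplus> L d = L (\<lambda>i. c i + d i)" "\<forall>z c. z \<odot> L c = L (\<lambda>i. z * c i)"
    and cong: "\<forall>c d. (\<forall>i<16. c i = d i) \<longrightarrow> L c = L d"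
    using coefficients by blast
  note atoms = L(1)[rule_format, of 0, unfolded xs_def, simplified]
    L(1)[rule_format, of 1, unfolded xs_def, simplified]
    L(1)[rule_format, of 2, unfolded xs_def, simplified]
    L(1)[rule_format, of 3, unfolded xs_def, simplified]
    L(1)[rule_format, of 4, unfolded xs_def, simplified]
    L(1)[rule_format, of 5, unfolded xs_def, simplified]
    L(1)[rule_format, of 6, unfolded xs_def, simplified]
    L(1)[rule_format, of 7, unfolded xs_def, simplified]
    L(1)[rule_format, of 8, unfolded xs_def, simplified]
    L(1)[rule_format, of 9, unfolded xs_def, simplified]
    L(1)[rule_format, of 10, unfolded xs_def, simplified]
    L(1)[rule_format, of 11, unfolded xs_def, simplified]
    L(1)[rule_format, of 12, unfolded xs_def, simplified]
    L(1)[rule_format, of 13, unfolded xs_def, simplified]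
    L(1)[rule_format, of 14, unfolded xs_def, simplified]
    L(1)[rule_format, of 15, unfolded xs_def, simplified]
  show ?thesis
    unfolding gtensor_cliff_one_mult[OF crossed_to_tensor_mem[OF abcd(1,2)] crossed_to_tensor_mem[OF abcd(3,4)] p]
    using less_two_cases[OF p]
    apply (elim disjE)
    apply (simp_all add: crossed_to_tensor_def twist_def hom_part_def expand closed abcd)
    apply (simp_all only: atoms)
    apply (simp_all only: L(2,3))
    apply (rule cong[rule_format], drule less_16, elim disjE; simp add: field_simps)
    apply (rule cong[rule_format], drule less_16, elim disjE; simp add: field_simps)
    done
qed

text \<open>Conjugating \<i> gives a sign, which cancels the one in the adjoint of a tensor of two
  odd elements.\<close>

lemma crossed_to_tensor_adj:
  assumes ab: "a \<in> carrier A" "b \<in> carrier A" and p: "p < 2"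
  shows "crossed_to_tensor (adj (crossed_alg A) (a, b)) p =
    adj (gtensor_alg A 2 cliff_one) (crossed_to_tensor (a, b)) p"
proof -
  \<comment> \<open>\<open>grading_adj\<close> moves every grading inside the adjoint, so these are
    the terms that remain.\<close>
  define xs where "xs = [adj A a, adj A b, adj A (grading A a), adj A (grading A b)]"
  have "set xs \<subseteq> carrier A" "length xs = 4"
    using ab by (simp_all add: closed xs_def)
  then obtain L where L: "\<forall>j<4. xs ! j = L (\<lambda>i. if i = j then 1 else 0)"
    "\<forall>c d. L c \<boxplus> L d = L (\<lambda>i. c i + d i)" "\<forall>z c. z \<odot> L c = L (\<lambda>i. z * c i)"
    and cong: "\<forall>c d. (\<forall>i<4. c i = d i) \<longrightarrow> L c = L d"
    using coefficients by blast
  note atoms = L(1)[rule_format, of 0, unfolded xs_def, simplified]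
    L(1)[rule_format, of 1, unfolded xs_def, simplified]
    L(1)[rule_format, of 2, unfolded xs_def, simplified]
    L(1)[rule_format, of 3, unfolded xs_def, simplified]
  show ?thesis
    unfolding gtensor_cliff_one_adj[OF crossed_to_tensor_mem[OF ab] p]
    using less_two_cases[OF p]
    apply (elim disjE)
    apply (simp_all add: crossed_to_tensor_def twist_def hom_part_def expand closed ab)
    apply (simp_all only: atoms)
    apply (simp_all only: L(2,3))
    apply (rule cong[rule_format], drule less_4, elim disjE; simp add: field_simps)
    apply (rule cong[rule_format], drule less_4, elim disjE; simp add: field_simps)
    done
qed

text \<open>The grading of \<open>A\<close> sends \<open>twist (1 - p) a\<close> to
  \<open>twist p a\<close>. So the first summand is fixed, and swapping the components only changes
  the factor \<open>(- 1) ^ p\<close> of the second.\<close>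

lemma crossed_to_tensor_grading:
  assumes ab: "a \<in> carrier A" "b \<in> carrier A" and p: "p < 2"
  shows "crossed_to_tensor (grading (crossed_alg A) (a, b)) p =
    grading (gtensor_alg A 2 cliff_one) (crossed_to_tensor (a, b)) p"
proof -
  define xs where "xs = [a, b, grading A a, grading A b]"
  have "set xs \<subseteq> carrier A" "length xs = 4"
    using ab by (simp_all add: closed xs_def)
  then obtain L where L: "\<forall>j<4. xs ! j = L (\<lambda>i. if i = j then 1 else 0)"
    "\<forall>c d. L c \<boxplus> L d = L (\<lambda>i. c i + d i)" "\<forall>z c. z \<odot> L c = L (\<lambda>i. z * c i)"
    and cong: "\<forall>c d. (\<forall>i<4. c i = d i) \<longrightarrow> L c = L d"
    using coefficients by blast
  note atoms = L(1)[rule_format, of 0, unfolded xs_def, simplified]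
    L(1)[rule_format, of 1, unfolded xs_def, simplified]
    L(1)[rule_format, of 2, unfolded xs_def, simplified]
    L(1)[rule_format, of 3, unfolded xs_def, simplified]
  show ?thesis
    unfolding gtensor_cliff_one_grading[OF crossed_to_tensor_mem[OF ab] p]
    using less_two_cases[OF p]
    apply (elim disjE)
    apply (simp_all add: crossed_to_tensor_def twist_def expand closed ab)
    apply (simp_all only: atoms(3,4))
    apply (simp_all only: atoms(1,2))
    apply (simp_all only: L(2,3))
    apply (rule cong[rule_format], drule less_4, elim disjE; simp add: field_simps)
    apply (rule cong[rule_format], drule less_4, elim disjE; simp add: field_simps)
    done
qed

lemma add_interchange:
  assumes "u \<in> carrier A" "v \<in> carrier A" "w \<in> carrier A" "z \<in> carrier A"
  shows "u \<boxplus> v \<boxplus> (w \<boxplus> z) = u \<boxplus> w \<boxplus> (v \<boxplus> z)"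
  using assms G.m_assoc[of u v "w \<boxplus> z"] G.m_assoc[of u w "v \<boxplus> z"] G.m_lcomm[of v w z]
  by simp

lemma twist_add: "a \<in> carrier A \<Longrightarrow> b \<in> carrier A \<Longrightarrow> twist p (a \<boxplus> b) = twist p a \<boxplus> twist p b"
  by (simp add: twist_def expand closed add_interchange)

lemma twist_scale: "a \<in> carrier A \<Longrightarrow> twist p (z \<odot> a) = z \<odot> twist p a"
  by (simp add: twist_def expand closed mult.commute)

lemma crossed_to_tensor_extensional: "crossed_to_tensor x \<in> extensional {..<2}"
  by (simp add: crossed_to_tensor_def case_prod_beta)

lemma grading_extensional: "grading (gtensor_alg A m D) x \<in> extensional {..<m}"
  by simp

theorem crossed_iso:
  "graded_star_iso (carrier (crossed_alg A)) (crossed_alg A) (gtensor_alg A 2 cliff_one) crossed_to_tensor"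
proof (rule graded_star_iso.intro)
  show "inj_on crossed_to_tensor (carrier (crossed_alg A))"
    by (rule inj_on_inverseI[of _ tensor_to_crossed]) (auto simp: tensor_to_crossed_inverse)
  show "crossed_to_tensor ` carrier (crossed_alg A) = carrier (gtensor_alg A 2 cliff_one)"
    unfolding crossed_alg_simps gtensor_alg_simps
  proof (intro subset_antisym subsetI)
    fix x assume "x \<in> crossed_to_tensor ` (carrier A \<times> carrier A)"
    then show "x \<in> {..<2::nat} \<rightarrow>\<^sub>E carrier A"
      using crossed_to_tensor_mem by blast
  next
    fix x assume x: "x \<in> {..<2::nat} \<rightarrow>\<^sub>E carrier A"
    have "tensor_to_crossed x \<in> carrier A \<times> carrier A"
      using PiE_mem[OF x] by (simp add: tensor_to_crossed_def twist_closed scale_closed)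
    then show "x \<in> crossed_to_tensor ` (carrier A \<times> carrier A)"
      using crossed_to_tensor_inverse[OF x] by (metis image_eqI)
  qed
  have zero: "twist p (vzero A) = vzero A" for p
    using twist_scale[of "vzero A" p 0] by (simp add: scale_zero_left twist_closed)
  show "crossed_to_tensor (vzero (crossed_alg A)) = vzero (gtensor_alg A 2 cliff_one)"
    using G.l_one[of "vzero A"] by (simp add: crossed_to_tensor_def zero scale_zero_right)
next
  fix x assume "x \<in> carrier (crossed_alg A)"
  then obtain a b where x: "x = (a, b)" and ab: "a \<in> carrier A" "b \<in> carrier A"
    by auto
  show "crossed_to_tensor (vscale (crossed_alg A) z x) = vscale (gtensor_alg A 2 cliff_one) z (crossed_to_tensor x)" for z
    using ab by (simp add: x crossed_to_tensor_def twist_scale scale_add scale_scale twist_closed scale_closed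
        mult.commute fun_eq_iff)
  show "crossed_to_tensor (adj (crossed_alg A) x) = adj (gtensor_alg A 2 cliff_one) (crossed_to_tensor x)"
    using crossed_to_tensor_adj[OF ab] unfolding x
    by (intro extensionalityI[OF crossed_to_tensor_extensional adj_extensional]) simp
  show "crossed_to_tensor (grading (crossed_alg A) x) = grading (gtensor_alg A 2 cliff_one) (crossed_to_tensor x)"
    using crossed_to_tensor_grading[OF ab] unfolding x
    by (intro extensionalityI[OF crossed_to_tensor_extensional grading_extensional])
      (simp del: gtensor_alg_simps)
  fix y assume "y \<in> carrier (crossed_alg A)"
  then obtain c d where y: "y = (c, d)" and cd: "c \<in> carrier A" "d \<in> carrier A"
    by auto
  show "crossed_to_tensor (vadd (crossed_alg A) x y) =
      vadd (gtensor_alg A 2 cliff_one) (crossed_to_tensor x) (crossed_to_tensor y)"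
    using ab cd unfolding x y crossed_to_tensor_def crossed_alg_simps gtensor_alg_simps prod.case
    by (intro restrict_ext) (simp add: twist_add scale_add twist_closed scale_closed add_interchange)
  show "crossed_to_tensor (amult (crossed_alg A) x y) =
      amult (gtensor_alg A 2 cliff_one) (crossed_to_tensor x) (crossed_to_tensor y)"
    using crossed_to_tensor_mult[OF ab cd] unfolding x y
    by (intro extensionalityI[OF crossed_to_tensor_extensional mult_extensional]) simp
qed (auto simp: closed)

end

section \<open>The second Clifford algebra\<close>

lemma cliff_one_simps [simp]:
  "carrier cliff_one = {..<2} \<rightarrow>\<^sub>E UNIV"
  "vadd cliff_one x y = (\<lambda>k\<in>{..<2}. x k + y k)"
  "vzero cliff_one = (\<lambda>k\<in>{..<2}. 0)"
  "vscale cliff_one z x = (\<lambda>k\<in>{..<2}. z * x k)"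
  "amult cliff_one x y = (\<lambda>k\<in>{..<2}. x k * y k)"
  "adj cliff_one x = (\<lambda>k\<in>{..<2}. cnj (x k))"
  "grading cliff_one x = (\<lambda>k\<in>{..<2}. x (1 - k))"
  by (simp_all add: cliff_one_def)

text \<open>Lets the one-step formulas be used with \<open>cliff_one\<close> itself as first factor,
  which computes the second Clifford algebra.\<close>

lemma cliff_one_prealgebra: "graded_prealgebra cliff_one"
proof -
  have comm: "comm_group (add_grp cliff_one)"
  proof (rule comm_groupI; simp only: add_grp_simps cliff_one_simps)
    fix x :: "nat \<Rightarrow> complex" assume x: "x \<in> {..<2} \<rightarrow>\<^sub>E UNIV"
    have "restrict x {..<2} = x"
      using x by (simp add: PiE_restrict)
    then show "(\<lambda>k\<in>{..<2}. (\<lambda>k\<in>{..<2}. 0) k + x k) = x"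
      by (simp cong: restrict_cong)
    show "\<exists>y\<in>{..<2} \<rightarrow>\<^sub>E UNIV. (\<lambda>k\<in>{..<2}. y k + x k) = (\<lambda>k\<in>{..<2}. 0)"
      by (rule bexI[of _ "\<lambda>k\<in>{..<2}. - x k"]) (auto cong: restrict_cong)
  qed (auto cong: restrict_cong simp: algebra_simps)
  have restrict: "restrict x {..<2} = x" if "x \<in> {..<2} \<rightarrow>\<^sub>E UNIV" for x :: "nat \<Rightarrow> complex"
    using that by (simp add: PiE_restrict)
  have "complex_space cliff_one"
    by (rule complex_space.intro[OF comm]; simp only: cliff_one_simps)
      (simp add: restrict_PiE_iff; fail | (rule restrict_ext, simp add: algebra_simps; fail) |
        (simp add: restrict cong: restrict_cong; fail))+
  then show ?thesis
    by (rule graded_prealgebra.intro; intro graded_prealgebra_axioms.intro;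
        simp only: cliff_one_simps clinear_map_def; (intro conjI ballI allI)?)
      (simp add: restrict_PiE_iff; fail | (rule restrict_ext, simp add: algebra_simps; fail) |
        (rule restrict_ext, simp only: lessThan_iff, drule less_two_cases, elim disjE, simp_all; fail))+
qed

text \<open>By the convention of \<open>pack\<close>, the component \<open>2 * p + q\<close> belongs
  to the basis tensor \<open>e\<^sub>p \<otimes> e\<^sub>q\<close>.\<close>

definition cliff_two :: "(nat \<Rightarrow> complex) graded_cstar" where
  "cliff_two = transport_alg (pack 2) (unpack 2) (gtensor cliff_one 2 cliff_one)"

lemma cliff_2: "cliff 2 = cliff_two"
  unfolding cliff_two_def by (simp add: numeral_2_eq_2)

lemma unpack_mem: "unpack 2 x \<in> {..<2} \<rightarrow>\<^sub>E carrier cliff_one"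
  by (simp add: unpack_def)

lemma less_four_cases:
  fixes k :: nat
  assumes "k < 4"
  obtains p q where "p < 2" "q < 2" "k = 2 * p + q"
proof
  show "k div 2 < 2" "k mod 2 < 2" "k = 2 * (k div 2) + k mod 2"
    using assms by auto
qed

lemma less_four_index: "p < 2 \<Longrightarrow> q < 2 \<Longrightarrow> 2 * p + q < (4::nat)"
  by simp

lemma pack_apply: "p < 2 \<Longrightarrow> q < 2 \<Longrightarrow> pack 2 X (2 * p + q) = X q p"
  by (auto simp: pack_def dest!: less_two_cases)

lemma unpack_apply: "p < 2 \<Longrightarrow> q < 2 \<Longrightarrow> unpack 2 x q p = x (2 * p + q)"
  by (simp add: unpack_def)

text \<open>For the grading, both factors swap their basis vectors, and
  \<open>2 * (1 - p) + (1 - q) = 3 - (2 * p + q)\<close>.\<close>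

lemma cliff_two_linear:
  assumes "k < 4"
  shows "vadd cliff_two x y k = x k + y k" "vscale cliff_two z x k = z * x k"
    "grading cliff_two x k = x (3 - k)"
proof -
  interpret graded_prealgebra cliff_one by (rule cliff_one_prealgebra)
  obtain p q where k: "p < 2" "q < 2" "k = 2 * p + q"
    using assms by (rule less_four_cases)
  show "vadd cliff_two x y k = x k + y k" "vscale cliff_two z x k = z * x k"
    using k(1,2) unfolding k(3) by (simp_all add: cliff_two_def transport_alg_def gtensor_def pack_apply unpack_apply)
  show "grading cliff_two x k = x (3 - k)"
    using k(1,2) less_two_cases[OF k(1)] less_two_cases[OF k(2)] gtensor_cliff_one_grading[OF unpack_mem k(2), of x] unfolding k(3)
    by (simp add: cliff_two_def transport_alg_def gtensor_def pack_apply unpack_apply del: gtensor_alg_simps)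
      (auto simp: numeral_3_eq_3 numeral_2_eq_2)
qed

lemma unpack_components: "p < 2 \<Longrightarrow> unpack 2 x 0 p = x (2 * p)" "p < 2 \<Longrightarrow> unpack 2 x (Suc 0) p = x (Suc (2 * p))"
  by (simp_all add: unpack_def)

text \<open>The one-step formula over \<open>cliff_one\<close>: products there are pointwise in
  \<open>p\<close>, and its grading exchanges \<open>p\<close> and \<open>1 - p\<close> inside the
  degree projections.\<close>

lemma cliff_two_mult:
  assumes p: "p < 2" and q: "q < 2"
  shows "amult cliff_two x y (2 * p + q) =
    x (2 * p) * (y (2 * p + q) + (- 1) ^ q * y (2 * (1 - p) + q)) / 2 +
    x (2 * p + 1) * (y (2 * p + q) - (- 1) ^ q * y (2 * (1 - p) + q)) / 2"
proof -
  interpret graded_prealgebra cliff_one by (rule cliff_one_prealgebra)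
  have "amult cliff_two x y (2 * p + q) =
      amult (gtensor_alg cliff_one 2 cliff_one) (unpack 2 x) (unpack 2 y) q p"
    using p q by (simp add: cliff_two_def transport_alg_def gtensor_def pack_apply)
  then show ?thesis
    using p q unfolding gtensor_cliff_one_mult[OF unpack_mem unpack_mem q]
    by (simp add: hom_part_def unpack_components unpack_apply field_simps)
qed

lemma cliff_two_adj:
  assumes p: "p < 2" and q: "q < 2"
  shows "adj cliff_two x (2 * p + q) =
    cnj (x (2 * p) + (- 1) ^ q * x (2 * (1 - p))) / 2 +
    cnj (x (2 * p + 1) - (- 1) ^ q * x (2 * (1 - p) + 1)) / 2"
proof -
  interpret graded_prealgebra cliff_one by (rule cliff_one_prealgebra)
  have "adj cliff_two x (2 * p + q) = adj (gtensor_alg cliff_one 2 cliff_one) (unpack 2 x) q p"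
    using p q by (simp add: cliff_two_def transport_alg_def gtensor_def pack_apply)
  then show ?thesis
    using p q unfolding gtensor_cliff_one_adj[OF unpack_mem q]
    by (simp add: hom_part_def unpack_components unpack_apply field_simps)
qed

lemma hom_part_cliff_two: "k < 4 \<Longrightarrow> hom_part cliff_two s x k = (x k + (- 1) ^ s * x (3 - k)) / 2"
  by (simp add: hom_part_def cliff_two_linear)

lemma std_basis_apply: "i < m \<Longrightarrow> std_basis m k i = (if i = k then 1 else 0)"
  by (simp add: std_basis_def)

text \<open>The indices \<open>3 - 2 * p\<close> and \<open>2 - 2 * p\<close> are the reflections of
  \<open>2 * p\<close> and \<open>2 * p + 1\<close> under the grading. One half comes from the
  degree projection and one from the product, whence the quarters.\<close>

lemma mult_coeff_cliff_two:
  assumes p: "p < 2" and q: "q < 2"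
  shows "mult_coeff 4 cliff_two (2 * p + q) (k, l, s) =
    ((if 2 * p = k then 1 else 0) + (- 1) ^ s * (if 3 - 2 * p = k then 1 else 0)) *
      ((if 2 * p + q = l then 1 else 0) + (- 1) ^ q * (if 2 * (1 - p) + q = l then 1 else 0)) / 4 +
    ((if 2 * p + 1 = k then 1 else 0) + (- 1) ^ s * (if 2 - 2 * p = k then 1 else 0)) *
      ((if 2 * p + q = l then 1 else 0) - (- 1) ^ q * (if 2 * (1 - p) + q = l then 1 else 0)) / 4"
  using p q unfolding mult_coeff_def prod.case cliff_two_mult[OF p q]
  by (simp add: hom_part_cliff_two std_basis_apply)

lemma adj_coeff_cliff_two:
  assumes p: "p < 2" and q: "q < 2" and k: "k < 4"
  shows "adj_coeff 4 cliff_two (2 * p + q) (k, s) =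
    ((if 2 * p = k then 1 else 0) + (- 1) ^ s * (if 3 - 2 * p = k then 1 else 0) +
      (- 1) ^ q * ((if 2 * (1 - p) = k then 1 else 0) + (- 1) ^ s * (if 1 + 2 * p = k then 1 else 0))) / 4 +
    ((if 2 * p + 1 = k then 1 else 0) + (- 1) ^ s * (if 2 - 2 * p = k then 1 else 0) -
      (- 1) ^ q * ((if 2 * (1 - p) + 1 = k then 1 else 0) + (- 1) ^ s * (if 2 * p = k then 1 else 0))) / 4"
  using less_two_cases[OF p] less_two_cases[OF q] less_4[OF k]
  unfolding adj_coeff_def prod.case cliff_two_adj[OF p q]
  by (elim disjE; simp add: hom_part_cliff_two std_basis_apply)

lemma grading_cliff_two: "k < 4 \<Longrightarrow> grading cliff_two (std_basis 4 l) k = (if l = 3 - k then 1 else 0)"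
  by (simp add: cliff_two_linear std_basis_apply)


section \<open>Iterated tensor products\<close>

context graded_prealgebra
begin

interpretation T: graded_prealgebra "gtensor_alg A 2 cliff_one"
  by (rule gtensor_prealgebra)

text \<open>The order of the indices is the one fixed by \<open>pack\<close> in the definition of \<open>cliff\<close>.\<close>

definition flatten :: "(nat \<Rightarrow> nat \<Rightarrow> 'a) \<Rightarrow> nat \<Rightarrow> 'a" where
  "flatten x = (\<lambda>k\<in>{..<4}. x (k mod 2) (k div 2))"

lemma flatten_apply: "p < 2 \<Longrightarrow> q < 2 \<Longrightarrow> flatten x (2 * p + q) = x q p"
  by (auto simp: flatten_def dest!: less_two_cases)

lemma flatten_mem:
  assumes "\<And>p q. p < 2 \<Longrightarrow> q < 2 \<Longrightarrow> x q p \<in> carrier A"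
  shows "flatten x \<in> {..<4} \<rightarrow>\<^sub>E carrier A"
  unfolding flatten_def restrict_PiE_iff using assms by auto

lemma hom_part_gtensor:
  assumes v: "v \<in> {..<2} \<rightarrow>\<^sub>E carrier A" and p: "p < 2"
  shows "hom_part (gtensor_alg A 2 cliff_one) t v p =
    (1 / 2) \<odot> (v p \<boxplus> ((- 1) ^ t \<odot> grading A (v (1 - p))))"
  using p gtensor_cliff_one_grading[OF v p] by (simp add: hom_part_def del: gtensor_alg_simps(5))

text \<open>Both sides are expanded over the products of an entry of \<open>x\<close> with a
  possibly graded entry of \<open>y\<close>: the left by using the one-step formula twice, the right
  by \<open>gtensor_mult\<close>. The assumption \<open>gg\<close> removes the double gradings on
  the left, and 32 coefficients are compared for each component.\<close>

lemma flatten_mult: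
  assumes x: "x \<in> {..<2} \<rightarrow>\<^sub>E ({..<2} \<rightarrow>\<^sub>E carrier A)" and y: "y \<in> {..<2} \<rightarrow>\<^sub>E ({..<2} \<rightarrow>\<^sub>E carrier A)"
    and p: "p < 2" and q: "q < 2"
    and gg: "\<And>a. a \<in> carrier A \<Longrightarrow> grading A (grading A a) = a"
  shows "amult (gtensor_alg (gtensor_alg A 2 cliff_one) 2 cliff_one) x y q p =
    amult (gtensor_alg A 4 cliff_two) (flatten x) (flatten y) (2 * p + q)"
proof -
  let ?T = "gtensor_alg A 2 cliff_one"
  let ?I = "{..<4::nat} \<times> {..<4::nat} \<times> {..<2::nat}"
  define X where "X = (\<lambda>(k, l, s). flatten x k \<star> (grading A ^^ s) (flatten y l))"
  define L where "L c = lincomb A ?I c X" for c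
  have x1: "x k \<in> {..<2} \<rightarrow>\<^sub>E carrier A" and y1: "y k \<in> {..<2} \<rightarrow>\<^sub>E carrier A" if "k < 2" for k
    using PiE_mem[OF x] PiE_mem[OF y] that by auto
  then have x01: "x 0 \<in> {..<2} \<rightarrow>\<^sub>E carrier A" "x 1 \<in> {..<2} \<rightarrow>\<^sub>E carrier A"
    by simp_all
  have xy: "x k i \<in> carrier A" "y k i \<in> carrier A" if "k < 2" "i < 2" for k i
    using PiE_mem[OF x1] PiE_mem[OF y1] that by auto
  have X: "X i \<in> carrier A" if "i \<in> ?I" for i
    using that PiE_mem[OF flatten_mem[OF xy(1)]] PiE_mem[OF flatten_mem[OF xy(2)]]
    by (auto simp: X_def intro!: pre_mult_closed grading_pow_closed)
  have delta: "X j = L (\<lambda>i. if i = j then 1 else 0)" if "j \<in> ?I" for j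
    unfolding L_def using X that by (intro lincomb_delta[symmetric]) auto
  \<comment> \<open>\<open>flatten\<close> puts \<open>x k i\<close> at index
    \<open>2 * i + k\<close>; the last entry of a triple tells whether the second factor is
    graded.\<close>
  have atoms: "x k i \<star> y l j = L (\<lambda>r. if r = (2 * i + k, 2 * j + l, 0) then 1 else 0)"
    "x k i \<star> grading A (y l j) = L (\<lambda>r. if r = (2 * i + k, 2 * j + l, 1) then 1 else 0)"
    if "k < 2" "i < 2" "l < 2" "j < 2" for k i l j
    using that delta[of "(2 * i + k, 2 * j + l, 0)"] delta[of "(2 * i + k, 2 * j + l, 1)"]
    by (simp_all add: X_def flatten_apply)
  have L_add: "L c \<boxplus> L d = L (\<lambda>i. c i + d i)" for c d
    unfolding L_def using X by (rule lincomb_add) auto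
  have L_scale: "z \<odot> L c = L (\<lambda>i. z * c i)" for z c
    unfolding L_def using X by (rule lincomb_scale) auto
  have L_cong: "L c = L d" if "\<And>i. i \<in> ?I \<Longrightarrow> c i = d i" for c d
    unfolding L_def using X that by (intro lincomb_cong) auto
  have hom: "hom_part ?T t (y q) \<in> {..<2} \<rightarrow>\<^sub>E carrier A" for t
    using T.hom_part_closed[of "y q"] y1[OF q] by simp
  note coeff = mult_coeff_cliff_two[of 0 0, simplified] mult_coeff_cliff_two[of 0 1, simplified]
    mult_coeff_cliff_two[of 1 0, simplified] mult_coeff_cliff_two[of 1 1, simplified]
  have "amult (gtensor_alg ?T 2 cliff_one) x y q p =
      (amult ?T (x 0) (hom_part ?T q (y q)) p) \<boxplus> (amult ?T (x 1) (hom_part ?T (1 + q) (y q)) p)"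
    using T.gtensor_cliff_one_mult[of x y q] x y p q by simp
  also have "\<dots> = L (mult_coeff 4 cliff_two (2 * p + q))"
    unfolding gtensor_cliff_one_mult[OF x01(1) hom p]
      gtensor_cliff_one_mult[OF x01(2) hom p] hom_part_gtensor[OF y1[OF q] p] hom_part_def[of A]
    using less_two_cases[OF p] less_two_cases[OF q]
    apply (elim disjE)
    apply (simp_all add: scale_add scale_scale pre_mult_add_right pre_mult_scale_right grading_add
      grading_scale gg scale_closed pre_mult_closed grading_closed xy)
    apply (simp_all add: atoms L_scale L_add)
    apply (rule L_cong, clarify, drule less_4, drule less_4, drule less_two_cases;
        elim disjE; simp add: coeff)+
    done
  also have "\<dots> = amult (gtensor_alg A 4 cliff_two) (flatten x) (flatten y) (2 * p + q)"
    unfolding L_def X_def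
    using p q by (intro gtensor_mult[symmetric] flatten_mem xy) auto
  finally show ?thesis .
qed

text \<open>The same comparison, over the eight adjoints of possibly graded entries of
  \<open>x\<close>.\<close>

lemma flatten_adj:
  assumes x: "x \<in> {..<2} \<rightarrow>\<^sub>E ({..<2} \<rightarrow>\<^sub>E carrier A)" and p: "p < 2" and q: "q < 2"
    and gg: "\<And>a. a \<in> carrier A \<Longrightarrow> grading A (grading A a) = a"
  shows "adj (gtensor_alg (gtensor_alg A 2 cliff_one) 2 cliff_one) x q p =
    adj (gtensor_alg A 4 cliff_two) (flatten x) (2 * p + q)"
proof -
  let ?T = "gtensor_alg A 2 cliff_one"
  let ?I = "{..<4::nat} \<times> {..<2::nat}"
  define X where "X = (\<lambda>(k, s). adj A ((grading A ^^ s) (flatten x k)))"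
  define L where "L c = lincomb A ?I c X" for c
  have x01: "x 0 \<in> {..<2} \<rightarrow>\<^sub>E carrier A" "x 1 \<in> {..<2} \<rightarrow>\<^sub>E carrier A"
    using PiE_mem[OF x] by auto
  have x_mem: "x k i \<in> carrier A" if "k < 2" "i < 2" for k i
    using PiE_mem[OF x01(1)] PiE_mem[OF x01(2)] that less_two_cases[of k] by auto
  have X: "X i \<in> carrier A" if "i \<in> ?I" for i
    using that PiE_mem[OF flatten_mem[OF x_mem]]
    by (auto simp: X_def intro!: pre_adj_closed grading_pow_closed)
  have delta: "X j = L (\<lambda>i. if i = j then 1 else 0)" if "j \<in> ?I" for j
    unfolding L_def using X that by (intro lincomb_delta[symmetric]) auto
  have atoms: "adj A (x k i) = L (\<lambda>r. if r = (2 * i + k, 0) then 1 else 0)"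
    "adj A (grading A (x k i)) = L (\<lambda>r. if r = (2 * i + k, 1) then 1 else 0)"
    if "k < 2" "i < 2" for k i
    using that delta[of "(2 * i + k, 0)"] delta[of "(2 * i + k, 1)"]
    by (simp_all add: X_def flatten_apply)
  have L_add: "L c \<boxplus> L d = L (\<lambda>i. c i + d i)" for c d
    unfolding L_def using X by (rule lincomb_add) auto
  have L_scale: "z \<odot> L c = L (\<lambda>i. z * c i)" for z c
    unfolding L_def using X by (rule lincomb_scale) auto
  have L_cong: "L c = L d" if "\<And>i. i \<in> ?I \<Longrightarrow> c i = d i" for c d
    unfolding L_def using X that by (intro lincomb_cong) auto
  have hom: "hom_part ?T t (x k) \<in> {..<2} \<rightarrow>\<^sub>E carrier A" if "k = 0 \<or> k = 1" for t k
    using T.hom_part_closed[of "x k"] x01 that by auto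
  have hom_apply: "hom_part ?T t (x k) i = (1 / 2) \<odot> (x k i \<boxplus> ((- 1) ^ t \<odot> grading A (x k (1 - i))))"
    if "k = 0 \<or> k = 1" "i < 2" for t k i
    using x01 that by (intro hom_part_gtensor) auto
  note coeff = adj_coeff_cliff_two[of 0 0, simplified] adj_coeff_cliff_two[of 0 1, simplified]
    adj_coeff_cliff_two[of 1 0, simplified] adj_coeff_cliff_two[of 1 1, simplified]
  have "adj (gtensor_alg ?T 2 cliff_one) x q p =
      (adj ?T (hom_part ?T q (x 0)) p) \<boxplus> (adj ?T (hom_part ?T (1 + q) (x 1)) p)"
    using T.gtensor_cliff_one_adj[of x q] x p q by simp
  also have "\<dots> = L (adj_coeff 4 cliff_two (2 * p + q))"
    unfolding gtensor_cliff_one_adj[OF hom[OF disjI1[OF refl]] p] gtensor_cliff_one_adj[OF hom[OF disjI2[OF refl]] p]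
      hom_part_def[of A]
    using less_two_cases[OF p] less_two_cases[OF q]
    apply (elim disjE)
    apply (simp_all add: hom_apply scale_add scale_scale pre_adj_add pre_adj_scale grading_add
      grading_scale gg scale_closed pre_adj_closed grading_closed x_mem)
    apply (simp_all add: atoms L_scale L_add)
    apply (rule L_cong, clarify, drule less_4, drule less_two_cases; elim disjE; simp add: coeff)+
    done
  also have "\<dots> = adj (gtensor_alg A 4 cliff_two) (flatten x) (2 * p + q)"
    unfolding L_def X_def
    using p q by (intro gtensor_adj[symmetric] flatten_mem x_mem) auto
  finally show ?thesis .
qed

lemma flatten_grading:
  assumes x: "x \<in> {..<2} \<rightarrow>\<^sub>E ({..<2} \<rightarrow>\<^sub>E carrier A)" and p: "p < 2" and q: "q < 2"
  shows "grading (gtensor_alg (gtensor_alg A 2 cliff_one) 2 cliff_one) x q p =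
    grading (gtensor_alg A 4 cliff_two) (flatten x) (2 * p + q)"
proof -
  have x1: "x k \<in> {..<2} \<rightarrow>\<^sub>E carrier A" if "k < 2" for k
    using PiE_mem[OF x] that by auto
  have x_mem: "x k i \<in> carrier A" if "k < 2" "i < 2" for k i
    using PiE_mem[OF x1] that by auto
  have mem: "grading A (flatten x k) \<in> carrier A" if "k \<in> {..<4}" for k
    using PiE_mem[OF flatten_mem[OF x_mem] that] by (rule grading_closed)
  have "grading (gtensor_alg (gtensor_alg A 2 cliff_one) 2 cliff_one) x q p = grading A (x (1 - q) (1 - p))"
    using T.gtensor_cliff_one_grading[of x q] gtensor_cliff_one_grading[OF x1[of "1 - q"] p] x q
    by (simp del: gtensor_alg_simps(5))
  \<comment> \<open>Exchanging both indices is the reflection of the flattened index.\<close>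
  also have "\<dots> = grading A (flatten x (3 - (2 * p + q)))"
    using less_two_cases[OF p] less_two_cases[OF q] by (auto simp: flatten_def)
  also have "\<dots> = lincomb A {..<4} (\<lambda>k. if k = 3 - (2 * p + q) then 1 else 0) (\<lambda>k. grading A (flatten x k))"
    using mem p q by (intro lincomb_delta[symmetric]) auto
  also have "\<dots> = grading (gtensor_alg A 4 cliff_two) (flatten x) (2 * p + q)"
    using mem p q by (simp add: grading_cliff_two)
  finally show ?thesis .
qed

end

text \<open>The associativity isomorphism for two factors Cliff_1: \<open>flatten\<close> uses the
  same packing as \<open>cliff\<close>, so elementary basis tensors correspond without further
  identification.\<close>

theorem (in graded_star_algebra) flatten_iso:
  "graded_star_iso ({..<2} \<rightarrow>\<^sub>E ({..<2} \<rightarrow>\<^sub>E carrier A))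
     (gtensor_alg (gtensor_alg A 2 cliff_one) 2 cliff_one) (gtensor_alg A 4 cliff_two) flatten"
    (is "graded_star_iso ?U ?TT ?D _")
proof -
  interpret T: graded_prealgebra "gtensor_alg A 2 cliff_one"
    by (rule gtensor_prealgebra)
  interpret TT: graded_prealgebra ?TT
    by (rule T.gtensor_prealgebra)
  have carrier: "carrier ?TT = ?U"
    by simp
  have mem: "x k i \<in> carrier A" if x: "x \<in> ?U" and "k < 2" "i < 2" for x k i
    using PiE_mem[OF PiE_mem[OF x]] that by simp
  have ext: "flatten x \<in> extensional {..<4}" for x :: "nat \<Rightarrow> nat \<Rightarrow> 'a"
    by (simp add: flatten_def)
  have eqI: "flatten x = y" if "y \<in> extensional {..<4}"
    and eq: "\<And>p q. p < 2 \<Longrightarrow> q < 2 \<Longrightarrow> x q p = y (2 * p + q)" for x y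
  proof (rule extensionalityI[OF ext that(1)])
    fix k :: nat assume "k \<in> {..<4}"
    then have "k < 4" by simp
    then show "flatten x k = y k"
      by (rule less_four_cases) (use eq in \<open>simp add: flatten_apply\<close>)
  qed
  show ?thesis
  proof (rule graded_star_iso.intro)
    show "inj_on flatten ?U"
    proof (rule inj_onI)
      fix x y assume x: "x \<in> ?U" and y: "y \<in> ?U" and eq: "flatten x = flatten y"
      have "x q p = y q p" if "p < 2" "q < 2" for p q
        using that eq by (metis flatten_apply)
      then show "x = y"
        using x y by (intro PiE_ext[OF x y] PiE_ext[OF PiE_mem[OF x] PiE_mem[OF y]]) auto
    qed
    show "flatten ` carrier ?TT = carrier ?D"
      unfolding carrier gtensor_alg_simps
    proof (intro subset_antisym subsetI)
      fix y assume "y \<in> flatten ` ?U"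
      then show "y \<in> {..<4} \<rightarrow>\<^sub>E carrier A"
        using flatten_mem mem by blast
    next
      fix y assume y: "y \<in> {..<4::nat} \<rightarrow>\<^sub>E carrier A"
      \<comment> \<open>The inverse re-indexing: entry \<open>2 * p + q\<close> returns to component
        \<open>p\<close> of the vector at \<open>q\<close>.\<close>
      define x where "x = (\<lambda>q\<in>{..<2}. \<lambda>p\<in>{..<2::nat}. y (2 * p + q :: nat))"
      have "x \<in> ?U"
        unfolding x_def restrict_PiE_iff using PiE_mem[OF y] less_four_index by auto
      moreover have "flatten x = y"
        using y by (intro eqI) (simp_all add: x_def PiE_iff)
      ultimately show "y \<in> flatten ` ?U"
        by blast
    qed
    show "flatten (vzero ?TT) = vzero ?D"
      by (intro eqI) simp_all
  next
    fix x assume x: "x \<in> ?U"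
    show "flatten (vscale ?TT z x) = vscale ?D z (flatten x)" for z
      by (intro eqI) (simp_all add: flatten_apply)
    show "flatten (adj ?TT x) = adj ?D (flatten x)"
      using flatten_adj[OF x] by (intro eqI adj_extensional) (simp add: grading_grading)
    show "flatten (grading ?TT x) = grading ?D (flatten x)"
      using flatten_grading[OF x] by (intro eqI grading_extensional) (simp del: gtensor_alg_simps)
    show "vscale ?TT z x \<in> ?U" for z
      using TT.scale_closed[of x z] x by (simp only: carrier)
    show "adj ?TT x \<in> ?U" "grading ?TT x \<in> ?U"
      using TT.pre_adj_closed[of x] TT.grading_closed[of x] x by (simp_all only: carrier)
    fix y assume y: "y \<in> ?U"
    show "flatten (vadd ?TT x y) = vadd ?D (flatten x) (flatten y)"
      by (intro eqI) (simp_all add: flatten_apply)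
    show "flatten (amult ?TT x y) = amult ?D (flatten x) (flatten y)"
      using flatten_mult[OF x y] by (intro eqI mult_extensional) (simp add: grading_grading)
    show "vadd ?TT x y \<in> ?U" "amult ?TT x y \<in> ?U"
      using TT.add_closed[of x y] TT.pre_mult_closed[of x y] x y by (simp_all only: carrier)
  qed (use TT.zero_closed in \<open>simp_all only: carrier subset_refl\<close>)
qed

lemma gtensor_alg_with_least_norm: "gtensor_alg (with_least_norm A) m D = gtensor_alg A m D"
  by (simp add: gtensor_alg_def hom_part_def add_grp_def)

lemma KK_least_norm_iso:
  assumes "graded_star_iso (carrier A) A A' f"
  shows "KK D (with_least_norm A) \<cong> KK D (with_least_norm A')"
  using graded_cstar_iso_least_norm[OF assms]
  by (intro graded_cstar_iso_carrier.KK_iso) (simp add: graded_cstar_iso_carrier_def)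

theorem corollary3p8:
  fixes B :: "'b graded_cstar"
  assumes "graded_cstar_algebra B" and "separable_cstar B"
  shows "Kgr_zero (crossed_product B) \<cong> Kgr_zero (B \<otimes>Cliff 1)
      \<and> Kgr_zero (B \<otimes>Cliff 1) = Kgr 1 B
      \<and> Kgr 1 (crossed_product B) \<cong> Kgr 1 (B \<otimes>Cliff 1)
      \<and> Kgr 1 (B \<otimes>Cliff 1) \<cong> Kgr 2 B"
proof -
  interpret B: graded_cstar_algebra B by fact
  let ?T = "gtensor_alg B 2 cliff_one"
  have cliff: "B \<otimes>Cliff 1 = with_least_norm ?T" "A \<otimes>Cliff 1 = with_least_norm (gtensor_alg A 2 cliff_one)"
    for A :: "'c graded_cstar"
    by (simp_all add: gtensor_def)
  have cliff_two: "B \<otimes>Cliff 2 = with_least_norm (gtensor_alg B 4 cliff_two)"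
    by (simp add: gtensor_def cliff_2)
  \<comment> \<open>Tensoring the isomorphism for the crossed product with Cliff_1 handles degree
    one.\<close>
  have lifted: "graded_star_iso ({..<2} \<rightarrow>\<^sub>E carrier (crossed_alg B)) (gtensor_alg (crossed_alg B) 2 cliff_one)
      (gtensor_alg ?T 2 cliff_one) (\<lambda>x. \<lambda>p\<in>{..<2}. B.crossed_to_tensor (x p))"
    using crossed_complex_space[OF B.complex_space_axioms] B.gtensor_complex_space
    by (rule graded_star_iso.gtensor_iso[OF B.crossed_iso]) simp
  have "Kgr_zero (crossed_product B) \<cong> Kgr_zero (B \<otimes>Cliff 1)"
    unfolding Kgr_zero_def crossed_product_def cliff
    using B.crossed_iso by (rule KK_least_norm_iso)
  moreover have "Kgr_zero (B \<otimes>Cliff 1) = Kgr 1 B"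
    by (simp add: Kgr_zero_def Kgr_def)
  moreover have "Kgr 1 (crossed_product B) \<cong> Kgr 1 (B \<otimes>Cliff 1)"
    unfolding Kgr_def crossed_product_def cliff gtensor_alg_with_least_norm
    using lifted by (intro KK_least_norm_iso) simp
  \<comment> \<open>Two successive factors \<open>cliff_one\<close> are compared with the single
    four-dimensional factor \<open>cliff_two\<close>.\<close>
  moreover have "Kgr 1 (B \<otimes>Cliff 1) \<cong> Kgr 2 B"
    unfolding Kgr_def cliff cliff_two gtensor_alg_with_least_norm
    using B.flatten_iso by (intro KK_least_norm_iso) simp
  ultimately show ?thesis
    by blast
qed

end
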